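(* Let $\mathbb X$ and $\mathbb Y$ be flow spaces admitting expansions $(X_i,f_i,p_i)$ about $x_\bullet$ and $(Y_i,g_i,q_i)$ about $y_\bullet$ respectively. Then there is a flow equivalence $h\colon\mathbb X\to\mathbb Y$ with $h(x_\bullet)=y_\bullet$ if and only if the inverse sequences $\Pi((X_i,f_i))$ and $\Pi((Y_i,g_i))$ are isomorphic inverse sequences in $\mathcal P_F$. (Equivalently, $\overline{\pi_1^+}(\mathbb X,x_\bullet)=\overline{\pi_1^+}(\mathbb Y,y_\bullet)$, where $\overline{\pi_1^+}(\mathbb X,x_\bullet)$ denotes the isomorphism class of $\Pi$ of any expansion of $\mathbb X$ about $x_\bullet$.)
   Context: Flow space: compact metrizable space of topological dimension one with a continuous $\mathbb R$-action without fixed points. Flow equivalence: homeomorphism mapping orbits onto orbits preserving flow orientation. Expansion of $\mathbb X$ about $x_\bullet$: oriented wedges of circles $X_i$ with wedge points $x_i$, positive maps $f_i\colon X_{i+1}\to X_i$ (continuous surjections, wedge point to wedge point, orientation preserving on each circle, locally injective away from the wedge point), projections $p_i\colon\mathbb X\to X_i$ (continuous surjections, locally injective and orientation preserving along orbits) with $p_i(x_\bullet)=x_i$, $p_n=f_n\circ\cdots\circ f_{m-1}\circ p_m$ for $m>n$, and $x\mapsto(p_i(x))_i$ a homeomorphism onto $\varprojlim(X_i,f_i)$. $\mathcal P_F$: objects are pairs $(F,\mathcal G)$, $F$ a free group of finite rank and $\mathcal G$ a chosen free basis (positive generators); morphisms are positive homomorphisms, i.e. homomorphisms mapping the semigroup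 generated by the source basis into the semigroup generated by the target basis. $\Pi((X_i,f_i))$ is the inverse sequence $\big((\pi_1(X_i,x_i),\mathcal G_i),\pi_1(f_i)\big)$, where $\mathcal G_i$ consists of the homotopy classes of loops going once around a single circle of $X_i$ in its positive direction. Two inverse sequences $(G_i,\sigma_i)$, $(H_i,\tau_i)$ in $\mathcal P_F$ are isomorphic if there are increasing $m_k$, $n_k$ and positive homomorphisms $d_k\colon G_{m_k}\to H_{n_k}$, $u_k\colon H_{n_{k+1}}\to G_{m_k}$ with $u_kd_{k+1}=\sigma_{m_k}\circ\cdots\circ\sigma_{m_{k+1}-1}$ and $d_ku_k=\tau_{n_k}\circ\cdots\circ\tau_{n_{k+1}-1}$ for all $k$. *)

theory Defs
  imports "HOL-Analysis.Analysis" "HOL-Algebra.Group"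
begin

definition cover_dim_le :: "'a topology \<Rightarrow> nat \<Rightarrow> bool" where
  "cover_dim_le X n \<longleftrightarrow>
     (\<forall>\<U>. finite \<U> \<and> (\<forall>U\<in>\<U>. openin X U) \<and> topspace X \<subseteq> \<Union>\<U> \<longrightarrow>
        (\<exists>\<V>. finite \<V> \<and> (\<forall>V\<in>\<V>. openin X V) \<and> topspace X \<subseteq> \<Union>\<V> \<and>
             (\<forall>V\<in>\<V>. \<exists>U\<in>\<U>. V \<subseteq> U) \<and>
             (\<forall>x\<in>topspace X. card {V\<in>\<V>. x \<in> V} \<le> Suc n)))"

definition topological_dimension_one :: "'a topology \<Rightarrow> bool" where
  "topological_dimension_one X \<longleftrightarrow> cover_dim_le X 1 \<and> \<not> cover_dim_le X 0"

definition flow_space :: "'a topology \<Rightarrow> (real \<Rightarrow> 'a \<Rightarrow> 'a) \<Rightarrow> bool" where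
  "flow_space X \<phi> \<longleftrightarrow>
     compact_space X \<and> metrizable_space X \<and> topological_dimension_one X \<and>
     continuous_map (prod_topology euclideanreal X) X (\<lambda>(t, x). \<phi> t x) \<and>
     (\<forall>x\<in>topspace X. \<phi> 0 x = x) \<and>
     (\<forall>x\<in>topspace X. \<forall>s t. \<phi> (s + t) x = \<phi> s (\<phi> t x)) \<and>
     (\<forall>x\<in>topspace X. \<exists>t. \<phi> t x \<noteq> x)"

text \<open>Flow equivalence: a homeomorphism mapping orbits onto orbits preserving the flow
orientation, i.e. along each orbit it is given by an increasing reparametrisation of time.\<close>
definition flow_equivalence ::
  "'a topology \<Rightarrow> (real \<Rightarrow> 'a \<Rightarrow> 'a) \<Rightarrow> 'b topology \<Rightarrow> (real \<Rightarrow> 'b \<Rightarrow> 'b) \<Rightarrow> ('a \<Rightarrow> 'b) \<Rightarrow> bool"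
  where
  "flow_equivalence X \<phi> Y \<psi> h \<longleftrightarrow>
     homeomorphic_map X Y h \<and>
     (\<forall>x\<in>topspace X. \<exists>\<tau>::real \<Rightarrow> real. strict_mono \<tau> \<and> surj \<tau> \<and>
        (\<forall>t. h (\<phi> t x) = \<psi> (\<tau> t) (h x)))"

text \<open>W is an oriented wedge of n circles with wedge point w: the k-th circle (k < n) is
parametrised, in its positive direction, by the loop c k on [0,1], injective on [0,1[,
based at w; the circles cover W and pairwise meet only in w.\<close>
definition oriented_wedge :: "'a topology \<Rightarrow> 'a \<Rightarrow> nat \<Rightarrow> (nat \<Rightarrow> real \<Rightarrow> 'a) \<Rightarrow> bool" where
  "oriented_wedge W w n c \<longleftrightarrow>
     Hausdorff_space W \<and> 0 < n \<and>
     (\<forall>k<n. pathin W (c k) \<and> c k 0 = w \<and> c k 1 = w \<and> inj_on (c k) {0..<1}) \<and>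
     topspace W = (\<Union>k<n. c k ` {0..1}) \<and>
     (\<forall>k<n. \<forall>j<n. k \<noteq> j \<longrightarrow> c k ` {0..1} \<inter> c j ` {0..1} = {w})"

text \<open>A curve gamma into the oriented wedge is locally injective and orientation preserving
at time t0: on a small left and a small right half-neighbourhood of t0 it runs along one
circle with strictly increasing parameter.\<close>
definition locally_positive ::
  "(nat \<Rightarrow> real \<Rightarrow> 'a) \<Rightarrow> nat \<Rightarrow> (real \<Rightarrow> 'a) \<Rightarrow> real \<Rightarrow> bool" where
  "locally_positive c n \<gamma> t0 \<longleftrightarrow>
     (\<exists>\<epsilon>>0.
       (\<exists>k<n. \<exists>s. strict_mono_on {t0-\<epsilon>..t0} s \<and> s ` {t0-\<epsilon>..t0} \<subseteq> {0..1} \<and>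
                   (\<forall>t\<in>{t0-\<epsilon>..t0}. \<gamma> t = c k (s t))) \<and>
       (\<exists>k<n. \<exists>s. strict_mono_on {t0..t0+\<epsilon>} s \<and> s ` {t0..t0+\<epsilon>} \<subseteq> {0..1} \<and>
                   (\<forall>t\<in>{t0..t0+\<epsilon>}. \<gamma> t = c k (s t))))"

definition positive_map ::
  "'a topology \<Rightarrow> 'a \<Rightarrow> nat \<Rightarrow> (nat \<Rightarrow> real \<Rightarrow> 'a) \<Rightarrow>
   'a topology \<Rightarrow> 'a \<Rightarrow> nat \<Rightarrow> (nat \<Rightarrow> real \<Rightarrow> 'a) \<Rightarrow> ('a \<Rightarrow> 'a) \<Rightarrow> bool" where
  "positive_map W' w' n' c' W w n c f \<longleftrightarrow>
     continuous_map W' W f \<and> f ` topspace W' = topspace W \<and> f w' = w \<and>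
     (\<forall>k<n'. \<forall>t0\<in>{0<..<1}. locally_positive c n (f \<circ> c' k) t0)"

fun bond :: "(nat \<Rightarrow> 'a \<Rightarrow> 'a) \<Rightarrow> nat \<Rightarrow> nat \<Rightarrow> 'a \<Rightarrow> 'a" where
  "bond f n 0 = id"
| "bond f n (Suc j) = bond f n j \<circ> f (n + j)"

definition expansion ::
  "'a topology \<Rightarrow> (real \<Rightarrow> 'a \<Rightarrow> 'a) \<Rightarrow> 'a \<Rightarrow>
   (nat \<Rightarrow> 'b topology) \<Rightarrow> (nat \<Rightarrow> 'b) \<Rightarrow> (nat \<Rightarrow> nat) \<Rightarrow> (nat \<Rightarrow> nat \<Rightarrow> real \<Rightarrow> 'b) \<Rightarrow>
   (nat \<Rightarrow> 'b \<Rightarrow> 'b) \<Rightarrow> (nat \<Rightarrow> 'a \<Rightarrow> 'b) \<Rightarrow> bool" where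
  "expansion X \<phi> x0 Xs xs n c f p \<longleftrightarrow>
     x0 \<in> topspace X \<and>
     (\<forall>i. oriented_wedge (Xs i) (xs i) (n i) (c i)) \<and>
     (\<forall>i. positive_map (Xs (Suc i)) (xs (Suc i)) (n (Suc i)) (c (Suc i))
                       (Xs i) (xs i) (n i) (c i) (f i)) \<and>
     (\<forall>i. continuous_map X (Xs i) (p i) \<and> p i ` topspace X = topspace (Xs i) \<and>
          (\<forall>x\<in>topspace X. \<forall>t0. locally_positive (c i) (n i) (\<lambda>t. p i (\<phi> t x)) t0) \<and>
          p i x0 = xs i) \<and>
     (\<forall>i j. \<forall>x\<in>topspace X. p i x = bond f i j (p (i + j) x)) \<and>
     homeomorphic_map X
       (subtopology (product_topology Xs UNIV)
          {z. \<forall>i. z i \<in> topspace (Xs i) \<and> z i = f i (z (Suc i))})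
       (\<lambda>x i. p i x)"

definition loopin :: "'a topology \<Rightarrow> 'a \<Rightarrow> (real \<Rightarrow> 'a) \<Rightarrow> bool" where
  "loopin W w g \<longleftrightarrow> pathin W g \<and> g 0 = w \<and> g 1 = w"

definition loop_homotopic :: "'a topology \<Rightarrow> 'a \<Rightarrow> (real \<Rightarrow> 'a) \<Rightarrow> (real \<Rightarrow> 'a) \<Rightarrow> bool" where
  "loop_homotopic W w g h \<longleftrightarrow>
     homotopic_with (\<lambda>r. r 0 = w \<and> r 1 = w) (top_of_set {0..1}) W g h"

definition loop_class :: "'a topology \<Rightarrow> 'a \<Rightarrow> (real \<Rightarrow> 'a) \<Rightarrow> (real \<Rightarrow> 'a) set" where
  "loop_class W w g = {h. loopin W w h \<and> loop_homotopic W w g h}"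

definition concat_path :: "(real \<Rightarrow> 'a) \<Rightarrow> (real \<Rightarrow> 'a) \<Rightarrow> real \<Rightarrow> 'a" where
  "concat_path g1 g2 = (\<lambda>x. if x \<le> 1/2 then g1 (2 * x) else g2 (2 * x - 1))"

definition fundamental_group :: "'a topology \<Rightarrow> 'a \<Rightarrow> ((real \<Rightarrow> 'a) set) monoid" where
  "fundamental_group W w =
     \<lparr>carrier = {loop_class W w g | g. loopin W w g},
      mult = (\<lambda>A B. {h. loopin W w h \<and>
                        (\<exists>a\<in>A. \<exists>b\<in>B. loop_homotopic W w (concat_path a b) h)}),
      one = loop_class W w (\<lambda>_. w)\<rparr>"

definition pi1_map :: "'b topology \<Rightarrow> 'b \<Rightarrow> ('a \<Rightarrow> 'b) \<Rightarrow> (real \<Rightarrow> 'a) set \<Rightarrow> (real \<Rightarrow> 'b) set" where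
  "pi1_map W w f A = {h. loopin W w h \<and> (\<exists>a\<in>A. loop_homotopic W w (f \<circ> a) h)}"

definition pos_generators ::
  "'a topology \<Rightarrow> 'a \<Rightarrow> nat \<Rightarrow> (nat \<Rightarrow> real \<Rightarrow> 'a) \<Rightarrow> (real \<Rightarrow> 'a) set set" where
  "pos_generators W w n c = {loop_class W w (c k) | k. k < n}"

inductive_set pos_semigroup :: "('g, 'm) monoid_scheme \<Rightarrow> 'g set \<Rightarrow> 'g set"
  for G S where
  gen: "s \<in> S \<Longrightarrow> s \<in> pos_semigroup G S"
| mult: "a \<in> pos_semigroup G S \<Longrightarrow> b \<in> pos_semigroup G S \<Longrightarrow> a \<otimes>\<^bsub>G\<^esub> b \<in> pos_semigroup G S"

definition positive_hom ::
  "('g, 'm) monoid_scheme \<Rightarrow> 'g set \<Rightarrow> ('h, 'n) monoid_scheme \<Rightarrow> 'h set \<Rightarrow> ('g \<Rightarrow> 'h) \<Rightarrow> bool" where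
  "positive_hom G S H T d \<longleftrightarrow> d \<in> hom G H \<and> d ` pos_semigroup G S \<subseteq> pos_semigroup H T"

fun hcomp :: "(nat \<Rightarrow> 'g \<Rightarrow> 'g) \<Rightarrow> nat \<Rightarrow> nat \<Rightarrow> 'g \<Rightarrow> 'g" where
  "hcomp \<sigma> n 0 = id"
| "hcomp \<sigma> n (Suc j) = hcomp \<sigma> n j \<circ> \<sigma> (n + j)"

definition iso_inverse_seq ::
  "(nat \<Rightarrow> ('g, 'm) monoid_scheme) \<Rightarrow> (nat \<Rightarrow> 'g set) \<Rightarrow> (nat \<Rightarrow> 'g \<Rightarrow> 'g) \<Rightarrow>
   (nat \<Rightarrow> ('h, 'n) monoid_scheme) \<Rightarrow> (nat \<Rightarrow> 'h set) \<Rightarrow> (nat \<Rightarrow> 'h \<Rightarrow> 'h) \<Rightarrow> bool" where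
  "iso_inverse_seq G S \<sigma> H T \<tau> \<longleftrightarrow>
     (\<exists>m l d u. strict_mono m \<and> strict_mono l \<and>
        (\<forall>k. positive_hom (G (m k)) (S (m k)) (H (l k)) (T (l k)) (d k)) \<and>
        (\<forall>k. positive_hom (H (l (Suc k))) (T (l (Suc k))) (G (m k)) (S (m k)) (u k)) \<and>
        (\<forall>k. \<forall>a\<in>carrier (G (m (Suc k))).
              u k (d (Suc k) a) = hcomp \<sigma> (m k) (m (Suc k) - m k) a) \<and>
        (\<forall>k. \<forall>b\<in>carrier (H (l (Suc k))).
              d k (u k b) = hcomp \<tau> (l k) (l (Suc k) - l k) b))"

definition Pi_groups :: "(nat \<Rightarrow> 'b topology) \<Rightarrow> (nat \<Rightarrow> 'b) \<Rightarrow> nat \<Rightarrow> ((real \<Rightarrow> 'b) set) monoid" where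
  "Pi_groups Xs xs i = fundamental_group (Xs i) (xs i)"

definition Pi_gens ::
  "(nat \<Rightarrow> 'b topology) \<Rightarrow> (nat \<Rightarrow> 'b) \<Rightarrow> (nat \<Rightarrow> nat) \<Rightarrow> (nat \<Rightarrow> nat \<Rightarrow> real \<Rightarrow> 'b) \<Rightarrow>
   nat \<Rightarrow> (real \<Rightarrow> 'b) set set" where
  "Pi_gens Xs xs n c i = pos_generators (Xs i) (xs i) (n i) (c i)"

definition Pi_maps ::
  "(nat \<Rightarrow> 'b topology) \<Rightarrow> (nat \<Rightarrow> 'b) \<Rightarrow> (nat \<Rightarrow> 'b \<Rightarrow> 'b) \<Rightarrow> nat \<Rightarrow> (real \<Rightarrow> 'b) set \<Rightarrow> (real \<Rightarrow> 'b) set" where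
  "Pi_maps Xs xs f i = pi1_map (Xs i) (xs i) (f i)"

end

theory Submission
  imports Defs
begin

text \<open>Every wedge maps to the circle by a clock that forgets on which circle a point lies. A positive
curve is a strictly increasing lift of its clock together with the sequence of circles it runs
through, so up to reparametrisation a positive map is given by positive words.

If the towers of positive words are isomorphic, reparametrisation turns the maps into a ladder that
commutes exactly, and its limit is a homeomorphism \<open>h\<close>. It maps orbits into orbits because the fibres
of a clock contain no non-constant curves, and it preserves their direction because clocks advance.

Conversely, given \<open>h\<close>, both expansions are towers over the same flow. Far up in one tower, two orbit
segments over the same circle are so close that they read the same word in a given stage of the
other tower, which defines the connecting homomorphisms. End points which only come close to
the wedge point are moved to the nearest passage through it, and this is consistent for stages
chosen far enough apart.\<close>

section \<open>Lifts to the real line\<close>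

text \<open>An isomorphism of sequences is a statement about whole fundamental groups, whereas the
  geometry yields words. Towards an isomorphism this gap is closed by homotopies: positive maps with
  the same words are homotopic relative to the wedge point, so the induced maps agree on all loop
  classes at once. Starting from an isomorphism, its equations are evaluated on generators, where
  both sides are positive words, and winding numbers tell positive words apart.

  Triangles that commute only up to homotopy do not pass to an inverse limit. Hence each map of the
  ladder is obtained by lifting a bonding map through the map chosen before it.

  Angles are counted in turns: passages through the wedge point are the integer values of a lift,
  and a letter is read between two consecutive integers. Near the wedge point means that the clock
  has positive real part, that is, less than a quarter turn from an integer. Three such errors stay
  below one turn, so rounding is compatible with comparing two curves. Distances are measured
  between values of clocks and of collapsing maps; compactness makes them uniformly small on the
  fibres of high stages.\<close>

lemma cis_2pi_eq_iff: "cis (2 * pi * a) = cis (2 * pi * b) \<longleftrightarrow> (\<exists>i::int. a = b + of_int i)"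
proof -
  have "cis (2 * pi * a) = cis (2 * pi * b) \<longleftrightarrow> (\<exists>i::int. 2 * pi * a = 2 * pi * b + 2 * pi * of_int i)"
    using sin_cos_eq_iff[of "2 * pi * a" "2 * pi * b"] by (auto simp: complex_eq_iff)
  also have "\<dots> \<longleftrightarrow> (\<exists>i::int. 2 * pi * a = 2 * pi * (b + of_int i))"
    by (simp add: distrib_left)
  finally show ?thesis by simp
qed

lemma cis_2pi_int [simp]: "cis (2 * pi * real_of_int i) = 1"
  using cis_2pi_eq_iff[of "real_of_int i" 0] by auto

lemma cis_2pi_frac: "cis (2 * pi * frac u) = cis (2 * pi * u)"
  unfolding cis_2pi_eq_iff frac_def by (intro exI[of _ "-\<lfloor>u\<rfloor>"]) simp

lemma cis_2pi_eq_1_iff: "cis (2 * pi * a) = 1 \<longleftrightarrow> a \<in> \<int>"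
  using cis_2pi_eq_iff[of a 0] by (auto elim!: Ints_cases)

lemma integer_valued_constant:
  fixes f :: "'a::topological_space \<Rightarrow> real"
  assumes S: "connected S" and f: "continuous_on S f" "\<And>x. x \<in> S \<Longrightarrow> f x \<in> \<int>"
    and xy: "x \<in> S" "y \<in> S"
  shows "f x = f y"
proof -
  have "f constant_on S"
  proof (rule continuous_discrete_range_constant[OF S f(1)])
    fix x assume "x \<in> S"
    have "1 \<le> norm (f y - f x)" if "y \<in> S" "f y \<noteq> f x" for y
      using f(2)[OF \<open>x \<in> S\<close>] f(2)[OF that(1)] that(2)
      by (auto elim!: Ints_cases simp flip: of_int_diff of_int_abs)
    then show "\<exists>e>0. \<forall>y. y \<in> S \<and> f y \<noteq> f x \<longrightarrow> e \<le> norm (f y - f x)"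
      by (intro exI[of _ 1]) auto
  qed
  with xy show ?thesis by (auto simp: constant_on_def)
qed

text \<open>A convex set is contractible, so a function without zeros has a continuous logarithm
  there; modulus one kills its real part. Dividing the imaginary part by 2 pi makes lifts count
  turns.\<close>

lemma circle_lift:
  fixes F :: "'a::real_normed_vector \<Rightarrow> complex"
  assumes S: "convex S" and F: "continuous_on S F" "\<And>x. x \<in> S \<Longrightarrow> norm (F x) = 1"
  obtains \<Theta> where "continuous_on S \<Theta>" "\<And>x. x \<in> S \<Longrightarrow> F x = cis (2 * pi * \<Theta> x)"
proof -
  obtain g where g: "continuous_on S g" "\<And>x. x \<in> S \<Longrightarrow> F x = exp (g x)"
    by (rule continuous_logarithm_on_contractible[OF F(1) convex_imp_contractible[OF S]])
      (use F(2) in force)+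
  show thesis
  proof
    show "continuous_on S (\<lambda>x. Im (g x) / (2 * pi))"
      by (intro continuous_intros g) simp
    show "F x = cis (2 * pi * (Im (g x) / (2 * pi)))" if "x \<in> S" for x
    proof -
      have "Re (g x) = 0" using F(2)[OF that] g(2)[OF that] by simp
      then show ?thesis using g(2)[OF that] by (simp add: exp_eq_polar)
    qed
  qed
qed

lemma circle_lift_unique:
  fixes \<Theta>1 \<Theta>2 :: "'a::topological_space \<Rightarrow> real"
  assumes S: "connected S" and c: "continuous_on S \<Theta>1" "continuous_on S \<Theta>2"
    and eq: "\<And>x. x \<in> S \<Longrightarrow> cis (2 * pi * \<Theta>1 x) = cis (2 * pi * \<Theta>2 x)"
  obtains N :: int where "\<And>x. x \<in> S \<Longrightarrow> \<Theta>1 x = \<Theta>2 x + of_int N"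
proof (cases "S = {}")
  case False
  then obtain x0 where x0: "x0 \<in> S" by blast
  have i: "\<Theta>1 x - \<Theta>2 x \<in> \<int>" if "x \<in> S" for x
    using eq[OF that] by (auto simp: cis_2pi_eq_iff)
  have "\<Theta>1 x - \<Theta>2 x = \<Theta>1 x0 - \<Theta>2 x0" if "x \<in> S" for x
    by (rule integer_valued_constant[OF S, of "\<lambda>x. \<Theta>1 x - \<Theta>2 x"])
      (use c i that x0 in \<open>auto intro!: continuous_intros\<close>)
  moreover obtain N where "\<Theta>1 x0 - \<Theta>2 x0 = of_int N" using i[OF x0] by (auto elim: Ints_cases)
  ultimately show thesis using that[of N] by (metis add.commute diff_add_cancel)
qed (use that in auto)

text \<open>A maximum over \<open>{a..b}\<close> cannot be attained before \<open>b\<close>, since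
  the function still grows to the right of it. Growth is known at interior points only, because
  positive maps are controlled only away from the ends of a circle.\<close>

lemma strict_mono_on_of_right_increasing:
  fixes \<Theta> :: "real \<Rightarrow> real"
  assumes S: "convex S" and cont: "continuous_on S \<Theta>"
    and inc: "\<And>t. t \<in> interior S \<Longrightarrow> \<exists>e>0. \<forall>t'\<in>S. t < t' \<and> t' \<le> t + e \<longrightarrow> \<Theta> t < \<Theta> t'"
  shows "strict_mono_on S \<Theta>"
proof -
  have sub: "{a..b} \<subseteq> S" if "a \<in> S" "b \<in> S" for a b
    using S that by (metis convex_contains_segment closed_segment_eq_real_ivl atLeastatMost_empty_iff2 empty_subsetI)
  have int: "{a<..<b} \<subseteq> interior S" if "a \<in> S" "b \<in> S" for a b
    by (rule interior_maximal) (use sub[OF that] in auto)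
  have 1: "\<Theta> a < \<Theta> b" if "a \<in> interior S" "b \<in> S" "a < b" for a b
  proof -
    have aS: "a \<in> S" using that interior_subset by blast
    have "continuous_on {a..b} \<Theta>" using cont sub[OF aS \<open>b \<in> S\<close>] continuous_on_subset by blast
    then obtain t where t: "t \<in> {a..b}" "\<And>y. y \<in> {a..b} \<Longrightarrow> \<Theta> y \<le> \<Theta> t"
      using continuous_attains_sup[of "{a..b}" \<Theta>] \<open>a < b\<close> by auto
    have nt: "t = b"
    proof (rule ccontr)
      assume "t \<noteq> b"
      then have tb: "t < b" using t by auto
      have "t \<in> interior S" using int[OF aS \<open>b \<in> S\<close>] t(1) tb that(1) by (cases "t = a") auto
      then obtain e where e: "e > 0" "\<And>t'. t' \<in> S \<Longrightarrow> t < t' \<Longrightarrow> t' \<le> t + e \<Longrightarrow> \<Theta> t < \<Theta> t'"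
        using inc by blast
      define t' where "t' = min b (t + e)"
      have "\<Theta> t < \<Theta> t'"
        by (rule e(2)) (use e(1) tb t(1) sub[OF aS \<open>b \<in> S\<close>] in \<open>auto simp: t'_def\<close>)
      moreover have "\<Theta> t' \<le> \<Theta> t" using t tb e by (auto simp: t'_def)
      ultimately show False by simp
    qed
    obtain e where e: "e > 0" "\<And>t'. t' \<in> S \<Longrightarrow> a < t' \<Longrightarrow> t' \<le> a + e \<Longrightarrow> \<Theta> a < \<Theta> t'"
      using inc[OF \<open>a \<in> interior S\<close>] by blast
    define t' where "t' = min b (a + e)"
    have "\<Theta> a < \<Theta> t'"
      by (rule e(2)) (use e(1) sub[OF aS \<open>b \<in> S\<close>] \<open>a < b\<close> in \<open>auto simp: t'_def\<close>)
    also have "\<Theta> t' \<le> \<Theta> b" using t(2)[of t'] nt e \<open>a < b\<close> by (auto simp: t'_def)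
    finally show ?thesis .
  qed
  show ?thesis
  proof (rule strict_mono_onI)
    fix a b assume ab: "a \<in> S" "b \<in> S" "a < b"
    define m where "m = (a + b) / 2"
    have m: "a < m" "m < b" using ab by (auto simp: m_def)
    have mS: "m \<in> interior S" using int[OF ab(1,2)] m by auto
    \<comment> \<open>The left end need not be interior. If \<open>\<Theta>\<close> fell from
      \<open>a\<close> to \<open>m\<close>, some interior \<open>d\<close> before \<open>m\<close>
      would carry the mean of the two values, which exceeds \<open>\<Theta> m\<close> and
      contradicts the growth already shown from interior points.\<close>
    have "\<Theta> a \<le> \<Theta> m"
    proof (rule ccontr)
      assume n: "\<not> \<Theta> a \<le> \<Theta> m"
      have "continuous_on {a..m} \<Theta>"
        by (rule continuous_on_subset[OF cont]) (use sub[OF ab(1,2)] m in force)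
      then obtain d where d: "a \<le> d" "d \<le> m" "\<Theta> d = (\<Theta> a + \<Theta> m) / 2"
        using IVT2'[of \<Theta> m "(\<Theta> a + \<Theta> m) / 2" a] n m by auto
      have "d \<noteq> a" "d \<noteq> m" using d n by auto
      then have "d \<in> interior S" "d < m" using int[OF ab(1,2)] d m by auto
      then show False using 1[of d m] mS interior_subset d n by fastforce
    qed
    then show "\<Theta> a < \<Theta> b" using 1[OF mS ab(2) m(2)] by simp
  qed
qed

text \<open>Finitely many compact pieces covering a Hausdorff space form a quotient map: the
  preimage of a closed set is a finite union of compact images. This serves for a wedge and for the
  product of a wedge with an interval.\<close>

lemma continuous_map_glue:
  assumes fin: "finite A" and K: "\<And>a. a \<in> A \<Longrightarrow> compact_space (K a)"
    and Z: "Hausdorff_space Z" and e: "\<And>a. a \<in> A \<Longrightarrow> continuous_map (K a) Z (e a)"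
    and cov: "topspace Z \<subseteq> (\<Union>a\<in>A. e a ` topspace (K a))"
    and F: "\<And>a. a \<in> A \<Longrightarrow> continuous_map (K a) V (F \<circ> e a)"
  shows "continuous_map Z V F"
  unfolding continuous_map_closedin
proof (intro conjI allI impI)
  show "F \<in> topspace Z \<rightarrow> topspace V"
  proof
    fix y assume "y \<in> topspace Z"
    then obtain a s where "a \<in> A" "s \<in> topspace (K a)" "y = e a s" using cov by blast
    then show "F y \<in> topspace V" using F[of a] by (auto simp: continuous_map_def)
  qed
  fix C assume C: "closedin V C"
  have sub: "\<And>a. a \<in> A \<Longrightarrow> e a ` topspace (K a) \<subseteq> topspace Z"
    using e by (auto simp: continuous_map_def)
  have "{x \<in> topspace Z. F x \<in> C} = (\<Union>a\<in>A. e a ` {x \<in> topspace (K a). (F \<circ> e a) x \<in> C})"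
    using cov sub by fastforce
  moreover have "closedin Z (e a ` {x \<in> topspace (K a). (F \<circ> e a) x \<in> C})" if a: "a \<in> A" for a
  proof (rule compactin_imp_closedin[OF Z image_compactin[OF _ e[OF a]]])
    show "compactin (K a) {x \<in> topspace (K a). (F \<circ> e a) x \<in> C}"
      using closedin_compact_space[OF K[OF a] closedin_continuous_map_preimage[OF F[OF a] C]] .
  qed
  ultimately show "closedin Z {x \<in> topspace Z. F x \<in> C}"
    using fin by (auto intro!: closedin_Union)
qed

section \<open>Curves in an oriented wedge\<close>

text \<open>The wedge point has several parameters, so one is chosen. The choice is harmless when
  all values at 0 and 1 agree, which is the condition in \<open>wedge_fun_eq\<close>.\<close>

definition wedge_fun :: "(nat \<Rightarrow> real \<Rightarrow> 'a) \<Rightarrow> nat \<Rightarrow> (nat \<Rightarrow> real \<Rightarrow> 'b) \<Rightarrow> 'a \<Rightarrow> 'b" where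
  "wedge_fun c n F y =
     (let p = (SOME p. fst p < n \<and> snd p \<in> {0..1} \<and> y = c (fst p) (snd p)) in F (fst p) (snd p))"

text \<open>The collapse of all circles but \<open>k\<close>, with the remaining one identified with
  the unit circle. Questions about which circle a point lies on thus become questions about complex
  functions.\<close>

definition circ :: "(nat \<Rightarrow> real \<Rightarrow> 'a) \<Rightarrow> nat \<Rightarrow> nat \<Rightarrow> 'a \<Rightarrow> complex" where
  "circ c n k = wedge_fun c n (\<lambda>j s. if j = k then cis (2 * pi * s) else 1)"

definition clock :: "(nat \<Rightarrow> real \<Rightarrow> 'a) \<Rightarrow> nat \<Rightarrow> 'a \<Rightarrow> complex" where
  "clock c n = wedge_fun c n (\<lambda>j s. cis (2 * pi * s))"

text \<open>The curve that reads the letter \<open>\<kappa> i\<close> between the times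
  \<open>i\<close> and \<open>i + 1\<close>. The word is infinite in both directions so that whole
  orbits can be described; the integers are the passages through the wedge point.\<close>

definition wcurve :: "(nat \<Rightarrow> real \<Rightarrow> 'a) \<Rightarrow> (int \<Rightarrow> nat) \<Rightarrow> real \<Rightarrow> 'a" where
  "wcurve c \<kappa> u = c (\<kappa> \<lfloor>u\<rfloor>) (frac u)"

locale wedge =
  fixes W :: "'a topology" and w :: 'a and n :: nat and c :: "nat \<Rightarrow> real \<Rightarrow> 'a"
  assumes ow: "oriented_wedge W w n c"
begin

lemma Haus: "Hausdorff_space W" and n_pos: "0 < n"
  using ow by (auto simp: oriented_wedge_def)

lemma
  assumes "k < n"
  shows c_pathin: "pathin W (c k)" and c_0: "c k 0 = w" and c_1: "c k 1 = w" and c_inj: "inj_on (c k) {0..<1}"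
  using ow assms by (auto simp: oriented_wedge_def)

lemma c_cont: "k < n \<Longrightarrow> continuous_map (top_of_set {0..1}) W (c k)"
  using c_pathin by (simp add: pathin_def)

lemma topW: "topspace W = (\<Union>k<n. c k ` {0..1})"
  using ow by (auto simp: oriented_wedge_def)

lemma c_in: "k < n \<Longrightarrow> 0 \<le> s \<Longrightarrow> s \<le> 1 \<Longrightarrow> c k s \<in> topspace W"
  unfolding topW by (auto intro!: bexI[of _ k])

lemma wedge_cases:
  assumes "y \<in> topspace W"
  obtains k s where "k < n" "0 \<le> s" "s < 1" "y = c k s"
proof -
  obtain k s where ks: "k < n" "s \<in> {0..1}" "y = c k s" using assms unfolding topW by auto
  show thesis
  proof (cases "s = 1")
    case True then show ?thesis using that[of k 0] ks c_0 c_1 by auto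
  next
    case False then show ?thesis using that[of k s] ks by auto
  qed
qed

lemma c_eq_w_iff: "k < n \<Longrightarrow> 0 \<le> s \<Longrightarrow> s \<le> 1 \<Longrightarrow> c k s = w \<longleftrightarrow> s = 0 \<or> s = 1"
  using c_0[of k] c_1[of k] inj_onD[OF c_inj[of k], of s 0] by (cases "s = 1") auto

lemma c_eq_cases:
  assumes "k < n" "j < n" "0 \<le> s" "s \<le> 1" "0 \<le> t" "t \<le> 1" "c k s = c j t"
  shows "(k = j \<and> s = t) \<or> (s \<in> {0, 1} \<and> t \<in> {0, 1})"
proof (cases "c k s = w")
  case True
  then show ?thesis using assms c_eq_w_iff[of k s] c_eq_w_iff[of j t] by auto
next
  case False
  have "k = j"
  proof (rule ccontr)
    assume "k \<noteq> j"
    then have "c k ` {0..1} \<inter> c j ` {0..1} = {w}" using ow assms by (auto simp: oriented_wedge_def)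
    moreover have "c k s \<in> c k ` {0..1} \<inter> c j ` {0..1}"
      by (rule IntI, use assms in force, subst assms(7), use assms in force)
    ultimately show False using False by blast
  qed
  moreover have "s < 1" "t < 1" using False assms c_1 by (force simp: less_le)+
  ultimately show ?thesis using inj_onD[OF c_inj[of k], of s t] assms by auto
qed

lemma wedge_fun_eq:
  assumes "k < n" "0 \<le> s" "s \<le> 1" and F: "\<And>j. j < n \<Longrightarrow> F j 0 = v \<and> F j 1 = v"
  shows "wedge_fun c n F (c k s) = F k s"
proof -
  define p where "p = (SOME p. fst p < n \<and> snd p \<in> {0..1} \<and> c k s = c (fst p) (snd p))"
  have "fst p < n \<and> snd p \<in> {0..1} \<and> c k s = c (fst p) (snd p)"
    unfolding p_def by (rule someI[of _ "(k, s)"]) (use assms in auto)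
  then have "(k = fst p \<and> s = snd p) \<or> (s \<in> {0, 1} \<and> snd p \<in> {0, 1})" "fst p < n"
    using c_eq_cases[of k "fst p" s "snd p"] assms by auto
  then have "F (fst p) (snd p) = F k s" using F[of k] F[of "fst p"] assms(1) by auto
  then show ?thesis unfolding wedge_fun_def Let_def by (simp only: p_def[symmetric])
qed

lemma continuous_map_from_wedge:
  assumes "\<And>k. k < n \<Longrightarrow> continuous_map (top_of_set {0..1}) V (\<lambda>s. F (c k s))"
  shows "continuous_map W V F"
  by (rule continuous_map_glue[where A="{..<n}" and K="\<lambda>_. top_of_set {0..1}" and e=c])
    (use assms c_cont Haus topW in \<open>auto simp: compact_space_subtopology o_def\<close>)

lemma clock_c: "k < n \<Longrightarrow> 0 \<le> s \<Longrightarrow> s \<le> 1 \<Longrightarrow> clock c n (c k s) = cis (2 * pi * s)"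
  unfolding clock_def by (subst wedge_fun_eq[where v=1]) auto

lemma circ_c: "k < n \<Longrightarrow> 0 \<le> s \<Longrightarrow> s \<le> 1 \<Longrightarrow> circ c n j (c k s) = (if k = j then cis (2 * pi * s) else 1)"
  unfolding circ_def by (subst wedge_fun_eq[where v=1]) auto

lemma clock_cont: "continuous_map W euclidean (clock c n)"
  by (rule continuous_map_from_wedge, rule continuous_map_eq[where f="\<lambda>s. cis (2 * pi * s)"])
    (auto simp: clock_c intro!: continuous_intros)

lemma circ_cont: "continuous_map W euclidean (circ c n j)"
  by (rule continuous_map_from_wedge, rule continuous_map_eq[where f="\<lambda>s. if _ = j then cis (2 * pi * s) else 1"])
    (auto simp: circ_c intro!: continuous_intros)

lemma norm_clock: "y \<in> topspace W \<Longrightarrow> norm (clock c n y) = 1"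
  by (erule wedge_cases) (simp add: clock_c)

lemma norm_circ: "y \<in> topspace W \<Longrightarrow> norm (circ c n j y) = 1"
  by (erule wedge_cases) (simp add: circ_c)

lemma clock_w [simp]: "clock c n w = 1" and circ_w [simp]: "circ c n j w = 1"
  using clock_c[OF n_pos, of 0] circ_c[OF n_pos, of 0] c_0[OF n_pos] by auto

lemma clock_eq_1_iff: "y \<in> topspace W \<Longrightarrow> clock c n y = 1 \<longleftrightarrow> y = w"
proof (erule wedge_cases)
  fix k s assume a: "k < n" "0 \<le> s" "s < 1" "y = c k s"
  have "clock c n y = 1 \<longleftrightarrow> s \<in> \<int>" using a by (simp add: clock_c cis_2pi_eq_1_iff)
  also have "\<dots> \<longleftrightarrow> s = 0" using a by (auto elim!: Ints_cases)
  finally show ?thesis using a c_eq_w_iff[of k s] by auto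
qed

lemma wcurve_int: "(\<And>i. \<kappa> i < n) \<Longrightarrow> wcurve c \<kappa> (of_int i) = w"
  unfolding wcurve_def by (simp add: c_0)

lemma wcurve_clock: "(\<And>i. \<kappa> i < n) \<Longrightarrow> clock c n (wcurve c \<kappa> u) = cis (2 * pi * u)"
  unfolding wcurve_def using frac_lt_1[of u] by (simp add: clock_c less_imp_le cis_2pi_frac)

lemma wcurve_circ:
  "(\<And>i. \<kappa> i < n) \<Longrightarrow> circ c n j (wcurve c \<kappa> u) = (if \<kappa> \<lfloor>u\<rfloor> = j then cis (2 * pi * u) else 1)"
  unfolding wcurve_def using frac_lt_1[of u] by (simp add: circ_c less_imp_le cis_2pi_frac)

lemma wcurve_piece:
  assumes k: "\<And>i. \<kappa> i < n" and "of_int i \<le> u" "u \<le> of_int i + 1"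
  shows "wcurve c \<kappa> u = c (\<kappa> i) (u - of_int i)"
proof (cases "u = of_int i + 1")
  case True
  then have "u = of_int (i + 1)" by simp
  then show ?thesis using k wcurve_int[of \<kappa> "i+1"] True by (simp add: c_1)
next
  case False
  then have "\<lfloor>u\<rfloor> = i" using assms by (intro floor_unique) auto
  then show ?thesis by (simp add: wcurve_def frac_def)
qed

lemma wcurve_cont:
  assumes k: "\<And>i. \<kappa> i < n"
  shows "continuous_map euclideanreal W (wcurve c \<kappa>)"
proof (rule pasting_lemma_locally_finite[where I=UNIV and T="\<lambda>i::int. {of_int i..of_int i + 1}" and f="\<lambda>_. wcurve c \<kappa>"])
  fix x :: real
  have "{i::int. {of_int i..of_int i + 1} \<inter> {x - 1<..<x + 1} \<noteq> {}} \<subseteq> {\<lfloor>x\<rfloor> - 3..\<lfloor>x\<rfloor> + 3}"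
    by auto linarith+
  then have "finite {i::int. {of_int i..of_int i + 1} \<inter> {x - 1<..<x + 1} \<noteq> {}}"
    using finite_subset by blast
  then show "\<exists>V. openin euclideanreal V \<and> x \<in> V \<and> finite {i \<in> UNIV. {real_of_int i..real_of_int i + 1} \<inter> V \<noteq> {}}"
    by (intro exI[of _ "{x - 1<..<x + 1}"]) auto
next
  fix i :: int
  have "continuous_map (top_of_set {of_int i..of_int i + 1}) W (c (\<kappa> i) \<circ> (\<lambda>u. u - of_int i))"
    by (rule continuous_map_compose[OF _ c_cont[OF k]])
      (auto simp: continuous_map_in_subtopology intro!: continuous_intros)
  then show "continuous_map (top_of_set {real_of_int i..real_of_int i + 1}) W (wcurve c \<kappa>)"
    by (rule continuous_map_eq) (use wcurve_piece[OF k] in auto)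
next
  fix x :: real
  show "\<exists>j::int. j \<in> UNIV \<and> x \<in> {real_of_int j..real_of_int j + 1} \<and> wcurve c \<kappa> x = wcurve c \<kappa> x"
    by (intro exI[of _ "\<lfloor>x\<rfloor>"]) auto
qed auto

lemma wcurve_comp_cont:
  assumes "\<And>i. \<kappa> i < n" "continuous_map X euclideanreal \<Theta>"
  shows "continuous_map X W (\<lambda>x. wcurve c \<kappa> (\<Theta> x))"
  using continuous_map_compose[OF assms(2) wcurve_cont[OF assms(1)]] by (simp add: o_def)

end

section \<open>Normal form of positive curves\<close>

context wedge
begin

text \<open>The parameter \<open>s\<close> in \<open>locally_positive\<close> is increasing but not
  assumed continuous, so it could differ from the lift \<open>\<Theta>\<close> by a varying integer.
  On the first half of the interval \<open>s\<close> gains at most \<open>d\<close>, and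
  \<open>d < 1\<close> because \<open>s\<close> keeps growing on the second half. Close to
  \<open>t0\<close> the lift moves by less than \<open>1 - d\<close>, so the integer discrepancy
  exceeds -1 and cannot be negative.\<close>

lemma positive_curve_right_increasing:
  assumes lp: "locally_positive c n \<gamma> t0" and \<Theta>: "\<And>t. t \<in> S \<Longrightarrow> clock c n (\<gamma> t) = cis (2 * pi * \<Theta> t)"
    and cont: "continuous_on S \<Theta>" and t0: "t0 \<in> interior S"
  shows "\<exists>e>0. \<forall>t\<in>S. t0 < t \<and> t \<le> t0 + e \<longrightarrow> \<Theta> t0 < \<Theta> t"
proof -
  obtain \<epsilon> where "\<epsilon> > 0" and ex: "\<exists>k<n. \<exists>s. strict_mono_on {t0..t0 + \<epsilon>} s \<and> s ` {t0..t0 + \<epsilon>} \<subseteq> {0..1} \<and>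
      (\<forall>t\<in>{t0..t0 + \<epsilon>}. \<gamma> t = c k (s t))"
    using lp unfolding locally_positive_def by (elim exE conjE) (rule that, assumption, intro exI conjI, assumption+)
  then obtain k s where \<epsilon>: "\<epsilon> > 0" "k < n" and s: "strict_mono_on {t0..t0 + \<epsilon>} s" "s ` {t0..t0 + \<epsilon>} \<subseteq> {0..1}"
    and \<gamma>: "\<And>t. t \<in> {t0..t0 + \<epsilon>} \<Longrightarrow> \<gamma> t = c k (s t)"
    by (elim exE conjE) (rule that, auto)
  define d where "d = s (t0 + \<epsilon> / 2) - s t0"
  have "s (t0 + \<epsilon> / 2) < s (t0 + \<epsilon>)" "s (t0 + \<epsilon>) \<le> 1" "s t0 \<ge> 0"
    using strict_mono_onD[OF s(1), of "t0 + \<epsilon> / 2" "t0 + \<epsilon>"] s(2) \<epsilon> by (auto simp: image_subset_iff)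
  then have d: "d < 1" by (simp add: d_def)
  have t0S: "t0 \<in> S" using t0 interior_subset by blast
  then obtain \<delta> where \<delta>: "\<delta> > 0" "\<And>t. t \<in> S \<Longrightarrow> \<bar>t - t0\<bar> < \<delta> \<Longrightarrow> \<bar>\<Theta> t - \<Theta> t0\<bar> < 1 - d"
    using cont d unfolding continuous_on_iff dist_real_def by (meson diff_gt_0_iff_gt)
  define e where "e = min (\<epsilon> / 2) (\<delta> / 2)"
  have "\<Theta> t0 < \<Theta> t" if t: "t \<in> S" "t0 < t" "t \<le> t0 + e" for t
  proof -
    have I: "t \<in> {t0..t0 + \<epsilon>}" "t0 \<in> {t0..t0 + \<epsilon>}" "t \<le> t0 + \<epsilon> / 2" using t \<epsilon> by (auto simp: e_def)
    have st: "s t0 < s t" using strict_mono_onD[OF s(1)] I t by blast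
    have "s t \<le> s (t0 + \<epsilon> / 2)"
      using strict_mono_on_leD[OF s(1), of t "t0 + \<epsilon> / 2"] I \<epsilon> by auto
    then have st2: "s t - s t0 \<le> d" by (simp add: d_def)
    have "cis (2 * pi * s u) = cis (2 * pi * \<Theta> u)" if "u = t \<or> u = t0" for u
      using \<Theta>[of u] \<gamma>[of u] that I t t0S s(2) \<epsilon> clock_c[of k "s u"] by (auto simp: image_subset_iff)
    then obtain i j :: int where "s t = \<Theta> t + of_int i" "s t0 = \<Theta> t0 + of_int j"
      unfolding cis_2pi_eq_iff by blast
    then have eq: "\<Theta> t - \<Theta> t0 = s t - s t0 + of_int (j - i)" by simp
    have "\<bar>\<Theta> t - \<Theta> t0\<bar> < 1 - d" using \<delta> t by (auto simp: e_def)
    then have "of_int (j - i) > (-1 :: real)" using eq st2 by linarith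
    then have "j - i \<ge> 0" by linarith
    then show ?thesis using eq st by (smt (verit) of_int_0_le_iff)
  qed
  moreover have "e > 0" using \<epsilon> \<delta> by (simp add: e_def)
  ultimately show ?thesis by blast
qed

lemma wcurve_of_clock:
  assumes y: "y \<in> topspace W" and cl: "clock c n y = cis (2 * pi * \<theta>)"
  obtains k where "k < n" "y = c k (frac \<theta>)"
proof -
  obtain k s where ks: "k < n" "0 \<le> s" "s < 1" "y = c k s" using y by (rule wedge_cases)
  then have "cis (2 * pi * s) = cis (2 * pi * \<theta>)" using cl clock_c by simp
  then obtain i :: int where "s = \<theta> + of_int i" unfolding cis_2pi_eq_iff by blast
  then have "frac \<theta> = s" using ks by (subst frac_unique_iff) auto
  then show thesis using that ks by blast
qed

text \<open>The comparison of the function \<open>circ c n k\<close> with the clock decides on which circle a point lies;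
by connectedness the answer is constant between two passages through the wedge point.\<close>
lemma positive_curve_normal_form:
  assumes S: "convex S" and \<gamma>: "continuous_map (top_of_set S) W \<gamma>"
    and lp: "\<And>t. t \<in> interior S \<Longrightarrow> locally_positive c n \<gamma> t"
  obtains \<kappa> \<Theta> where "\<And>i. \<kappa> i < n" "continuous_on S \<Theta>" "strict_mono_on S \<Theta>"
    "\<And>t. t \<in> S \<Longrightarrow> \<gamma> t = wcurve c \<kappa> (\<Theta> t)"
proof -
  have \<gamma>in: "\<gamma> t \<in> topspace W" if "t \<in> S" for t
    using \<gamma> that by (auto simp: continuous_map_def)
  have comp: "continuous_on S (\<lambda>t. g (\<gamma> t))" if "continuous_map W euclidean g" for g :: "'a \<Rightarrow> complex"
    using continuous_map_compose[OF \<gamma> that] by (simp add: o_def)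
  obtain \<Theta> where \<Theta>: "continuous_on S \<Theta>" "\<And>t. t \<in> S \<Longrightarrow> clock c n (\<gamma> t) = cis (2 * pi * \<Theta> t)"
    by (rule circle_lift[OF S comp[OF clock_cont]]) (use \<gamma>in norm_clock in auto)
  have mono: "strict_mono_on S \<Theta>"
    by (rule strict_mono_on_of_right_increasing[OF S \<Theta>(1)])
      (rule positive_curve_right_increasing[OF lp \<Theta>(2,1)])
  have "\<exists>k<n. \<forall>t\<in>S. of_int m < \<Theta> t \<and> \<Theta> t < of_int m + 1 \<longrightarrow> \<gamma> t = c k (frac (\<Theta> t))" for m :: int
  proof (cases "\<exists>t\<in>S. of_int m < \<Theta> t \<and> \<Theta> t < of_int m + 1")
    case False then show ?thesis using n_pos by auto
  next
    case True
    define T where "T = {t\<in>S. of_int m < \<Theta> t \<and> \<Theta> t < of_int m + 1}"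
    obtain t0 where t0: "t0 \<in> T" using True by (auto simp: T_def)
    obtain k where k: "k < n" "\<gamma> t0 = c k (frac (\<Theta> t0))"
      using wcurve_of_clock[OF \<gamma>in \<Theta>(2)] t0 by (auto simp: T_def)
    have "is_interval T"
      unfolding is_interval_1
    proof (intro allI impI ballI)
      fix a b x assume ab: "a \<in> T" "b \<in> T" "a \<le> x \<and> x \<le> b"
      then have "x \<in> S" using S unfolding is_interval_convex_1[symmetric] is_interval_1 T_def by blast
      with ab show "x \<in> T" using strict_mono_on_leD[OF mono, of a x] strict_mono_on_leD[OF mono, of x b]
        by (auto simp: T_def)
    qed
    then have conn: "connected T" using is_interval_connected by blast
    have ne: "cis (2 * pi * \<Theta> t) - 1 \<noteq> 0" if "t \<in> T" for t
      using that floor_unique[of m "\<Theta> t"] by (auto simp: cis_2pi_eq_1_iff T_def elim!: Ints_cases)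
    \<comment> \<open>On the circle \<open>j\<close> this quotient is 1 if \<open>j = k\<close> and
      0 otherwise; the denominator does not vanish because the lift is strictly between two
      integers. Being continuous with integer values, it is constant on \<open>T\<close>.\<close>
    define R where "R t = Re ((circ c n k (\<gamma> t) - 1) / (cis (2 * pi * \<Theta> t) - 1))" for t
    have R: "R t = (if j = k then 1 else 0)" if "t \<in> T" "j < n" "\<gamma> t = c j (frac (\<Theta> t))" for t j
      using that circ_c[of j "frac (\<Theta> t)"] frac_lt_1[of "\<Theta> t"] ne[OF that(1)]
      by (simp add: R_def less_imp_le cis_2pi_frac)
    have ex: "\<exists>j<n. \<gamma> t = c j (frac (\<Theta> t))" if "t \<in> T" for t
      using wcurve_of_clock[OF \<gamma>in \<Theta>(2)] that by (auto simp: T_def)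
    have "R t = R t0" if "t \<in> T" for t
    proof (rule integer_valued_constant[OF conn _ _ that t0])
      have TS: "T \<subseteq> S" by (auto simp: T_def)
      show "continuous_on T R"
        unfolding R_def using ne
        by (intro continuous_intros continuous_on_subset[OF comp[OF circ_cont] TS] continuous_on_subset[OF \<Theta>(1) TS]) auto
      show "R x \<in> \<int>" if "x \<in> T" for x using ex[OF that] R[OF that] by auto
    qed
    moreover have "R t0 = 1" using R[OF t0 k] by simp
    ultimately have "\<gamma> t = c k (frac (\<Theta> t))" if "t \<in> T" for t
      using ex[OF that] R[OF that] that by (metis zero_neq_one)
    then show ?thesis using k(1) unfolding T_def by blast
  qed
  then obtain \<kappa> where \<kappa>: "\<And>m. \<kappa> m < n"
    "\<And>m t. t \<in> S \<Longrightarrow> of_int m < \<Theta> t \<Longrightarrow> \<Theta> t < of_int m + 1 \<Longrightarrow> \<gamma> t = c (\<kappa> m) (frac (\<Theta> t))"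
    by metis
  have "\<gamma> t = wcurve c \<kappa> (\<Theta> t)" if "t \<in> S" for t
  proof (cases "\<Theta> t \<in> \<int>")
    case True
    then have "clock c n (\<gamma> t) = 1" using \<Theta>(2)[OF that] by (simp add: cis_2pi_eq_1_iff)
    then show ?thesis using True clock_eq_1_iff[OF \<gamma>in[OF that]] wcurve_int[of \<kappa>] \<kappa>(1) by (auto elim!: Ints_cases)
  next
    case False
    then have "of_int \<lfloor>\<Theta> t\<rfloor> < \<Theta> t" by (metis Ints_of_int of_int_floor_le order_le_imp_less_or_eq)
    then show ?thesis using \<kappa>(2)[OF that, of "\<lfloor>\<Theta> t\<rfloor>"] by (simp add: wcurve_def)
  qed
  then show thesis using that \<kappa>(1) \<Theta>(1) mono by blast
qed

text \<open>Two lifts of the same clock differ by a fixed integer. Each letter is then tested at a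
  half-integer, where the point is away from the wedge point and determines its circle. So the word
  of a curve does not depend on the chosen normal form.\<close>

lemma normal_form_letters_eq:
  fixes a b :: real and i i' j :: int
  assumes \<kappa>: "\<And>i. \<kappa> i < n" "\<And>i. \<kappa>' i < n" and ab: "a \<le> b"
    and \<Theta>: "continuous_on {a..b} \<Theta>" "continuous_on {a..b} \<Theta>'"
    and eq: "\<And>t. t \<in> {a..b} \<Longrightarrow> wcurve c \<kappa> (\<Theta> t) = wcurve c \<kappa>' (\<Theta>' t)"
    and st: "\<Theta> a = of_int i" "\<Theta>' a = of_int i'" and j: "\<Theta> b = of_int j"
  shows "\<Theta>' b = of_int (j - i + i')" and "map \<kappa> [i..j - 1] = map \<kappa>' [i'..j - i + i' - 1]"
proof -
  have cis: "cis (2 * pi * \<Theta> t) = cis (2 * pi * \<Theta>' t)" if "t \<in> {a..b}" for t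
    using arg_cong[OF eq[OF that], of "clock c n"] wcurve_clock[of \<kappa>] wcurve_clock[of \<kappa>'] \<kappa> by simp
  obtain N :: int where N: "\<And>t. t \<in> {a..b} \<Longrightarrow> \<Theta> t = \<Theta>' t + of_int N"
    by (rule circle_lift_unique[of "{a..b}" \<Theta> \<Theta>']) (use \<Theta> cis in auto)
  have "of_int N = real_of_int (i - i')" using N[of a] st ab by simp
  then have Ni: "N = i - i'" by linarith
  show "\<Theta>' b = of_int (j - i + i')" using N[of b] j ab Ni by simp
  have l: "\<kappa> m = \<kappa>' (m - N)" if m: "i \<le> m" "m < j" for m
  proof -
    have "\<Theta> a \<le> of_int m + 1/2" using st m by simp
    moreover have "of_int m + 1/2 \<le> \<Theta> b"
    proof -
      have "of_int (m + 1) \<le> real_of_int j" using m by linarith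
      then show ?thesis using j by simp
    qed
    ultimately obtain t where t: "a \<le> t" "t \<le> b" "\<Theta> t = of_int m + 1/2"
      using IVT'[of \<Theta> a _ b] \<Theta> ab by auto
    have t': "\<Theta>' t = of_int (m - N) + 1/2" using N[of t] t by simp
    have f: "\<lfloor>\<Theta> t\<rfloor> = m" "\<lfloor>\<Theta>' t\<rfloor> = m - N" unfolding t' t(3) by linarith+
    have fr: "frac (\<Theta> t) = 1/2" "frac (\<Theta>' t) = 1/2" unfolding frac_def f using t' t by auto
    then have "c (\<kappa> m) (1/2) = c (\<kappa>' (m - N)) (1/2)"
      using eq[of t] t(1,2) unfolding wcurve_def f fr by auto
    then show ?thesis using c_eq_cases[of "\<kappa> m" "\<kappa>' (m - N)" "1/2" "1/2"] \<kappa> by auto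
  qed
  have len: "length [i..j - 1] = length [i'..j - i + i' - 1]" by simp
  show "map \<kappa> [i..j - 1] = map \<kappa>' [i'..j - i + i' - 1]"
  proof (rule nth_equalityI)
    fix m assume "m < length (map \<kappa> [i..j - 1])"
    then have "m < nat (j - i)" by simp
    then show "map \<kappa> [i..j - 1] ! m = map \<kappa>' [i'..j - i + i' - 1] ! m"
      using l[of "i + int m"] by (simp add: Ni algebra_simps)
  qed (use len in simp)
qed

end

section \<open>Words of positive maps\<close>

text \<open>Pads a finite word to the kind of index that \<open>wcurve\<close> expects. The letter 0
  is always admissible, since a wedge has at least one circle.\<close>

definition word_ext :: "nat list \<Rightarrow> int \<Rightarrow> nat" where
  "word_ext v i = (if 0 \<le> i \<and> i < int (length v) then v ! nat i else 0)"

lemma map_word_ext: "map (word_ext v) [0..int (length v) - 1] = v"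
  by (rule nth_equalityI) (auto simp: word_ext_def)

definition wloop :: "(nat \<Rightarrow> real \<Rightarrow> 'a) \<Rightarrow> nat list \<Rightarrow> real \<Rightarrow> 'a" where
  "wloop c v s = wcurve c (word_ext v) (real (length v) * s)"

text \<open>The combinatorial form of a positive map, which up to reparametrisation is determined by the words it reads.\<close>
definition follows_words ::
  "nat \<Rightarrow> (nat \<Rightarrow> real \<Rightarrow> 'b) \<Rightarrow> nat \<Rightarrow> (nat \<Rightarrow> real \<Rightarrow> 'a) \<Rightarrow> ('b \<Rightarrow> 'a) \<Rightarrow> (nat \<Rightarrow> nat list) \<Rightarrow> bool" where
  "follows_words n' c' n c f v \<longleftrightarrow>
     (\<forall>a<n'. v a \<noteq> [] \<and> set (v a) \<subseteq> {..<n} \<and>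
        (\<exists>\<Theta>. continuous_on {0..1} \<Theta> \<and> strict_mono_on {0..1} \<Theta> \<and> \<Theta> 0 = 0 \<and> \<Theta> 1 = real (length (v a)) \<and>
             (\<forall>s\<in>{0..1}. f (c' a s) = wcurve c (word_ext (v a)) (\<Theta> s))))"

lemma follows_wordsE:
  assumes "follows_words n' c' n c f v" "a < n'"
  obtains \<Theta> where "v a \<noteq> []" "set (v a) \<subseteq> {..<n}" "continuous_on {0..1} \<Theta>" "strict_mono_on {0..1} \<Theta>"
    "\<Theta> 0 = 0" "\<Theta> 1 = real (length (v a))"
    "\<And>s. s \<in> {0..1} \<Longrightarrow> f (c' a s) = wcurve c (word_ext (v a)) (\<Theta> s)"
  using assms unfolding follows_words_def by blast

context wedge
begin

lemma word_ext_less: "set v \<subseteq> {..<n} \<Longrightarrow> word_ext v i < n"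
  using n_pos nth_mem[of "nat i" v] by (force simp: word_ext_def)

lemma follows_words_cont:
  assumes W': "wedge W' w' n' c'" and f: "follows_words n' c' n c f v"
  shows "continuous_map W' W f" and "f w' = w"
proof -
  interpret W': wedge W' w' n' c' by fact
  show "continuous_map W' W f"
  proof (rule W'.continuous_map_from_wedge)
    fix a assume "a < n'"
    with f obtain \<Theta> where \<Theta>: "v a \<noteq> []" "set (v a) \<subseteq> {..<n}" "continuous_on {0..1} \<Theta>"
      "\<And>s. s \<in> {0..1} \<Longrightarrow> f (c' a s) = wcurve c (word_ext (v a)) (\<Theta> s)"
      by (rule follows_wordsE) blast
    show "continuous_map (top_of_set {0..1}) W (\<lambda>s. f (c' a s))"
      by (rule continuous_map_eq[OF wcurve_comp_cont[of "word_ext (v a)" _ \<Theta>]])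
        (use \<Theta> word_ext_less in auto)
  qed
  obtain \<Theta> where \<Theta>: "set (v 0) \<subseteq> {..<n}" "\<Theta> 0 = 0"
      "\<And>s. s \<in> {0..1} \<Longrightarrow> f (c' 0 s) = wcurve c (word_ext (v 0)) (\<Theta> s)"
    by (rule follows_wordsE[OF f W'.n_pos]) blast
  show "f w' = w" using \<Theta>(3)[of 0] \<Theta>(2) W'.c_0[OF W'.n_pos] wcurve_int[of "word_ext (v 0)" 0] word_ext_less[OF \<Theta>(1)]
    by simp
qed

text \<open>Both ends of a circle go to the wedge point, so the lift in the normal form has integer
  end values \<open>i\<close> and \<open>j\<close>. The word consists of the letters in between,
  shifted to start at 0.\<close>

lemma positive_map_follows_words:
  assumes W': "wedge W' w' n' c'" and f: "positive_map W' w' n' c' W w n c f"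
  obtains v where "follows_words n' c' n c f v"
proof -
  interpret W': wedge W' w' n' c' by fact
  have "\<exists>va. va \<noteq> [] \<and> set va \<subseteq> {..<n} \<and>
        (\<exists>\<Theta>. continuous_on {0..1} \<Theta> \<and> strict_mono_on {0..1} \<Theta> \<and> \<Theta> 0 = 0 \<and> \<Theta> 1 = real (length va) \<and>
             (\<forall>s\<in>{0..1}. f (c' a s) = wcurve c (word_ext va) (\<Theta> s)))" if a: "a < n'" for a
  proof -
    obtain \<kappa> \<Theta> where \<kappa>: "\<And>i. \<kappa> i < n" and \<Theta>: "continuous_on {0..1} \<Theta>" "strict_mono_on {0..1} \<Theta>"
      "\<And>t. t \<in> {0..1} \<Longrightarrow> (f \<circ> c' a) t = wcurve c \<kappa> (\<Theta> t)"
    proof (rule positive_curve_normal_form[of "{0..1}" "f \<circ> c' a"])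
      show "continuous_map (top_of_set {0..1}) W (f \<circ> c' a)"
        using f W'.c_cont[OF a] by (auto simp: positive_map_def intro: continuous_map_compose)
      show "locally_positive c n (f \<circ> c' a) t" if "t \<in> interior {0..1}" for t
        using f a that by (auto simp: positive_map_def)
    qed auto
    have int: "\<Theta> t \<in> \<int>" if "t = 0 \<or> t = 1" for t
    proof -
      have "(f \<circ> c' a) t = w" using that a f W'.c_0 W'.c_1 by (auto simp: positive_map_def)
      then have "wcurve c \<kappa> (\<Theta> t) = w" using \<Theta>(3)[of t] that by auto
      then show ?thesis using wcurve_clock[of \<kappa> "\<Theta> t"] \<kappa> cis_2pi_eq_1_iff by simp
    qed
    obtain i j where ij: "\<Theta> 0 = of_int i" "\<Theta> 1 = of_int j" using int[of 0] int[of 1] by (auto elim!: Ints_cases)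
    have "i < j" using strict_mono_onD[OF \<Theta>(2), of 0 1] ij by simp
    define va where "va = map \<kappa> [i..j - 1]"
    have len: "int (length va) = j - i" using \<open>i < j\<close> by (simp add: va_def)
    have ext: "word_ext va m = \<kappa> (m + i)" if "0 \<le> m" "m < j - i" for m
      using that len by (simp add: word_ext_def va_def algebra_simps)
    have sva: "set va \<subseteq> {..<n}" using \<kappa> by (auto simp: va_def)
    show ?thesis
    proof (intro exI conjI ballI)
      show "va \<noteq> []" using len \<open>i < j\<close> by auto
      show "set va \<subseteq> {..<n}" by fact
      show "continuous_on {0..1} (\<lambda>s. \<Theta> s - of_int i)" by (intro continuous_intros \<Theta>)
      show "strict_mono_on {0..1} (\<lambda>s. \<Theta> s - of_int i)" using \<Theta>(2) by (auto simp: strict_mono_on_def)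
      show "\<Theta> 0 - of_int i = 0" using ij by simp
      show "\<Theta> 1 - of_int i = real (length va)" using ij arg_cong[OF len, of real_of_int] by simp
      fix s :: real assume s: "s \<in> {0..1}"
      have b: "of_int i \<le> \<Theta> s" "\<Theta> s \<le> of_int j"
        using strict_mono_on_leD[OF \<Theta>(2), of 0 s] strict_mono_on_leD[OF \<Theta>(2), of s 1] s ij by auto
      \<comment> \<open>When the lift equals \<open>j\<close>, its floor points behind the last
        letter, where the padding differs from \<open>\<kappa>\<close>; but both curves are at the
        wedge point then.\<close>
      show "f (c' a s) = wcurve c (word_ext va) (\<Theta> s - of_int i)"
      proof (cases "\<Theta> s = of_int j")
        case True
        then have "\<Theta> s - of_int i = of_int (j - i)" by simp
        then show ?thesis
          using \<Theta>(3)[OF s] True wcurve_int[of \<kappa> j] \<kappa> wcurve_int[of "word_ext va" "j - i"] word_ext_less[OF sva] by simp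
      next
        case False
        define m where "m = \<lfloor>\<Theta> s - of_int i\<rfloor>"
        have "\<lfloor>\<Theta> s\<rfloor> = m + i" by (simp add: m_def)
        moreover have "0 \<le> m" "m < j - i" using b False unfolding m_def by linarith+
        ultimately show ?thesis using \<Theta>(3)[OF s] ext[of m] m_def[symmetric] by (simp add: wcurve_def frac_def algebra_simps)
      qed
    qed
  qed
  then obtain v where "\<forall>a<n'. v a \<noteq> [] \<and> set (v a) \<subseteq> {..<n} \<and>
        (\<exists>\<Theta>. continuous_on {0..1} \<Theta> \<and> strict_mono_on {0..1} \<Theta> \<and> \<Theta> 0 = 0 \<and> \<Theta> 1 = real (length (v a)) \<and>
             (\<forall>s\<in>{0..1}. f (c' a s) = wcurve c (word_ext (v a)) (\<Theta> s)))" by metis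
  then show thesis using that unfolding follows_words_def by blast
qed

end

context wedge
begin

lemma wcurve_append_left:
  assumes "set p \<subseteq> {..<n}" "set q \<subseteq> {..<n}" "0 \<le> y" "y \<le> real (length p)"
  shows "wcurve c (word_ext (p @ q)) y = wcurve c (word_ext p) y"
proof (cases "y = real (length p)")
  case True
  then have "y = of_int (int (length p))" by simp
  then show ?thesis
    using wcurve_int[of "word_ext (p @ q)" "int (length p)"] wcurve_int[of "word_ext p" "int (length p)"] assms word_ext_less by auto
next
  case False
  then have "0 \<le> \<lfloor>y\<rfloor>" "\<lfloor>y\<rfloor> < int (length p)" using assms by linarith+
  then show ?thesis by (simp add: wcurve_def word_ext_def nth_append nat_less_iff)
qed

lemma wcurve_append_right:
  assumes "set p \<subseteq> {..<n}" "set q \<subseteq> {..<n}" "0 \<le> y" "y \<le> real (length q)"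
  shows "wcurve c (word_ext (p @ q)) (real (length p) + y) = wcurve c (word_ext q) y"
proof (cases "y = real (length q)")
  case True
  then have "y = of_int (int (length q))" "real (length p) + y = of_int (int (length p + length q))" by simp_all
  then show ?thesis
    using wcurve_int[of "word_ext (p @ q)"] wcurve_int[of "word_ext q"] assms word_ext_less
    by (metis Un_least set_append)
next
  case False
  then have "0 \<le> \<lfloor>y\<rfloor>" "\<lfloor>y\<rfloor> < int (length q)" using assms by linarith+
  moreover have f: "\<lfloor>real (length p) + y\<rfloor> = int (length p) + \<lfloor>y\<rfloor>" by linarith
  moreover from f have "frac (real (length p) + y) = frac y" by (simp add: frac_def)
  ultimately show ?thesis by (simp add: wcurve_def word_ext_def nth_append nat_add_distrib)
qed

lemma wcurve_singleton:
  assumes "a < n" "0 \<le> y" "y \<le> 1"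
  shows "wcurve c (word_ext [a]) y = c a y"
  using wcurve_piece[of "word_ext [a]" 0 y] word_ext_less[of "[a]"] assms by (simp add: word_ext_def)

end

text \<open>On words a positive map acts by substituting \<open>v a\<close> for each letter
  \<open>a\<close>. The reparametrisations of single letters are glued at integers, where both sides
  are at the wedge point; appending letters on the right leaves the part already built
  unchanged.\<close>

lemma follows_words_along_word:
  assumes W': "wedge W' w' n' c'" and W: "wedge W w n c" and f: "follows_words n' c' n c f v"
    and u: "set u \<subseteq> {..<n'}"
  obtains \<Theta> where "continuous_on {0..real (length u)} \<Theta>" "strict_mono_on {0..real (length u)} \<Theta>" "\<Theta> 0 = 0"
    "\<Theta> (real (length u)) = real (length (concat (map v u)))"
    "\<And>x. x \<in> {0..real (length u)} \<Longrightarrow> f (wcurve c' (word_ext u) x) = wcurve c (word_ext (concat (map v u))) (\<Theta> x)"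
proof -
  interpret W': wedge W' w' n' c' by fact
  interpret W: wedge W w n c by fact
  define good where "good u \<Theta> \<longleftrightarrow> continuous_on {0..real (length u)} \<Theta> \<and> strict_mono_on {0..real (length u)} \<Theta> \<and> \<Theta> 0 = 0 \<and>
    \<Theta> (real (length u)) = real (length (concat (map v u))) \<and>
    (\<forall>x \<in> {0..real (length u)}. f (wcurve c' (word_ext u) x) = wcurve c (word_ext (concat (map v u))) (\<Theta> x))"
    for u and \<Theta> :: "real \<Rightarrow> real"
  have "\<exists>\<Theta>. good u \<Theta>" using u
  proof (induction u rule: rev_induct)
    case Nil
    have "wcurve c' (word_ext []) 0 = w'" "wcurve c (word_ext []) 0 = w"
      using W'.wcurve_int[of "word_ext []" 0] W.wcurve_int[of "word_ext []" 0] W'.word_ext_less[of "[]"] W.word_ext_less[of "[]"] by auto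
    then show ?case using W.follows_words_cont(2)[OF W' f] by (intro exI[of _ id]) (auto simp: good_def strict_mono_on_def)
  next
    case (snoc a u)
    have a: "a < n'" and u: "set u \<subseteq> {..<n'}" using snoc.prems by auto
    obtain \<Theta> where \<Theta>: "good u \<Theta>" using snoc.IH[OF u] by blast
    obtain \<Phi> where \<Phi>: "v a \<noteq> []" "set (v a) \<subseteq> {..<n}" "continuous_on {0..1} \<Phi>" "strict_mono_on {0..1} \<Phi>"
      "\<Phi> 0 = 0" "\<Phi> 1 = real (length (v a))"
      "\<And>s. s \<in> {0..1} \<Longrightarrow> f (c' a s) = wcurve c (word_ext (v a)) (\<Phi> s)"
      by (rule follows_wordsE[OF f a]) blast
    define k where "k = length u"
    define U where "U = concat (map v u)"
    define L where "L = length U"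
    have sv: "set (v a) \<subseteq> {..<n}" if "a < n'" for a using f that by (auto simp: follows_words_def)
    have sU: "set U \<subseteq> {..<n}" using u sv by (fastforce simp: U_def)
    define \<Theta>' where "\<Theta>' x = (if x \<le> real k then \<Theta> x else real L + \<Phi> (x - real k))" for x
    have c1: "continuous_on {0..real k} \<Theta>" "strict_mono_on {0..real k} \<Theta>" "\<Theta> 0 = 0" "\<Theta> (real k) = real L"
      and eq: "\<And>x. x \<in> {0..real k} \<Longrightarrow> f (wcurve c' (word_ext u) x) = wcurve c (word_ext U) (\<Theta> x)"
      using \<Theta> by (auto simp: good_def k_def L_def U_def)
    have cat: "concat (map v (u @ [a])) = U @ v a" by (simp add: U_def)
    have "good (u @ [a]) \<Theta>'"
      unfolding good_def cat
    proof (intro conjI ballI)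
      have "continuous_on ({0..real k} \<union> {real k..real k + 1}) \<Theta>'"
        unfolding \<Theta>'_def
      proof (rule continuous_on_If)
        show "continuous_on {real k..real k + 1} (\<lambda>x. real L + \<Phi> (x - real k))"
          by (intro continuous_intros continuous_on_compose2[OF \<Phi>(3)]) auto
      qed (use c1 \<Phi>(5) in \<open>auto simp: order.antisym\<close>)
      moreover have "{0..real k} \<union> {real k..real k + 1} = {0..real (length (u @ [a]))}" by (auto simp: k_def)
      ultimately show "continuous_on {0..real (length (u @ [a]))} \<Theta>'" by simp
      show "\<Theta>' 0 = 0" using c1 by (simp add: \<Theta>'_def)
      show "\<Theta>' (real (length (u @ [a]))) = real (length (U @ v a))" using \<Phi>(6) by (simp add: \<Theta>'_def k_def L_def)
      show "strict_mono_on {0..real (length (u @ [a]))} \<Theta>'"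
      proof (rule strict_mono_onI)
        fix x y assume xy: "x \<in> {0..real (length (u @ [a]))}" "y \<in> {0..real (length (u @ [a]))}" "x < y"
        have "\<Theta> x \<le> real L" if "x \<le> real k"
          using strict_mono_on_leD[OF c1(2), of x "real k"] that xy c1(4) by auto
        moreover have "\<Phi> (y - real k) > 0" if "y > real k"
          using strict_mono_onD[OF \<Phi>(4), of 0 "y - real k"] that xy \<Phi>(5) by (auto simp: k_def)
        moreover have "\<Theta> x < \<Theta> y" if "y \<le> real k" using strict_mono_onD[OF c1(2)] that xy by auto
        moreover have "\<Phi> (x - real k) < \<Phi> (y - real k)" if "x > real k"
          using strict_mono_onD[OF \<Phi>(4), of "x - real k" "y - real k"] that xy by (auto simp: k_def)
        ultimately show "\<Theta>' x < \<Theta>' y" using xy by (fastforce simp: \<Theta>'_def)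
      qed
      fix x assume x: "x \<in> {0..real (length (u @ [a]))}"
      show "f (wcurve c' (word_ext (u @ [a])) x) = wcurve c (word_ext (U @ v a)) (\<Theta>' x)"
      proof (cases "x \<le> real k")
        case True
        then have x': "x \<in> {0..real k}" using x by simp
        then have "\<Theta> x \<in> {0..real L}"
          using strict_mono_on_leD[OF c1(2), of x "real k"] strict_mono_on_leD[OF c1(2), of 0 x] c1 by auto
        then show ?thesis
          using eq[OF x'] x' W'.wcurve_append_left[of u "[a]" x] W.wcurve_append_left[of U "v a" "\<Theta> x"] u a sU \<Phi>(2) True
          by (simp add: \<Theta>'_def k_def L_def)
      next
        case False
        define y where "y = x - real k"
        have y: "y \<in> {0..1}" "x = real (length u) + y" using False x by (auto simp: y_def k_def)
        have "\<Phi> y \<in> {0..real (length (v a))}"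
          using strict_mono_on_leD[OF \<Phi>(4), of 0 y] strict_mono_on_leD[OF \<Phi>(4), of y 1] y \<Phi> by auto
        then have "wcurve c (word_ext (U @ v a)) (\<Theta>' x) = f (c' a y)"
          using \<Phi>(7)[OF y(1)] W.wcurve_append_right[of U "v a" "\<Phi> y"] sU \<Phi>(2) False
          by (simp add: \<Theta>'_def y_def L_def)
        moreover have "wcurve c' (word_ext (u @ [a])) x = c' a y"
          using W'.wcurve_append_right[of u "[a]" y] W'.wcurve_singleton[of a y] u a y by simp
        ultimately show ?thesis by simp
      qed
    qed
    then show ?case by blast
  qed
  then show thesis using that unfolding good_def by blast
qed

lemma follows_words_id:
  assumes W: "wedge W w n c"
  shows "follows_words n c n c id (\<lambda>a. [a])"
proof -
  interpret wedge W w n c by fact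
  show ?thesis unfolding follows_words_def
    by (intro allI impI conjI exI[of _ id]) (auto simp: wcurve_singleton strict_mono_on_def)
qed

lemma follows_words_comp:
  assumes W'': "wedge W'' w'' n'' c''" and W': "wedge W' w' n' c'" and W: "wedge W w n c"
    and f: "follows_words n'' c'' n' c' f v" and g: "follows_words n' c' n c g u"
  shows "follows_words n'' c'' n c (g \<circ> f) (\<lambda>a. concat (map u (v a)))"
  unfolding follows_words_def
proof (intro allI impI)
  fix a assume a: "a < n''"
  obtain \<Theta> where \<Theta>: "v a \<noteq> []" "set (v a) \<subseteq> {..<n'}" "continuous_on {0..1} \<Theta>" "strict_mono_on {0..1} \<Theta>"
      "\<Theta> 0 = 0" "\<Theta> 1 = real (length (v a))"
      "\<And>s. s \<in> {0..1} \<Longrightarrow> f (c'' a s) = wcurve c' (word_ext (v a)) (\<Theta> s)"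
    by (rule follows_wordsE[OF f a]) blast
  obtain \<Phi> where \<Phi>: "continuous_on {0..real (length (v a))} \<Phi>" "strict_mono_on {0..real (length (v a))} \<Phi>" "\<Phi> 0 = 0"
    "\<Phi> (real (length (v a))) = real (length (concat (map u (v a))))"
    "\<And>x. x \<in> {0..real (length (v a))} \<Longrightarrow>
      g (wcurve c' (word_ext (v a)) x) = wcurve c (word_ext (concat (map u (v a)))) (\<Phi> x)"
    using follows_words_along_word[OF W' W g \<Theta>(2)] by metis
  have im: "\<Theta> s \<in> {0..real (length (v a))}" if "s \<in> {0..1}" for s
    using strict_mono_on_leD[OF \<Theta>(4), of 0 s] strict_mono_on_leD[OF \<Theta>(4), of s 1] that \<Theta> by auto
  have ne: "u b \<noteq> []" "set (u b) \<subseteq> {..<n}" if "b < n'" for b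
    using g that by (auto simp: follows_words_def)
  have "concat (map u (v a)) \<noteq> []" using \<Theta>(1,2) ne(1)[of "hd (v a)"] by (cases "v a") auto
  moreover have "set (concat (map u (v a))) \<subseteq> {..<n}" using \<Theta>(2) ne(2) by fastforce
  moreover have "continuous_on {0..1} (\<Phi> \<circ> \<Theta>)"
    by (rule continuous_on_compose[OF \<Theta>(3) continuous_on_subset[OF \<Phi>(1)]]) (use im in auto)
  moreover have "strict_mono_on {0..1} (\<Phi> \<circ> \<Theta>)"
    using im strict_mono_onD[OF \<Theta>(4)] strict_mono_onD[OF \<Phi>(2)] by (auto intro!: strict_mono_onI)
  ultimately show "concat (map u (v a)) \<noteq> [] \<and> set (concat (map u (v a))) \<subseteq> {..<n} \<and>
        (\<exists>\<Theta>. continuous_on {0..1} \<Theta> \<and> strict_mono_on {0..1} \<Theta> \<and> \<Theta> 0 = 0 \<and> \<Theta> 1 = real (length (concat (map u (v a)))) \<and>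
             (\<forall>s\<in>{0..1}. (g \<circ> f) (c'' a s) = wcurve c (word_ext (concat (map u (v a)))) (\<Theta> s)))"
    using \<Theta>(5,6,7) \<Phi>(3,4,5) im by (intro conjI exI[of _ "\<Phi> \<circ> \<Theta>"]) (auto simp del: map_concat)
qed

lemma follows_words_bond:
  assumes W: "\<And>i. wedge (Ws i) (ws i) (n i) (c i)"
    and f: "\<And>i. follows_words (n (Suc i)) (c (Suc i)) (n i) (c i) (f i) (v i)"
  shows "\<exists>u. follows_words (n (i + j)) (c (i + j)) (n i) (c i) (bond f i j) u"
proof (induction j)
  case 0
  then show ?case using follows_words_id[OF W[of i]] by (auto simp: id_def)
next
  case (Suc j)
  then obtain u where "follows_words (n (i + j)) (c (i + j)) (n i) (c i) (bond f i j) u" by blast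
  from follows_words_comp[OF W W W f[of "i + j"] this] show ?case by (auto simp: o_def)
qed

lemma strict_mono_on_inverse:
  fixes \<Theta> :: "real \<Rightarrow> real"
  assumes ab: "a \<le> b" and \<Theta>: "continuous_on {a..b} \<Theta>" "strict_mono_on {a..b} \<Theta>"
  obtains \<Phi> where "continuous_on {\<Theta> a..\<Theta> b} \<Phi>" "strict_mono_on {\<Theta> a..\<Theta> b} \<Phi>"
    "\<And>y. y \<in> {\<Theta> a..\<Theta> b} \<Longrightarrow> \<Phi> y \<in> {a..b} \<and> \<Theta> (\<Phi> y) = y" "\<And>x. x \<in> {a..b} \<Longrightarrow> \<Phi> (\<Theta> x) = x"
proof -
  define \<Phi> where "\<Phi> = the_inv_into {a..b} \<Theta>"
  have inj: "inj_on \<Theta> {a..b}" using \<Theta>(2) strict_mono_on_imp_inj_on by blast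
  have im: "\<Theta> ` {a..b} = {\<Theta> a..\<Theta> b}"
  proof
    show "\<Theta> ` {a..b} \<subseteq> {\<Theta> a..\<Theta> b}" using strict_mono_on_leD[OF \<Theta>(2)] ab by auto
    show "{\<Theta> a..\<Theta> b} \<subseteq> \<Theta> ` {a..b}" using IVT'[of \<Theta> a _ b] ab \<Theta>(1) by force
  qed
  have l: "\<Phi> (\<Theta> x) = x" if "x \<in> {a..b}" for x using that inj by (simp add: \<Phi>_def the_inv_into_f_f)
  have r: "\<Phi> y \<in> {a..b} \<and> \<Theta> (\<Phi> y) = y" if "y \<in> {\<Theta> a..\<Theta> b}" for y
    using that l im by (metis imageE)
  show thesis
  proof (rule that)
    show "continuous_on {\<Theta> a..\<Theta> b} \<Phi>"
      using continuous_on_inv[OF \<Theta>(1)] l im by (metis compact_Icc)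
    show "strict_mono_on {\<Theta> a..\<Theta> b} \<Phi>"
    proof (rule strict_mono_onI)
      fix x y assume xy: "x \<in> {\<Theta> a..\<Theta> b}" "y \<in> {\<Theta> a..\<Theta> b}" "x < y"
      show "\<Phi> x < \<Phi> y"
      proof (rule ccontr)
        assume "\<not> \<Phi> x < \<Phi> y"
        then have "\<Theta> (\<Phi> y) \<le> \<Theta> (\<Phi> x)" using strict_mono_on_leD[OF \<Theta>(2), of "\<Phi> y" "\<Phi> x"] r xy by auto
        then show False using r[OF xy(1)] r[OF xy(2)] xy(3) by simp
      qed
    qed
  qed (use l r in auto)
qed

text \<open>A positive map is a local homeomorphism onto its image along positive paths, so paths whose words lift can be lifted exactly.\<close>
lemma follows_words_lift:
  assumes W1: "wedge W1 w1 n1 c1" and W2: "wedge W2 w2 n2 c2" and W3: "wedge W3 w3 n3 c3"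
    and U: "follows_words n2 c2 n1 c1 U u" and F: "follows_words n3 c3 n1 c1 F v"
    and d: "\<And>a. a < n3 \<Longrightarrow> d a \<noteq> []" "\<And>a. a < n3 \<Longrightarrow> set (d a) \<subseteq> {..<n2}"
      "\<And>a. a < n3 \<Longrightarrow> concat (map u (d a)) = v a"
  obtains D where "follows_words n3 c3 n2 c2 D d" "\<And>y. y \<in> topspace W3 \<Longrightarrow> U (D y) = F y"
proof -
  interpret W1: wedge W1 w1 n1 c1 by fact
  interpret W2: wedge W2 w2 n2 c2 by fact
  interpret W3: wedge W3 w3 n3 c3 by fact
  have "\<exists>\<Theta>. continuous_on {0..1} \<Theta> \<and> strict_mono_on {0..1} \<Theta> \<and> \<Theta> 0 = 0 \<and> \<Theta> 1 = real (length (d a)) \<and>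
    (\<forall>s\<in>{0..1}. U (wcurve c2 (word_ext (d a)) (\<Theta> s)) = F (c3 a s))" if a: "a < n3" for a
  proof -
    obtain \<Theta> where \<Theta>: "continuous_on {0..1} \<Theta>" "strict_mono_on {0..1} \<Theta>"
        "\<Theta> 0 = 0" "\<Theta> 1 = real (length (v a))"
        "\<And>s. s \<in> {0..1} \<Longrightarrow> F (c3 a s) = wcurve c1 (word_ext (v a)) (\<Theta> s)"
      by (rule follows_wordsE[OF F a]) blast
    obtain \<Psi> where \<Psi>: "continuous_on {0..real (length (d a))} \<Psi>" "strict_mono_on {0..real (length (d a))} \<Psi>" "\<Psi> 0 = 0"
      "\<Psi> (real (length (d a))) = real (length (v a))"
      "\<And>x. x \<in> {0..real (length (d a))} \<Longrightarrow>
        U (wcurve c2 (word_ext (d a)) x) = wcurve c1 (word_ext (v a)) (\<Psi> x)"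
      using follows_words_along_word[OF W2 W1 U d(2)[OF a]] unfolding d(3)[OF a] by metis
    obtain \<Phi> where \<Phi>: "continuous_on {0..real (length (v a))} \<Phi>" "strict_mono_on {0..real (length (v a))} \<Phi>"
      "\<And>y. y \<in> {0..real (length (v a))} \<Longrightarrow> \<Phi> y \<in> {0..real (length (d a))} \<and> \<Psi> (\<Phi> y) = y"
      "\<And>x. x \<in> {0..real (length (d a))} \<Longrightarrow> \<Phi> (\<Psi> x) = x"
      using strict_mono_on_inverse[OF _ \<Psi>(1,2)] unfolding \<Psi>(3,4) by (metis of_nat_0_le_iff)
    have im: "\<Theta> s \<in> {0..real (length (v a))}" if "s \<in> {0..1}" for s
      using strict_mono_on_leD[OF \<Theta>(2), of 0 s] strict_mono_on_leD[OF \<Theta>(2), of s 1] that \<Theta> by auto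
    \<comment> \<open>Along \<open>d a\<close> the map \<open>U\<close> reads the same word as
      \<open>F\<close> along the circle \<open>a\<close>, with reparametrisations
      \<open>\<Psi>\<close> and \<open>\<Theta>\<close> of the same range. Running with the inverse
      of \<open>\<Psi>\<close> after \<open>\<Theta>\<close> makes the two sides equal point by
      point.\<close>
    show ?thesis
    proof (intro exI[of _ "\<Phi> \<circ> \<Theta>"] conjI ballI)
      show "continuous_on {0..1} (\<Phi> \<circ> \<Theta>)"
        by (rule continuous_on_compose[OF \<Theta>(1) continuous_on_subset[OF \<Phi>(1)]]) (use im in auto)
      show "strict_mono_on {0..1} (\<Phi> \<circ> \<Theta>)"
        using im strict_mono_onD[OF \<Theta>(2)] strict_mono_onD[OF \<Phi>(2)] by (auto intro!: strict_mono_onI)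
      show "(\<Phi> \<circ> \<Theta>) 0 = 0" using \<Phi>(4)[of 0] \<Theta> \<Psi> by simp
      show "(\<Phi> \<circ> \<Theta>) 1 = real (length (d a))" using \<Phi>(4)[of "real (length (d a))"] \<Theta> \<Psi> by simp
      fix s :: real assume s: "s \<in> {0..1}"
      show "U (wcurve c2 (word_ext (d a)) ((\<Phi> \<circ> \<Theta>) s)) = F (c3 a s)"
        using \<Psi>(5)[of "\<Phi> (\<Theta> s)"] \<Phi>(3)[OF im[OF s]] \<Theta>(5)[OF s] by simp
    qed
  qed
  then obtain \<Theta> where \<Theta>: "\<And>a. a < n3 \<Longrightarrow> continuous_on {0..1} (\<Theta> a) \<and> strict_mono_on {0..1} (\<Theta> a) \<and> \<Theta> a 0 = 0 \<and>
     \<Theta> a 1 = real (length (d a)) \<and> (\<forall>s\<in>{0..1}. U (wcurve c2 (word_ext (d a)) (\<Theta> a s)) = F (c3 a s))" by metis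
  define D where "D = wedge_fun c3 n3 (\<lambda>a s. wcurve c2 (word_ext (d a)) (\<Theta> a s))"
  have D: "D (c3 a s) = wcurve c2 (word_ext (d a)) (\<Theta> a s)" if "a < n3" "0 \<le> s" "s \<le> 1" for a s
    unfolding D_def
  proof (rule W3.wedge_fun_eq[where v=w2, OF that])
    fix j assume j: "j < n3"
    show "wcurve c2 (word_ext (d j)) (\<Theta> j 0) = w2 \<and> wcurve c2 (word_ext (d j)) (\<Theta> j 1) = w2"
      using \<Theta>[OF j] W2.wcurve_int[of "word_ext (d j)" 0] W2.wcurve_int[of "word_ext (d j)" "int (length (d j))"]
        W2.word_ext_less[OF d(2)[OF j]] by simp
  qed
  show thesis
  proof (rule that[of D])
    show "follows_words n3 c3 n2 c2 D d"
      unfolding follows_words_def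
    proof (intro allI impI conjI)
      fix a assume a: "a < n3"
      show "\<exists>\<Theta>. continuous_on {0..1} \<Theta> \<and> strict_mono_on {0..1} \<Theta> \<and> \<Theta> 0 = 0 \<and> \<Theta> 1 = real (length (d a)) \<and>
        (\<forall>s\<in>{0..1}. D (c3 a s) = wcurve c2 (word_ext (d a)) (\<Theta> s))"
        using \<Theta>[OF a] D[OF a] by (intro exI[of _ "\<Theta> a"]) auto
    qed (use d in auto)
    fix y assume "y \<in> topspace W3"
    then show "U (D y) = F y" by (rule W3.wedge_cases) (use D \<Theta> in force)
  qed
qed

text \<open>Positive words embed in the fundamental group. Lifting the clock along a homotopy tells at which
time the \<open>i\<close>-th letter is read; the part of the loop that runs along the circle \<open>k\<close> at this time,
with everything else collapsed, is a map \<open>J\<close> to the circle whose total increment is invariant and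
decides whether the \<open>i\<close>-th letter is \<open>k\<close>. No covering space of the wedge is needed.\<close>
lemma (in wedge) wloop_homotopic_imp_eq:
  assumes v: "set v \<subseteq> {..<n}" "set v' \<subseteq> {..<n}" and hom: "loop_homotopic W w (wloop c v) (wloop c v')"
  shows "v = v'"
proof -
  define Q where "Q = {0..1::real} \<times> {0..1::real}"
  define V where "V t = (if t = 0 then v else v')" for t :: real
  have sV: "word_ext (V t) i < n" for t i using v word_ext_less by (auto simp: V_def)
  obtain h where h: "continuous_map (top_of_set Q) W h"
    and h01: "\<And>x. h (0, x) = wloop c v x" "\<And>x. h (1, x) = wloop c v' x"
    and hw: "\<And>t. t \<in> {0..1} \<Longrightarrow> h (t, 0) = w" "\<And>t. t \<in> {0..1} \<Longrightarrow> h (t, 1) = w"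
    using hom unfolding loop_homotopic_def homotopic_with_def Q_def by auto
  have hV: "h (t, x) = wloop c (V t) x" if "t \<in> {0, 1}" for t x using h01 that by (auto simp: V_def)
  have hin: "h z \<in> topspace W" if "z \<in> Q" for z using h that by (auto simp: continuous_map_def)
  have comp: "continuous_on Q (\<lambda>t. g (h t))" if "continuous_map W euclidean g" for g :: "'a \<Rightarrow> complex"
    using continuous_map_compose[OF h that] by (simp add: o_def)
  have Q: "convex Q" "closed Q" by (auto simp: Q_def convex_Times closed_Times)
  obtain \<Xi>0 where \<Xi>0: "continuous_on Q \<Xi>0" "\<And>z. z \<in> Q \<Longrightarrow> clock c n (h z) = cis (2 * pi * \<Xi>0 z)"
    by (rule circle_lift[OF Q(1) comp[OF clock_cont]]) (use hin norm_clock in auto)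
  define \<Xi> where "\<Xi> z = \<Xi>0 z - \<Xi>0 (0, 0)" for z
  have "(0, 0) \<in> Q" by (simp add: Q_def)
  then have "\<Xi>0 (0, 0) \<in> \<int>" using \<Xi>0(2)[of "(0, 0)"] hw(1)[of 0] by (simp add: cis_2pi_eq_1_iff)
  then obtain N :: int where N: "\<Xi>0 (0, 0) = of_int N" by (auto elim: Ints_cases)
  have cont: "continuous_on Q \<Xi>" unfolding \<Xi>_def by (intro continuous_intros \<Xi>0)
  have cl: "clock c n (h z) = cis (2 * pi * \<Xi> z)" if "z \<in> Q" for z
    unfolding \<Xi>0(2)[OF that] cis_2pi_eq_iff \<Xi>_def N by auto
  have edge: "continuous_on {0..1} (\<lambda>t. g (t, x))" "continuous_on {0..1} (\<lambda>t. g (x, t))"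
    if "continuous_on Q g" "x \<in> {0..1}" for g :: "real \<times> real \<Rightarrow> real" and x
    by (rule continuous_on_compose2[OF that(1)], use that(2) in \<open>auto simp: Q_def intro!: continuous_intros\<close>)+
  have const: "g (0, x) = g (1, x)" if g: "continuous_on Q g" "x \<in> {0..1}" "\<And>t. t \<in> {0..1} \<Longrightarrow> g (t, x) \<in> \<int>"
    for g :: "real \<times> real \<Rightarrow> real" and x
    by (rule integer_valued_constant[of "{0..1}" "\<lambda>t. g (t, x)" 0 1]) (use g edge in auto)
  have side: "\<Xi> (t, x) \<in> \<int>" if "t \<in> {0..1}" "x \<in> {0, 1}" for t x
  proof -
    have "h (t, x) = w" using hw[OF that(1)] that(2) by auto
    then show ?thesis using cl[of "(t, x)"] clock_w that by (auto simp: Q_def cis_2pi_eq_1_iff)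
  qed
  have z0: "\<Xi> (t, 0) = 0" if "t \<in> {0, 1}" for t
    using const[OF cont, of 0] side that by (auto simp: \<Xi>_def)
  have \<Xi>V: "\<Xi> (t, x) = real (length (V t)) * x" if t: "t \<in> {0, 1}" and x: "x \<in> {0..1}" for t x
  proof -
    have *: "cis (2 * pi * \<Xi> (t, y)) = cis (2 * pi * (real (length (V t)) * y))" if "y \<in> {0..1}" for y
      using cl[of "(t, y)"] hV[OF t] wcurve_clock[OF sV] that t by (auto simp: Q_def wloop_def)
    obtain M :: int where M: "\<And>y. y \<in> {0..1} \<Longrightarrow> \<Xi> (t, y) = real (length (V t)) * y + of_int M"
      by (rule circle_lift_unique[of "{0..1}" "\<lambda>y. \<Xi> (t, y)" "\<lambda>y. real (length (V t)) * y"])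
        (use * edge(2)[OF cont] t in \<open>auto intro!: continuous_intros\<close>)
    show ?thesis using M[of 0] M[OF x] z0[OF t] by simp
  qed
  \<comment> \<open>The side \<open>x = 1\<close> of the square stays at the wedge point, so the
    lifted clock is a constant integer along it; its values at the two ends are the two
    lengths.\<close>
  have len: "length v = length v'"
    using const[OF cont, of 1] side \<Xi>V[of 0 1] \<Xi>V[of 1 1] by (auto simp: V_def)
  have "v ! i = v' ! i" if i: "i < length v" for i
  proof -
    define k where "k = v ! i"
    define J where "J z = (if real i \<le> \<Xi> z \<and> \<Xi> z \<le> real i + 1 then circ c n k (h z) else 1)" for z
    define A where "A = Q \<inter> \<Xi> -` {real i..real i + 1}"
    define B where "B = Q \<inter> \<Xi> -` ({..real i} \<union> {real i + 1..})"
    have AB: "A \<union> B = Q" by (auto simp: A_def B_def)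
    have "continuous_on (A \<union> B) J"
      unfolding J_def
    proof (rule continuous_on_cases)
      show "closed A" "closed B" unfolding A_def B_def
        by (intro continuous_closed_preimage cont Q closed_Un; simp)+
      show "continuous_on A (\<lambda>z. circ c n k (h z))"
        by (rule continuous_on_subset[OF comp[OF circ_cont]]) (auto simp: A_def)
      \<comment> \<open>Where the two closed pieces meet, \<open>\<Xi>\<close> is an integer, so
        \<open>h\<close> is at the wedge point and the value is 1 from both sides.\<close>
      show "\<forall>z. z \<in> A \<and> \<not> (real i \<le> \<Xi> z \<and> \<Xi> z \<le> real i + 1) \<or> z \<in> B \<and> real i \<le> \<Xi> z \<and> \<Xi> z \<le> real i + 1 \<longrightarrow>
            circ c n k (h z) = 1"
      proof (intro allI impI)
        fix z assume "z \<in> A \<and> \<not> (real i \<le> \<Xi> z \<and> \<Xi> z \<le> real i + 1) \<or> z \<in> B \<and> real i \<le> \<Xi> z \<and> \<Xi> z \<le> real i + 1"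
        then have z: "z \<in> Q" "\<Xi> z = real i \<or> \<Xi> z = real i + 1" by (auto simp: A_def B_def)
        then have "\<Xi> z \<in> \<int>" by auto
        then have "h z = w" using cl[OF z(1)] clock_eq_1_iff[OF hin[OF z(1)]] by (simp add: cis_2pi_eq_1_iff)
        then show "circ c n k (h z) = 1" by simp
      qed
    qed auto
    then have J: "continuous_on Q J" by (simp add: AB)
    obtain \<beta> where \<beta>: "continuous_on Q \<beta>" "\<And>z. z \<in> Q \<Longrightarrow> J z = cis (2 * pi * \<beta> z)"
      by (rule circle_lift[OF Q(1) J]) (use hin norm_circ in \<open>auto simp: J_def\<close>)
    have int: "\<beta> (t, x) \<in> \<int>" if "t \<in> {0..1}" "x \<in> {0, 1}" for t x
    proof -
      have "h (t, x) = w" using hw[OF that(1)] that(2) by auto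
      then have "J (t, x) = 1" by (simp add: J_def)
      then show ?thesis using \<beta>(2)[of "(t, x)"] that by (auto simp: Q_def cis_2pi_eq_1_iff)
    qed
    \<comment> \<open>On the sides \<open>x = 0\<close> and \<open>x = 1\<close> the lift
      \<open>\<beta>\<close> is integer-valued, hence constant. So \<open>J\<close> has the same
      total turning along the loop at both ends of the homotopy.\<close>
    have inc: "\<beta> (0, 1) - \<beta> (0, 0) = \<beta> (1, 1) - \<beta> (1, 0)"
      using const[OF \<beta>(1), of 0] const[OF \<beta>(1), of 1] int by auto
    have inc_eq: "\<beta> (t, 1) - \<beta> (t, 0) = (if V t ! i = k then 1 else 0)" if t: "t \<in> {0, 1}" for t
    proof -
      define L where "L = real (length (V t))"
      have iL: "i < length (V t)" "real i + 1 \<le> L" using i len by (auto simp: V_def L_def)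
      \<comment> \<open>An explicit lift of \<open>J\<close> along one edge: a ramp of height one
        while the i-th letter is read if that letter is \<open>k\<close>, and zero
        otherwise.\<close>
      define G where "G x = (if V t ! i = k then max 0 (min 1 (L * x - real i)) else 0)" for x
      have *: "cis (2 * pi * \<beta> (t, x)) = cis (2 * pi * G x)" if x: "x \<in> {0..1}" for x
      proof -
        have tx: "(t, x) \<in> Q" using t x by (auto simp: Q_def)
        have eq: "\<Xi> (t, x) = L * x" using \<Xi>V[OF t x] by (simp add: L_def)
        show ?thesis
        proof (cases "real i \<le> L * x \<and> L * x \<le> real i + 1")
          case True
          have "h (t, x) = c (V t ! i) (L * x - real i)"
            using hV[OF t, of x] wcurve_piece[of "word_ext (V t)" "int i" "L * x"] sV True iL by (simp add: wloop_def L_def word_ext_def)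
          then have "J (t, x) = (if V t ! i = k then cis (2 * pi * (L * x - real i)) else 1)"
            using True sV[of t "int i"] iL circ_c[of "V t ! i" "L * x - real i" k] by (simp add: J_def eq word_ext_def)
          then show ?thesis using True \<beta>(2)[OF tx] by (auto simp: G_def)
        next
          case False
          then have "J (t, x) = 1" unfolding J_def eq by auto
          moreover have "G x = 0 \<or> G x = 1" using False by (auto simp: G_def)
          ultimately show ?thesis using \<beta>(2)[OF tx] cis_2pi_int[of 1] by auto
        qed
      qed
      have G: "continuous_on {0..1} G"
        unfolding G_def by (cases "V t ! i = k") (auto intro!: continuous_intros)
      obtain M :: int where M: "\<And>y. y \<in> {0..1} \<Longrightarrow> \<beta> (t, y) = G y + of_int M"
        by (rule circle_lift_unique[of "{0..1}" "\<lambda>y. \<beta> (t, y)" G])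
          (use * edge(2)[OF \<beta>(1)] t G in auto)
      show ?thesis using M[of 0] M[of 1] iL by (auto simp: G_def)
    qed
    show ?thesis using inc inc_eq[of 0] inc_eq[of 1] by (auto simp: V_def k_def split: if_splits)
  qed
  then show ?thesis using len by (simp add: list_eq_iff_nth_eq)
qed

section \<open>The fundamental group of a wedge\<close>

lemma loop_homotopic_sym: "loop_homotopic W w g h \<Longrightarrow> loop_homotopic W w h g"
  unfolding loop_homotopic_def by (rule homotopic_with_symD)

lemma loop_homotopic_trans [trans]: "loop_homotopic W w g h \<Longrightarrow> loop_homotopic W w h k \<Longrightarrow> loop_homotopic W w g k"
  unfolding loop_homotopic_def by (rule homotopic_with_trans)

lemma loop_homotopic_imp_loopin:
  assumes "loop_homotopic W w g h"
  shows "loopin W w g" "loopin W w h"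
  using homotopic_with_imp_continuous_maps[of _ _ W g h] homotopic_with_imp_property[of _ _ W g h] assms
  unfolding loop_homotopic_def loopin_def pathin_def by blast+

lemma loop_homotopic_refl: "loopin W w g \<Longrightarrow> loop_homotopic W w g g"
  by (simp add: loop_homotopic_def loopin_def pathin_def)

lemma loop_homotopic_eqI:
  assumes "loopin W w g" "\<And>s. s \<in> {0..1} \<Longrightarrow> g s = h s"
  shows "loop_homotopic W w g h"
  unfolding loop_homotopic_def
  by (rule homotopic_with_equal) (use assms in \<open>force simp: loopin_def pathin_def\<close>)+

lemma loop_class_eq: "loop_homotopic W w g h \<Longrightarrow> loop_class W w g = loop_class W w h"
  unfolding loop_class_def by (auto intro: loop_homotopic_trans loop_homotopic_sym)

lemma loop_class_eq_iff:
  assumes "loopin W w h"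
  shows "loop_class W w g = loop_class W w h \<longleftrightarrow> loop_homotopic W w g h"
proof
  assume "loop_class W w g = loop_class W w h"
  moreover have "h \<in> loop_class W w h" using assms loop_homotopic_refl by (auto simp: loop_class_def)
  ultimately show "loop_homotopic W w g h" by (auto simp: loop_class_def)
qed (rule loop_class_eq)

lemma continuous_map_reparam:
  assumes "continuous_map (top_of_set Q) W H" "continuous_on S r" "r ` S \<subseteq> Q"
  shows "continuous_map (top_of_set S) W (\<lambda>z. H (r z))"
proof -
  have "continuous_map (top_of_set S) (top_of_set Q) r"
    using assms(2,3) by (auto simp: continuous_map_in_subtopology)
  from continuous_map_compose[OF this assms(1)] show ?thesis by (simp add: o_def)
qed

lemma loop_homotopic_concat:
  assumes "loop_homotopic W w g g'" "loop_homotopic W w h h'"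
  shows "loop_homotopic W w (concat_path g h) (concat_path g' h')"
proof -
  define Q where "Q = {0..1::real} \<times> {0..1::real}"
  obtain G where G: "continuous_map (top_of_set Q) W G" "\<And>x. G (0, x) = g x" "\<And>x. G (1, x) = g' x"
    "\<And>t. t \<in> {0..1} \<Longrightarrow> G (t, 0) = w \<and> G (t, 1) = w"
    using assms(1) unfolding loop_homotopic_def homotopic_with_def Q_def by auto
  obtain H where H: "continuous_map (top_of_set Q) W H" "\<And>x. H (0, x) = h x" "\<And>x. H (1, x) = h' x"
    "\<And>t. t \<in> {0..1} \<Longrightarrow> H (t, 0) = w \<and> H (t, 1) = w"
    using assms(2) unfolding loop_homotopic_def homotopic_with_def Q_def by auto
  define K where "K z = (if snd z \<le> 1/2 then G (fst z, 2 * snd z) else H (fst z, 2 * snd z - 1))" for z :: "real \<times> real"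
  have "continuous_map (top_of_set Q) W K"
    unfolding K_def
  proof (rule continuous_map_cases_le)
    show "continuous_map (subtopology (top_of_set Q) {x \<in> topspace (top_of_set Q). snd x \<le> 1/2}) W (\<lambda>z. G (fst z, 2 * snd z))"
      unfolding subtopology_subtopology
      by (rule continuous_map_reparam[OF G(1)]) (auto simp: Q_def intro!: continuous_intros)
    show "continuous_map (subtopology (top_of_set Q) {x \<in> topspace (top_of_set Q). 1/2 \<le> snd x}) W (\<lambda>z. H (fst z, 2 * snd z - 1))"
      unfolding subtopology_subtopology
      by (rule continuous_map_reparam[OF H(1)]) (auto simp: Q_def intro!: continuous_intros)
    show "G (fst z, 2 * snd z) = H (fst z, 2 * snd z - 1)" if "z \<in> topspace (top_of_set Q)" "snd z = 1/2" for z
    proof -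
      have "2 * snd z = 1" "2 * snd z - 1 = 0" "fst z \<in> {0..1}" using that by (auto simp: Q_def)
      then show ?thesis using G(4) H(4) by metis
    qed
  qed (auto intro!: continuous_intros)
  then show ?thesis
    unfolding loop_homotopic_def homotopic_with_def Q_def
    using G H by (intro exI[of _ K]) (auto simp: K_def concat_path_def)
qed

lemma loopin_concat: "loopin W w g \<Longrightarrow> loopin W w h \<Longrightarrow> loopin W w (concat_path g h)"
  using loop_homotopic_concat[OF loop_homotopic_refl loop_homotopic_refl] loop_homotopic_imp_loopin(1) by metis

lemma fundamental_group_carrier: "A \<in> carrier (fundamental_group W w) \<longleftrightarrow> (\<exists>g. loopin W w g \<and> A = loop_class W w g)"
  by (auto simp: fundamental_group_def)

lemma loop_class_mult:
  assumes "loopin W w g" "loopin W w h"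
  shows "loop_class W w g \<otimes>\<^bsub>fundamental_group W w\<^esub> loop_class W w h = loop_class W w (concat_path g h)"
  unfolding fundamental_group_def loop_class_def using assms
  by (auto intro: loop_homotopic_trans loop_homotopic_concat loop_homotopic_refl)

lemma loop_homotopic_compose:
  assumes "loop_homotopic W' w' g h" "continuous_map W' W f" "f w' = w"
  shows "loop_homotopic W w (f \<circ> g) (f \<circ> h)"
  using homotopic_with_compose_continuous_map_left[OF assms(1)[unfolded loop_homotopic_def] assms(2)] assms(3)
  unfolding loop_homotopic_def by auto

lemma loopin_compose: "loopin W' w' g \<Longrightarrow> continuous_map W' W f \<Longrightarrow> f w' = w \<Longrightarrow> loopin W w (f \<circ> g)"
  using loop_homotopic_compose[OF loop_homotopic_refl] loop_homotopic_imp_loopin(1) by metis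

lemma pi1_map_class:
  assumes "loopin W' w' g" "continuous_map W' W f" "f w' = w"
  shows "pi1_map W w f (loop_class W' w' g) = loop_class W w (f \<circ> g)"
  unfolding pi1_map_def loop_class_def
  using assms loop_homotopic_refl[OF assms(1)]
  by (auto intro: loop_homotopic_trans loop_homotopic_compose)

lemma pi1_map_hom:
  assumes "continuous_map W' W f" "f w' = w"
  shows "pi1_map W w f \<in> hom (fundamental_group W' w') (fundamental_group W w)"
proof (rule homI)
  show "pi1_map W w f x \<in> carrier (fundamental_group W w)" if "x \<in> carrier (fundamental_group W' w')" for x
    using that assms pi1_map_class loopin_compose unfolding fundamental_group_carrier by metis
  fix x y assume "x \<in> carrier (fundamental_group W' w')" "y \<in> carrier (fundamental_group W' w')"
  then obtain g h where g: "loopin W' w' g" "x = loop_class W' w' g" and h: "loopin W' w' h" "y = loop_class W' w' h"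
    unfolding fundamental_group_carrier by blast
  have "f \<circ> concat_path g h = concat_path (f \<circ> g) (f \<circ> h)" by (auto simp: concat_path_def)
  then show "pi1_map W w f (x \<otimes>\<^bsub>fundamental_group W' w'\<^esub> y) =
      pi1_map W w f x \<otimes>\<^bsub>fundamental_group W w\<^esub> pi1_map W w f y"
    using g h assms by (simp add: loop_class_mult pi1_map_class loopin_concat loopin_compose)
qed

section \<open>Positive words as elements of the fundamental group\<close>

context wedge
begin

text \<open>The parameters are interpolated linearly, so the homotopy never leaves the curve; common
  integer values at the ends keep them at the wedge point.\<close>

lemma wcurve_reparam_homotopic:
  assumes \<kappa>: "\<And>i. \<kappa> i < n" and \<Theta>: "continuous_on {0..1} \<Theta>" "continuous_on {0..1} \<Theta>'"
    and e: "\<Theta> 0 = of_int i" "\<Theta>' 0 = of_int i" "\<Theta> 1 = of_int j" "\<Theta>' 1 = of_int j"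
  shows "loop_homotopic W w (\<lambda>s. wcurve c \<kappa> (\<Theta> s)) (\<lambda>s. wcurve c \<kappa> (\<Theta>' s))"
proof -
  define K where "K z = wcurve c \<kappa> ((1 - fst z) * \<Theta> (snd z) + fst z * \<Theta>' (snd z))" for z :: "real \<times> real"
  have c2: "continuous_on ({0..1} \<times> {0..1}) (\<lambda>z. g (snd z))" if "continuous_on {0..1} g" for g :: "real \<Rightarrow> real"
    by (rule continuous_on_compose2[OF that]) (auto intro!: continuous_intros)
  have "continuous_map (top_of_set ({0..1} \<times> {0..1})) W K"
    unfolding K_def by (rule wcurve_comp_cont[OF \<kappa>]) (auto intro!: continuous_intros c2 \<Theta>)
  moreover have "K (t, 0) = w" "K (t, 1) = w" for t
    using wcurve_int[of \<kappa> i] wcurve_int[of \<kappa> j] \<kappa> e by (simp_all add: K_def algebra_simps)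
  ultimately show ?thesis
    unfolding loop_homotopic_def homotopic_with_def
    by (intro exI[of _ K]) (auto simp: K_def)
qed

lemma wloop_loopin: "set v \<subseteq> {..<n} \<Longrightarrow> loopin W w (wloop c v)"
  using wcurve_reparam_homotopic[of "word_ext v" "\<lambda>s. real (length v) * s" "\<lambda>s. real (length v) * s" 0 "int (length v)"]
    word_ext_less loop_homotopic_imp_loopin(1)
  unfolding wloop_def by (auto intro!: continuous_intros)

lemma c_loopin: "a < n \<Longrightarrow> loopin W w (c a)"
  by (simp add: loopin_def c_pathin c_0 c_1)

lemma c_class: "a < n \<Longrightarrow> loop_class W w (c a) = loop_class W w (wloop c [a])"
  by (intro loop_class_eq loop_homotopic_eqI) (auto simp: c_loopin wloop_def wcurve_singleton)

lemma wloop_append_class: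
  assumes u: "set u \<subseteq> {..<n}" and v: "set v \<subseteq> {..<n}"
  shows "loop_class W w (wloop c (u @ v)) =
    loop_class W w (wloop c u) \<otimes>\<^bsub>fundamental_group W w\<^esub> loop_class W w (wloop c v)"
proof -
  define \<Theta> where "\<Theta> s = (if s \<le> 1/2 then real (length u) * (2 * s) else real (length u) + real (length v) * (2 * s - 1))" for s :: real
  have uv: "set (u @ v) \<subseteq> {..<n}" using u v by simp
  have "continuous_on ({..1/2} \<union> {1/2..}) \<Theta>"
    unfolding \<Theta>_def
  proof (rule continuous_on_If)
    show "real (length u) * (2 * s) = real (length u) + real (length v) * (2 * s - 1)" if "s \<in> {1/2..}" "s \<le> 1/2" for s :: real
    proof -
      have s: "s = 1/2" using that by simp
      show ?thesis unfolding s by simp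
    qed
  qed (auto intro!: continuous_intros)
  then have \<Theta>: "continuous_on {0..1} \<Theta>" by (rule continuous_on_subset) auto
  have \<Theta>01: "\<Theta> 0 = 0" "\<Theta> 1 = real (length u) + real (length v)" by (auto simp: \<Theta>_def)
  have "loop_homotopic W w (concat_path (wloop c u) (wloop c v)) (\<lambda>s. wcurve c (word_ext (u @ v)) (\<Theta> s))"
  proof (rule loop_homotopic_eqI)
    fix s :: real assume s: "s \<in> {0..1}"
    show "concat_path (wloop c u) (wloop c v) s = wcurve c (word_ext (u @ v)) (\<Theta> s)"
      using wcurve_append_left[OF u v, of "real (length u) * (2 * s)"] wcurve_append_right[OF u v, of "real (length v) * (2 * s - 1)"]
        mult_left_mono[of "2 * s" 1 "real (length u)"] mult_left_mono[of "2 * s - 1" 1 "real (length v)"] s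
      by (auto simp: concat_path_def wloop_def \<Theta>_def)
  qed (intro loopin_concat wloop_loopin u v)
  also have "loop_homotopic W w (\<lambda>s. wcurve c (word_ext (u @ v)) (\<Theta> s)) (wloop c (u @ v))"
    unfolding wloop_def
    by (rule wcurve_reparam_homotopic[OF word_ext_less[OF uv], of _ _ 0 "int (length (u @ v))"])
      (auto intro!: continuous_intros \<Theta> simp: \<Theta>01)
  finally have "loop_homotopic W w (concat_path (wloop c u) (wloop c v)) (wloop c (u @ v))" .
  from loop_class_eq[OF this] show ?thesis by (simp add: loop_class_mult wloop_loopin u v)
qed

text \<open>Concatenating loops concatenates words, and a product of generators has at least one
  factor. Positivity of a homomorphism thereby becomes a statement about words.\<close>

lemma pos_semigroup_eq:
  "pos_semigroup (fundamental_group W w) (pos_generators W w n c) =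
    {loop_class W w (wloop c v) | v. v \<noteq> [] \<and> set v \<subseteq> {..<n}}" (is "?L = ?R")
proof
  show "?L \<subseteq> ?R"
  proof
    fix A assume "A \<in> ?L"
    then show "A \<in> ?R"
    proof induction
      case (gen s)
      then obtain k where "k < n" "s = loop_class W w (c k)" by (auto simp: pos_generators_def)
      then show ?case using c_class[of k] by (auto intro!: exI[of _ "[k]"])
    next
      case (mult a b)
      then obtain u v where "u \<noteq> []" "set u \<subseteq> {..<n}" "a = loop_class W w (wloop c u)"
        "v \<noteq> []" "set v \<subseteq> {..<n}" "b = loop_class W w (wloop c v)" by blast
      then show ?case using wloop_append_class[of u v] by (auto intro!: exI[of _ "u @ v"])
    qed
  qed
  have "loop_class W w (wloop c v) \<in> ?L" if "v \<noteq> []" "set v \<subseteq> {..<n}" for v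
    using that
  proof (induction v rule: list_nonempty_induct)
    case (single a)
    then show ?case by (auto simp flip: c_class intro!: pos_semigroup.gen simp: pos_generators_def)
  next
    case (cons a v)
    then have "loop_class W w (wloop c [a]) \<in> ?L"
      by (auto simp flip: c_class intro!: pos_semigroup.gen simp: pos_generators_def)
    then show ?case using cons wloop_append_class[of "[a]" v] by (auto intro: pos_semigroup.mult)
  qed
  then show "?R \<subseteq> ?L" by blast
qed

lemma follows_words_wloop_class:
  assumes W': "wedge W' w' n' c'" and f: "follows_words n' c' n c f v" and u: "set u \<subseteq> {..<n'}"
  shows "pi1_map W w f (loop_class W' w' (wloop c' u)) = loop_class W w (wloop c (concat (map v u)))"
proof -
  interpret W': wedge W' w' n' c' by fact
  let ?u = "concat (map v u)"
  obtain \<Theta> where \<Theta>: "continuous_on {0..real (length u)} \<Theta>" "\<Theta> 0 = 0"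
    "\<Theta> (real (length u)) = real (length ?u)"
    "\<And>x. x \<in> {0..real (length u)} \<Longrightarrow> f (wcurve c' (word_ext u) x) = wcurve c (word_ext ?u) (\<Theta> x)"
    by (rule follows_words_along_word[OF W' wedge_axioms f u]) blast
  have su: "set ?u \<subseteq> {..<n}" using f u by (fastforce simp: follows_words_def)
  have fc: "continuous_map W' W f" "f w' = w" using follows_words_cont[OF W' f] by auto
  have im: "real (length u) * s \<in> {0..real (length u)}" if "s \<in> {0..1}" for s
    using that mult_left_mono[of s 1 "real (length u)"] by auto
  have "loop_homotopic W w (f \<circ> wloop c' u) (\<lambda>s. wcurve c (word_ext ?u) (\<Theta> (real (length u) * s)))"
    by (rule loop_homotopic_eqI[OF loopin_compose[OF W'.wloop_loopin[OF u] fc]])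
      (use \<Theta>(4)[OF im] in \<open>auto simp: wloop_def\<close>)
  also have "loop_homotopic W w \<dots> (wloop c ?u)"
    unfolding wloop_def
  proof (rule wcurve_reparam_homotopic[OF word_ext_less[OF su], of _ _ 0 "int (length ?u)"])
    show "continuous_on {0..1} (\<lambda>s. \<Theta> (real (length u) * s))"
      by (rule continuous_on_compose2[OF \<Theta>(1)]) (use im in \<open>auto intro!: continuous_intros\<close>)
  qed (use \<Theta> in \<open>auto intro!: continuous_intros\<close>)
  finally show ?thesis using loop_class_eq pi1_map_class[OF W'.wloop_loopin[OF u] fc] by simp
qed

lemma follows_words_positive_hom:
  assumes W': "wedge W' w' n' c'" and f: "follows_words n' c' n c f v"
  shows "positive_hom (fundamental_group W' w') (pos_generators W' w' n' c')
    (fundamental_group W w) (pos_generators W w n c) (pi1_map W w f)"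
  unfolding positive_hom_def wedge.pos_semigroup_eq[OF W'] pos_semigroup_eq
proof (intro conjI subsetI)
  show "pi1_map W w f \<in> hom (fundamental_group W' w') (fundamental_group W w)"
    using follows_words_cont[OF W' f] by (rule pi1_map_hom)
  fix A assume "A \<in> pi1_map W w f ` {loop_class W' w' (wloop c' v) |v. v \<noteq> [] \<and> set v \<subseteq> {..<n'}}"
  then obtain u where u: "u \<noteq> []" "set u \<subseteq> {..<n'}" "A = pi1_map W w f (loop_class W' w' (wloop c' u))" by blast
  have "concat (map v u) \<noteq> []" "set (concat (map v u)) \<subseteq> {..<n}"
    using f u by (cases u; fastforce simp: follows_words_def)+
  then show "A \<in> {loop_class W w (wloop c v) |v. v \<noteq> [] \<and> set v \<subseteq> {..<n}}"
    using follows_words_wloop_class[OF W' f u(2)] u(3) by blast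
qed

text \<open>On each circle both maps run through one \<open>wcurve\<close> with equal end values, so
  their parameters can be interpolated linearly. The homotopy lives on the whole wedge and fixes the
  wedge point; it is composed with \<open>g\<close> only at the end and so treats all loops
  alike.\<close>

lemma same_words_homotopic:
  assumes W': "wedge W' w' n' c'" and f: "follows_words n' c' n c f v" and f': "follows_words n' c' n c f' v"
    and g: "loopin W' w' g"
  shows "loop_homotopic W w (f \<circ> g) (f' \<circ> g)"
proof -
  interpret W': wedge W' w' n' c' by fact
  let ?P = "\<lambda>h \<Theta> a. continuous_on {0..1} \<Theta> \<and> \<Theta> 0 = 0 \<and> \<Theta> 1 = real (length (v a)) \<and>
     (\<forall>s\<in>{0..1}. h (c' a s) = wcurve c (word_ext (v a)) (\<Theta> s))"
  have sv: "word_ext (v a) i < n" if "a < n'" for a i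
    using f that by (auto simp: follows_words_def intro: word_ext_less)
  obtain \<Theta> where \<Theta>: "\<And>a. a < n' \<Longrightarrow> ?P f (\<Theta> a) a" using f unfolding follows_words_def by metis
  obtain \<Phi> where \<Phi>: "\<And>a. a < n' \<Longrightarrow> ?P f' (\<Phi> a) a" using f' unfolding follows_words_def by metis
  define L where "L t a s = wcurve c (word_ext (v a)) ((1 - t) * \<Theta> a s + t * \<Phi> a s)" for t a s
  define H where "H z = wedge_fun c' n' (L (fst z)) (snd z)" for z :: "real \<times> 'b"
  have H: "H (t, c' a s) = L t a s" if "a < n'" "0 \<le> s" "s \<le> 1" for t a s
    unfolding H_def fst_conv snd_conv
  proof (rule W'.wedge_fun_eq[where v=w, OF that])
    fix j assume j: "j < n'"
    have "(1 - t) * \<Theta> j 1 + t * \<Phi> j 1 = of_int (int (length (v j)))" using \<Theta>[OF j] \<Phi>[OF j] by (simp add: algebra_simps)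
    then show "L t j 0 = w \<and> L t j 1 = w"
      using \<Theta>[OF j] \<Phi>[OF j] wcurve_int[of "word_ext (v j)" 0] wcurve_int[of "word_ext (v j)" "int (length (v j))"] sv[OF j] by (simp add: L_def)
  qed
  have c2: "continuous_on ({0..1} \<times> {0..1}) (\<lambda>z. g (snd z))" if "continuous_on {0..1} g" for g :: "real \<Rightarrow> real"
    by (rule continuous_on_compose2[OF that]) (auto intro!: continuous_intros)
  have Hc: "continuous_map (prod_topology (top_of_set {0..1}) W') W H"
  proof (rule continuous_map_glue[where A="{..<n'}" and K="\<lambda>_. top_of_set ({0..1} \<times> {0..1})"
        and e="\<lambda>a z. (fst z, c' a (snd z))"])
    fix a assume "a \<in> {..<n'}"
    then have a: "a < n'" by simp
    show "compact_space (top_of_set ({0..1::real} \<times> {0..1::real}))" by (simp add: compact_space_subtopology compact_Times)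
    have "continuous_map (top_of_set ({0..1} \<times> {0..1})) W' (\<lambda>z. c' a (snd z))"
      by (rule continuous_map_reparam[OF W'.c_cont[OF a]]) (auto intro!: continuous_intros)
    then show "continuous_map (top_of_set ({0..1} \<times> {0..1})) (prod_topology (top_of_set {0..1}) W') (\<lambda>z. (fst z, c' a (snd z)))"
      by (intro continuous_map_pairedI) (auto simp: continuous_map_in_subtopology intro!: continuous_intros)
    have "continuous_map (top_of_set ({0..1} \<times> {0..1})) W (\<lambda>z. L (fst z) a (snd z))"
      unfolding L_def by (rule wcurve_comp_cont[OF sv[OF a]]) (use \<Theta>[OF a] \<Phi>[OF a] in \<open>auto intro!: continuous_intros c2\<close>)
    then show "continuous_map (top_of_set ({0..1} \<times> {0..1})) W (H \<circ> (\<lambda>z. (fst z, c' a (snd z))))"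
      by (rule continuous_map_eq) (use H a in auto)
  next
    show "topspace (prod_topology (top_of_set {0..1}) W') \<subseteq>
      (\<Union>a\<in>{..<n'}. (\<lambda>z. (fst z, c' a (snd z))) ` topspace (top_of_set ({0..1} \<times> {0..1})))"
      unfolding topspace_prod_topology W'.topW by force
  qed (auto simp: Hausdorff_space_prod_topology W'.Haus Hausdorff_space_subtopology)
  have Hw: "H (t, w') = w" for t
    using H[OF W'.n_pos, of 0 t] W'.c_0[OF W'.n_pos] \<Theta>[OF W'.n_pos] \<Phi>[OF W'.n_pos] wcurve_int[of "word_ext (v 0)" 0] sv[OF W'.n_pos]
    by (simp add: L_def)
  have gin: "g s \<in> topspace W'" if "s \<in> {0..1}" for s
    using g that by (auto simp: loopin_def pathin_def continuous_map_def)
  have H0: "H (0, y) = f y" "H (1, y) = f' y" if "y \<in> topspace W'" for y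
    using that by (rule W'.wedge_cases, use H \<Theta> \<Phi> in \<open>force simp: L_def\<close>)+
  have "continuous_map (top_of_set ({0..1} \<times> {0..1})) W' (\<lambda>z. g (snd z))"
    by (rule continuous_map_reparam) (use g in \<open>auto simp: loopin_def pathin_def intro!: continuous_intros\<close>)
  then have gc: "continuous_map (prod_topology (top_of_set {0..1}) (top_of_set {0..1})) (prod_topology (top_of_set {0..1}) W') (\<lambda>z. (fst z, g (snd z)))"
    by (intro continuous_map_pairedI) (auto simp: continuous_map_in_subtopology intro: continuous_on_fst[OF continuous_on_id])
  have "loop_homotopic W w (\<lambda>s. H (0, g s)) (\<lambda>s. H (1, g s))"
    unfolding loop_homotopic_def homotopic_with_def
    using continuous_map_compose[OF gc Hc] g Hw by (intro exI[of _ "\<lambda>z. H (fst z, g (snd z))"]) (auto simp: o_def loopin_def)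
  then have 1: "loop_homotopic W w (\<lambda>s. H (0, g s)) (f' \<circ> g)"
    using loop_homotopic_trans loop_homotopic_eqI[of W w "\<lambda>s. H (1, g s)" "f' \<circ> g"] H0 gin loop_homotopic_imp_loopin by (metis comp_apply)
  then have 2: "loop_homotopic W w (\<lambda>s. H (0, g s)) (f \<circ> g)"
    using loop_homotopic_eqI[of W w "\<lambda>s. H (0, g s)" "f \<circ> g"] H0 gin loop_homotopic_imp_loopin(1) by (metis comp_apply)
  show ?thesis by (rule loop_homotopic_trans[OF loop_homotopic_sym[OF 2] 1])
qed

end

section \<open>Clocks on flows\<close>

definition clock_lift :: "(real \<Rightarrow> complex) \<Rightarrow> (real \<Rightarrow> real) \<Rightarrow> bool" where
  "clock_lift \<gamma> \<Theta> \<longleftrightarrow> continuous_on UNIV \<Theta> \<and> strict_mono \<Theta> \<and> (\<forall>t. \<gamma> t = cis (2 * pi * \<Theta> t))"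

locale compact_flow =
  fixes X :: "'a topology" and \<phi> :: "real \<Rightarrow> 'a \<Rightarrow> 'a"
  assumes compact: "compact_space X"
    and flow_cont: "continuous_map (prod_topology euclideanreal X) X (\<lambda>(t, x). \<phi> t x)"
    and flow_0: "\<And>x. x \<in> topspace X \<Longrightarrow> \<phi> 0 x = x"
    and flow_add: "\<And>x s t. x \<in> topspace X \<Longrightarrow> \<phi> (s + t) x = \<phi> s (\<phi> t x)"
begin

lemma flow_in: "x \<in> topspace X \<Longrightarrow> \<phi> t x \<in> topspace X"
  using flow_cont by (auto simp: continuous_map_def Pi_iff)

lemma flow_comp_cont:
  assumes "continuous_map Z euclideanreal s" "continuous_map Z X A"
  shows "continuous_map Z X (\<lambda>z. \<phi> (s z) (A z))"
  using continuous_map_compose[OF continuous_map_pairedI[OF assms] flow_cont] by (simp add: o_def)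

lemma orbit_cont: "x \<in> topspace X \<Longrightarrow> continuous_map euclideanreal X (\<lambda>t. \<phi> t x)"
  by (rule flow_comp_cont) auto

text \<open>By compactness every clock advances by a uniform positive amount in unit time.\<close>
lemma clock_lift_surj:
  assumes F: "continuous_map X euclidean F"
    and lifts: "\<And>x. x \<in> topspace X \<Longrightarrow> \<exists>\<Theta>. clock_lift (\<lambda>t. F (\<phi> t x)) \<Theta>"
    and x: "x \<in> topspace X" and \<Theta>: "clock_lift (\<lambda>t. F (\<phi> t x)) \<Theta>"
  shows "surj \<Theta>"
proof -
  \<comment> \<open>Points whose clock strays by at most \<open>1 / (n + 1)\<close> during one unit
    of time. A point common to all these closed sets would have a constant clock on that time
    interval, against the strict increase of its lift.\<close>
  define C where "C n = (\<Inter>s\<in>{0..1::real}. {z \<in> topspace X. norm (F (\<phi> s z) - F z) \<in> {..inverse (real (Suc n))}})" for n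
  have clC: "closedin X (C n)" for n
    unfolding C_def
  proof (rule closedin_INT)
    fix s :: real
    have "continuous_map X euclidean (\<lambda>z. F (\<phi> s z))"
      using continuous_map_compose[OF flow_comp_cont[OF _ continuous_map_id[unfolded id_def], of "\<lambda>_. s"] F] by (simp add: o_def)
    then have "continuous_map X euclideanreal (\<lambda>z. norm (F (\<phi> s z) - F z))"
      by (intro continuous_map_norm continuous_map_diff F)
    then show "closedin X {z \<in> topspace X. norm (F (\<phi> s z) - F z) \<in> {..inverse (real (Suc n))}}"
      by (rule closedin_continuous_map_preimage) simp
  qed auto
  have "\<exists>n. C n = {}"
  proof (rule ccontr)
    assume ne: "\<nexists>n. C n = {}"
    have "decseq C"
    proof (rule decseq_SucI)
      fix n
      have "inverse (real (Suc (Suc n))) \<le> inverse (real (Suc n))" by (simp add: field_simps)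
      then show "C (Suc n) \<subseteq> C n" unfolding C_def by (intro INT_anti_mono subset_refl) (auto intro: order_trans)
    qed
    then obtain z where z: "\<And>n. z \<in> C n" using compact_space_imp_nest[OF compact, of C] clC ne by blast
    have zX: "z \<in> topspace X" using z[of 0] by (auto simp: C_def dest: bspec[of _ _ 0])
    have "norm (F (\<phi> s z) - F z) = 0" if s: "s \<in> {0..1}" for s
    proof (rule ccontr)
      assume "norm (F (\<phi> s z) - F z) \<noteq> 0"
      then obtain n where "inverse (real (Suc n)) < norm (F (\<phi> s z) - F z)"
        using reals_Archimedean[of "norm (F (\<phi> s z) - F z)"] by auto
      moreover have "norm (F (\<phi> s z) - F z) \<le> inverse (real (Suc n))" using z[of n] s by (auto simp: C_def)
      ultimately show False by simp
    qed
    then have eq: "F (\<phi> s z) = F z" if "s \<in> {0..1}" for s using that by simp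
    obtain \<Theta>z where "clock_lift (\<lambda>t. F (\<phi> t z)) \<Theta>z" using lifts[OF zX] by blast
    then have \<Theta>z: "continuous_on UNIV \<Theta>z" "strict_mono \<Theta>z" "\<And>t. F (\<phi> t z) = cis (2 * pi * \<Theta>z t)"
      by (auto simp: clock_lift_def)
    have "\<Theta>z 0 - \<Theta>z 0 = \<Theta>z 1 - \<Theta>z 0"
    proof (rule integer_valued_constant[of "{0..1}" "\<lambda>s. \<Theta>z s - \<Theta>z 0" 0 1])
      fix s :: real assume "s \<in> {0..1}"
      then have "cis (2 * pi * \<Theta>z s) = cis (2 * pi * \<Theta>z 0)" using eq[of s] eq[of 0] \<Theta>z(3) by auto
      then show "\<Theta>z s - \<Theta>z 0 \<in> \<int>" unfolding cis_2pi_eq_iff by auto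
    qed (auto intro!: continuous_intros continuous_on_subset[OF \<Theta>z(1)])
    then show False using strict_monoD[OF \<Theta>z(2), of 0 1] by simp
  qed
  then obtain n where n: "C n = {}" by blast
  define e where "e = inverse (real (Suc n))"
  have e: "e > 0" by (simp add: e_def)
  have big: "\<exists>s\<in>{0..1}. norm (F (\<phi> s z) - F z) > e" if "z \<in> topspace X" for z
  proof (rule ccontr)
    assume "\<not> ?thesis"
    then have "z \<in> C n" using that by (auto simp: C_def e_def not_less)
    then show False using n by simp
  qed
  \<comment> \<open>Converts the chord length \<open>e\<close> into an angle: a clock that strays by
    more than \<open>e\<close> has turned by at least \<open>d\<close>. Gaining \<open>d\<close> in
    every unit of time makes the lift unbounded in both directions.\<close>
  have "continuous_on UNIV (\<lambda>u. cis (2 * pi * u))" by (intro continuous_intros)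
  then obtain d where "d > 0" "\<And>u. dist u 0 < d \<Longrightarrow> dist (cis (2 * pi * u)) (cis (2 * pi * 0)) < e"
    using e unfolding continuous_on_iff by (meson UNIV_I)
  then have d: "d > 0" "\<And>u. \<bar>u\<bar> < d \<Longrightarrow> norm (cis (2 * pi * u) - 1) < e"
    by (auto simp: dist_norm)
  have c: "continuous_on UNIV \<Theta>" and m: "strict_mono \<Theta>" and eq: "\<And>t. F (\<phi> t x) = cis (2 * pi * \<Theta> t)"
    using \<Theta> by (auto simp: clock_lift_def)
  have step: "\<Theta> t + d \<le> \<Theta> (t + 1)" for t
  proof -
    obtain s where s: "0 \<le> s" "s \<le> 1" "norm (F (\<phi> s (\<phi> t x)) - F (\<phi> t x)) > e"
      using big[OF flow_in[OF x]] by force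
    have "F (\<phi> s (\<phi> t x)) - F (\<phi> t x) = cis (2 * pi * \<Theta> t) * (cis (2 * pi * (\<Theta> (s + t) - \<Theta> t)) - 1)"
      unfolding flow_add[OF x, symmetric] eq by (simp add: cis_mult right_diff_distrib)
    then have "norm (cis (2 * pi * (\<Theta> (s + t) - \<Theta> t)) - 1) > e" using s(3) by (simp add: norm_mult)
    then have "d \<le> \<bar>\<Theta> (s + t) - \<Theta> t\<bar>" using d(2)[of "\<Theta> (s + t) - \<Theta> t"] by linarith
    moreover have "\<Theta> t \<le> \<Theta> (s + t)" "\<Theta> (s + t) \<le> \<Theta> (t + 1)" using m s by (simp_all add: strict_mono_less_eq)
    ultimately show ?thesis by linarith
  qed
  have up: "\<Theta> 0 + real k * d \<le> \<Theta> (real k)" for k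
  proof (induction k)
    case (Suc k)
    then show ?case using step[of "real k"] by (simp add: algebra_simps)
  qed simp
  have dn: "\<Theta> (- real k) \<le> \<Theta> 0 - real k * d" for k
  proof (induction k)
    case (Suc k)
    have "- real (Suc k) + 1 = - real k" by simp
    then show ?case using Suc step[of "- real (Suc k)"] by (simp add: algebra_simps del: of_nat_Suc) (simp add: algebra_simps)
  qed simp
  show ?thesis
  proof (unfold surj_def, intro allI)
    fix y
    obtain k where k: "\<bar>y - \<Theta> 0\<bar> / d < real k" using reals_Archimedean2 by blast
    then have "\<bar>y - \<Theta> 0\<bar> \<le> real k * d" using d by (simp add: field_simps)
    then have "\<Theta> (- real k) \<le> y" "y \<le> \<Theta> (real k)" using up[of k] dn[of k] by linarith+
    then show "\<exists>t. y = \<Theta> t"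
      using IVT'[of \<Theta> "- real k" y "real k"] continuous_on_subset[OF c subset_UNIV] by auto
  qed
qed

text \<open>Sliding the points of a curve along the flow until their clock shows a constant value
makes the curve run in a fibre of the clock.\<close>
lemma curve_in_orbit:
  assumes F: "continuous_map X euclidean F"
    and lifts: "\<And>x. x \<in> topspace X \<Longrightarrow> \<exists>\<Theta>. clock_lift (\<lambda>t. F (\<phi> t x)) \<Theta>"
    and fibre: "\<And>B. continuous_map euclideanreal X B \<Longrightarrow> (\<And>t. F (B t) = F (B 0)) \<Longrightarrow> (\<And>t. B t = B 0)"
    and A: "continuous_map euclideanreal X A"
  obtains s where "continuous_on UNIV s" "s 0 = 0" "\<And>t. A t = \<phi> (s t) (A 0)"
proof -
  have Ain: "A t \<in> topspace X" for t using A by (auto simp: continuous_map_def)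
  have G: "continuous_on UNIV (\<lambda>z::real \<times> real. F (\<phi> (- fst z) (A (snd z))))"
  proof -
    have 1: "continuous_map euclidean euclideanreal (\<lambda>z::real \<times> real. - fst z)" by (auto intro!: continuous_intros)
    have "continuous_map euclidean euclideanreal (snd :: real \<times> real \<Rightarrow> real)" by (auto intro!: continuous_intros)
    from continuous_map_compose[OF this A] have 2: "continuous_map euclidean X (\<lambda>z::real \<times> real. A (snd z))" by (simp add: o_def)
    from continuous_map_compose[OF flow_comp_cont[OF 1 2] F] show ?thesis by (simp add: o_def)
  qed
  have nF: "norm (F y) = 1" if "y \<in> topspace X" for y
    using lifts[OF that] flow_0[OF that] by (metis clock_lift_def norm_cis)
  \<comment> \<open>The lift is taken over the whole plane to be continuous jointly in the sliding
    time and in the time of the curve. For a fixed point of the curve it is, up to an integer and a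
    sign of time, a clock lift, so it attains the level \<open>\<Gamma> (0, 0)\<close> exactly
    once.\<close>
  obtain \<Gamma> where \<Gamma>: "continuous_on UNIV \<Gamma>" "\<And>z::real \<times> real. F (\<phi> (- fst z) (A (snd z))) = cis (2 * pi * \<Gamma> z)"
    by (rule circle_lift[OF convex_UNIV G]) (use nF flow_in Ain in auto)
  have slice: "continuous_on UNIV (\<lambda>u. \<Gamma> (g u, k u))" if "continuous_on UNIV g" "continuous_on UNIV k"
    for g k :: "real \<Rightarrow> real"
    by (rule continuous_on_compose2[OF \<Gamma>(1)]) (auto intro!: continuous_intros that)
  have col: "strict_mono (\<lambda>u. \<Gamma> (- u, t)) \<and> surj (\<lambda>u. \<Gamma> (- u, t))" for t
  proof -
    obtain \<Theta> where \<Theta>: "clock_lift (\<lambda>u. F (\<phi> u (A t))) \<Theta>" using lifts[OF Ain] by blast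
    obtain N :: int where N: "\<And>u. u \<in> UNIV \<Longrightarrow> \<Gamma> (- u, t) = \<Theta> u + of_int N"
    proof (rule circle_lift_unique[of UNIV "\<lambda>u. \<Gamma> (- u, t)" \<Theta>])
      show "cis (2 * pi * \<Gamma> (- u, t)) = cis (2 * pi * \<Theta> u)" for u
        using \<Gamma>(2)[of "(- u, t)"] \<Theta> by (simp add: clock_lift_def)
    qed (use \<Theta> in \<open>auto simp: clock_lift_def intro!: slice continuous_intros\<close>)
    have "clock_lift (\<lambda>u. F (\<phi> u (A t))) (\<lambda>u. \<Gamma> (- u, t))"
      using \<Theta> N \<Gamma>(2)[of "(- u, t)" for u] unfolding clock_lift_def
      by (auto simp: strict_mono_def intro!: slice continuous_intros)
    then show ?thesis using clock_lift_surj[OF F lifts Ain[of t]] by (auto simp: clock_lift_def)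
  qed
  have anti: "\<Gamma> (u', t) < \<Gamma> (u, t)" if "u < u'" for u u' t
    using strict_monoD[OF conjunct1[OF col[of t]], of "- u'" "- u"] that by simp
  have "\<exists>u. \<Gamma> (u, t) = \<Gamma> (0, 0)" for t
  proof -
    obtain u where "\<Gamma> (0, 0) = \<Gamma> (- u, t)" using surjD[OF conjunct2[OF col[of t]], of "\<Gamma> (0, 0)"] by blast
    then show ?thesis by metis
  qed
  then have "\<forall>t. \<exists>u. \<Gamma> (u, t) = \<Gamma> (0, 0)" by blast
  from choice[OF this] obtain s where s: "\<And>t. \<Gamma> (s t, t) = \<Gamma> (0, 0)" by blast
  have s0: "s 0 = 0"
  proof (rule ccontr)
    assume "s 0 \<noteq> 0"
    then show False using s[of 0] anti[of "s 0" 0 0] anti[of 0 "s 0" 0] by (cases "s 0 < 0") auto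
  qed
  \<comment> \<open>At \<open>s t0 - e / 2\<close> and \<open>s t0 + e / 2\<close> the lift lies
    strictly on opposite sides of the level. This persists for nearby \<open>t\<close>, and
    monotonicity traps \<open>s t\<close> in between.\<close>
  have "isCont s t0" for t0
    unfolding isCont_def LIM_eq
  proof (intro allI impI)
    fix e :: real assume e: "0 < e"
    have tend: "(\<lambda>t. \<Gamma> (u, t)) \<midarrow>t0\<rightarrow> \<Gamma> (u, t0)" for u
      using slice[of "\<lambda>_. u" "\<lambda>t. t"] by (simp add: continuous_on_eq_continuous_at isCont_def)
    have "\<Gamma> (s t0 + e / 2, t0) < \<Gamma> (0, 0)" "\<Gamma> (0, 0) < \<Gamma> (s t0 - e / 2, t0)"
      using anti[of "s t0" "s t0 + e / 2" t0] anti[of "s t0 - e / 2" "s t0" t0] e by (auto simp: s)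
    then have "\<forall>\<^sub>F t in at t0. \<Gamma> (s t0 + e / 2, t) < \<Gamma> (0, 0) \<and> \<Gamma> (0, 0) < \<Gamma> (s t0 - e / 2, t)"
      using order_tendstoD[OF tend] by (intro eventually_conj) auto
    then have "\<forall>\<^sub>F t in at t0. norm (s t - s t0) < e"
    proof (rule eventually_mono)
      fix t assume "\<Gamma> (s t0 + e / 2, t) < \<Gamma> (0, 0) \<and> \<Gamma> (0, 0) < \<Gamma> (s t0 - e / 2, t)"
      then have "\<not> s t0 + e / 2 < s t" "\<not> s t < s t0 - e / 2" using anti s[of t] by (metis less_asym)+
      then show "norm (s t - s t0) < e" using e by auto
    qed
    then show "\<exists>d>0. \<forall>t. t \<noteq> t0 \<and> norm (t - t0) < d \<longrightarrow> norm (s t - s t0) < e"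
      unfolding eventually_at dist_norm by auto
  qed
  then have sc: "continuous_on UNIV s" by (simp add: continuous_at_imp_continuous_on)
  have "continuous_map euclideanreal X (\<lambda>t. \<phi> (- s t) (A t))"
    by (rule flow_comp_cont[OF _ A]) (auto intro!: continuous_intros sc)
  moreover have "F (\<phi> (- s t) (A t)) = F (\<phi> (- s 0) (A 0))" for t
    using \<Gamma>(2)[of "(s t, t)"] \<Gamma>(2)[of "(s 0, 0)"] s by simp
  ultimately have "\<phi> (- s t) (A t) = \<phi> (- s 0) (A 0)" for t
    by (rule fibre)
  then have "\<phi> (- s t) (A t) = A 0" for t using s0 flow_0 Ain by simp
  then have "\<phi> (s t) (A 0) = A t" for t
    using flow_add[OF Ain[of t], of "s t" "- s t"] flow_0[OF Ain] by (metis add.right_inverse)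
  then show thesis using that sc s0 by metis
qed

text \<open>On the orbit of \<open>A 0\<close> the clock determines the time:
  \<open>\<Lambda> \<circ> s\<close> and \<open>\<Theta>\<close> lift the same function, so they
  differ by an integer and \<open>s\<close> inherits monotonicity and surjectivity from
  \<open>\<Theta>\<close>.\<close>

lemma curve_in_orbit_increasing:
  assumes F: "continuous_map X euclidean F"
    and lifts: "\<And>x. x \<in> topspace X \<Longrightarrow> \<exists>\<Theta>. clock_lift (\<lambda>t. F (\<phi> t x)) \<Theta>"
    and fibre: "\<And>B. continuous_map euclideanreal X B \<Longrightarrow> (\<And>t. F (B t) = F (B 0)) \<Longrightarrow> (\<And>t. B t = B 0)"
    and A: "continuous_map euclideanreal X A" and \<Theta>: "clock_lift (\<lambda>t. F (A t)) \<Theta>" "surj \<Theta>"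
  obtains s where "strict_mono s" "surj s" "\<And>t. A t = \<phi> (s t) (A 0)"
proof -
  obtain s where s: "continuous_on UNIV s" "s 0 = 0" "\<And>t. A t = \<phi> (s t) (A 0)"
    using curve_in_orbit[OF F lifts fibre A] by blast
  have A0: "A 0 \<in> topspace X" using A by (auto simp: continuous_map_def)
  obtain \<Lambda> where \<Lambda>: "clock_lift (\<lambda>u. F (\<phi> u (A 0))) \<Lambda>" using lifts[OF A0] by blast
  have m\<Lambda>: "strict_mono \<Lambda>" using \<Lambda> by (simp add: clock_lift_def)
  obtain N :: int where N: "\<And>t. t \<in> UNIV \<Longrightarrow> \<Lambda> (s t) = \<Theta> t + of_int N"
  proof (rule circle_lift_unique[of UNIV "\<lambda>t. \<Lambda> (s t)" \<Theta>])
    show "continuous_on UNIV (\<lambda>t. \<Lambda> (s t))"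
      by (rule continuous_on_compose2[OF _ s(1)]) (use \<Lambda> in \<open>auto simp: clock_lift_def\<close>)
    show "cis (2 * pi * \<Lambda> (s t)) = cis (2 * pi * \<Theta> t)" for t
    proof -
      have "F (A t) = cis (2 * pi * \<Lambda> (s t))" by (subst s(3)) (use \<Lambda> in \<open>simp add: clock_lift_def\<close>)
      then show ?thesis using \<Theta> by (simp add: clock_lift_def)
    qed
  qed (use \<Theta> in \<open>auto simp: clock_lift_def\<close>)
  show thesis
  proof (rule that[OF _ _ s(3)])
    show "strict_mono s"
    proof (rule strict_monoI)
      fix t t' :: real assume "t < t'"
      then have "\<Lambda> (s t) < \<Lambda> (s t')" using \<Theta> N by (simp add: clock_lift_def strict_mono_def)
      then show "s t < s t'" using m\<Lambda> by (simp add: strict_mono_less)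
    qed
    show "surj s"
    proof (unfold surj_def, intro allI)
      fix u
      obtain t where "\<Theta> t = \<Lambda> u - of_int N" using \<Theta>(2) by (metis surjD)
      then have "\<Lambda> (s t) = \<Lambda> u" using N by simp
      then show "\<exists>t. u = s t" using m\<Lambda> by (metis strict_mono_eq)
    qed
  qed
qed

end

text \<open>The pairs that agree at stage \<open>i\<close> but are at least \<open>e\<close> apart
  under \<open>F\<close> form decreasing closed sets in the compact square. A pair in all of them
  would agree at every stage and hence be a single point.\<close>

lemma compact_fibres_shrink:
  fixes F :: "'a \<Rightarrow> 'c::real_normed_vector"
  assumes X: "compact_space X" and r: "\<And>i. continuous_map X (Ws i) (r i)" and H: "\<And>i. Hausdorff_space (Ws i)"
    and nest: "\<And>i x x'. x \<in> topspace X \<Longrightarrow> x' \<in> topspace X \<Longrightarrow> r (Suc i) x = r (Suc i) x' \<Longrightarrow> r i x = r i x'"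
    and sep: "\<And>x x'. x \<in> topspace X \<Longrightarrow> x' \<in> topspace X \<Longrightarrow> (\<And>i. r i x = r i x') \<Longrightarrow> x = x'"
    and F: "continuous_map X euclidean F" and e: "e > 0"
  obtains M where "\<And>m x x'. m \<ge> M \<Longrightarrow> x \<in> topspace X \<Longrightarrow> x' \<in> topspace X \<Longrightarrow> r m x = r m x' \<Longrightarrow> norm (F x - F x') < e"
proof -
  define P where "P = prod_topology X X"
  define C where "C i = {z \<in> topspace P. r i (fst z) = r i (snd z)} \<inter> {z \<in> topspace P. norm (F (fst z) - F (snd z)) \<in> {e..}}" for i
  have fs: "continuous_map P X fst" "continuous_map P X snd" by (auto simp: P_def continuous_map_fst continuous_map_snd)
  have cl: "closedin P (C i)" for i
    unfolding C_def
  proof (rule closedin_Int)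
    show "closedin P {z \<in> topspace P. r i (fst z) = r i (snd z)}"
      using closedin_continuous_maps_eq[OF H continuous_map_compose[OF fs(1) r] continuous_map_compose[OF fs(2) r]] by (simp add: o_def)
    have "continuous_map P euclideanreal (\<lambda>z. norm (F (fst z) - F (snd z)))"
      using continuous_map_compose[OF fs(1) F] continuous_map_compose[OF fs(2) F]
      by (intro continuous_map_norm continuous_map_diff) (simp_all add: o_def)
    then show "closedin P {z \<in> topspace P. norm (F (fst z) - F (snd z)) \<in> {e..}}"
      by (rule closedin_continuous_map_preimage) simp
  qed
  have dec: "decseq C"
  proof (intro decseq_SucI subsetI)
    fix n z assume z: "z \<in> C (Suc n)"
    have "r n (fst z) = r n (snd z)" by (rule nest) (use z in \<open>auto simp: C_def P_def\<close>)
    then show "z \<in> C n" using z by (simp add: C_def)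
  qed
  have "\<exists>i. C i = {}"
  proof (rule ccontr)
    assume ne: "\<nexists>i. C i = {}"
    have "compact_space P" using X by (simp add: P_def compact_space_prod_topology)
    then obtain z where z: "\<And>i. z \<in> C i"
      using compact_space_imp_nest[of P C] cl dec ne by blast
    have "z \<in> topspace P" using z[of 0] by (simp add: C_def)
    then have "fst z \<in> topspace X" "snd z \<in> topspace X" by (auto simp: P_def)
    moreover have "r i (fst z) = r i (snd z)" for i using z[of i] by (simp add: C_def)
    ultimately have "fst z = snd z" by (rule sep)
    then show False using z[of 0] e by (auto simp: C_def)
  qed
  then obtain M where M: "C M = {}" by blast
  show thesis
  proof (rule that[of M])
    fix m x x' assume a: "m \<ge> M" "x \<in> topspace X" "x' \<in> topspace X" "r m x = r m x'"
    have "(x, x') \<notin> C m" using decseqD[OF dec a(1)] M by blast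
    moreover have "(x, x') \<in> topspace P" using a by (simp add: P_def)
    ultimately show "norm (F x - F x') < e" using a(4) by (simp add: C_def not_le)
  qed
qed

text \<open>On the compact set where \<open>g\<close> is not positive, \<open>f\<close> attains a
  maximum, which lies below 1. So being close to the top level of \<open>f\<close> already forces
  \<open>g\<close> to be positive.\<close>

lemma compact_threshold:
  fixes f g :: "'a \<Rightarrow> real"
  assumes X: "compact_space X" and f: "continuous_map X euclideanreal f" and g: "continuous_map X euclideanreal g"
    and fg: "\<And>y. y \<in> topspace X \<Longrightarrow> 1 \<le> f y \<Longrightarrow> 0 < g y"
  obtains \<rho> where "0 \<le> \<rho>" "\<rho> < 1" "\<And>y. y \<in> topspace X \<Longrightarrow> \<rho> < f y \<Longrightarrow> 0 < g y"
proof -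
  define C where "C = {y \<in> topspace X. g y \<in> {..0}}"
  have "closedin X C" unfolding C_def by (rule closedin_continuous_map_preimage[OF g]) simp
  then have "compactin X C" using X closedin_compact_space by blast
  then have "compact (f ` C)" using image_compactin[OF _ f] by (metis compactin_euclidean_iff)
  show thesis
  proof (cases "C = {}")
    case True
    then show thesis using that[of 0] by (force simp: C_def not_le)
  next
    case False
    then obtain m where m: "m \<in> f ` C" "\<And>y. y \<in> f ` C \<Longrightarrow> y \<le> m"
      using compact_attains_sup[OF \<open>compact (f ` C)\<close>] by auto
    have "m < 1" using m(1) fg by (force simp: C_def)
    then show thesis using that[of "max 0 m"] m(2) by (force simp: C_def not_le)
  qed
qed

section \<open>Words of nearby curves\<close>

text \<open>The nearest integer is at most half a turn away, and on half a turn the cosine decreases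
  and vanishes at the quarter. This is the source of all bounds by 1/4.\<close>

lemma abs_diff_round_less:
  assumes "0 < Re (cis (2 * pi * u))"
  shows "\<bar>u - of_int (round u)\<bar> < 1/4"
proof (rule ccontr)
  define d where "d = u - of_int (round u)"
  assume "\<not> \<bar>u - of_int (round u)\<bar> < 1/4"
  then have d: "1/4 \<le> \<bar>d\<bar>" "\<bar>d\<bar> \<le> 1/2" using of_int_round_abs_le[of u] by (auto simp: d_def abs_minus_commute)
  have "cis (2 * pi * u) = cis (2 * pi * d)" unfolding cis_2pi_eq_iff d_def by (intro exI[of _ "round u"]) simp
  then have "cos (2 * pi * u) = cos (2 * pi * \<bar>d\<bar>)" by (cases "d \<ge> 0") (simp_all add: complex_eq_iff)
  also have "\<dots> \<le> cos (pi / 2)"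
  proof (rule cos_monotone_0_pi_le)
    show "pi / 2 \<le> 2 * pi * \<bar>d\<bar>" using mult_left_mono[OF d(1), of "2 * pi"] by simp
    show "2 * pi * \<bar>d\<bar> \<le> pi" using mult_left_mono[OF d(2), of "2 * pi"] by simp
  qed simp
  finally show False using assms by simp
qed

lemma Re_cis_diff_pos:
  assumes "norm (cis (2 * pi * u) - cis (2 * pi * v)) < 1"
  shows "0 < Re (cis (2 * pi * (u - v)))"
proof -
  have "cis (2 * pi * u) - cis (2 * pi * v) = cis (2 * pi * v) * (cis (2 * pi * (u - v)) - 1)"
    by (simp add: cis_mult right_diff_distrib)
  then have "norm (cis (2 * pi * (u - v)) - 1) < 1" using assms by (simp add: norm_mult)
  then show ?thesis using abs_Re_le_cmod[of "cis (2 * pi * (u - v)) - 1"] by simp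
qed

lemma norm_less_1_imp_Re_pos: "norm (z - 1) < 1 \<Longrightarrow> 0 < Re z"
  using abs_Re_le_cmod[of "z - 1"] by simp

text \<open>Rounding can change only when the lift crosses a half-integer, where the real part is
  -1. So a curve that stays near the wedge point belongs to one passage.\<close>

lemma round_const:
  fixes \<Theta> :: "real \<Rightarrow> real"
  assumes \<Theta>: "continuous_on {a..b} \<Theta>" and ab: "a \<le> b"
    and pos: "\<And>t. t \<in> {a..b} \<Longrightarrow> 0 < Re (cis (2 * pi * \<Theta> t))"
  shows "round (\<Theta> a) = round (\<Theta> b)"
proof -
  have no: "\<Theta> t \<noteq> of_int m + 1/2" if "t \<in> {a..b}" for t and m :: int
  proof
    assume "\<Theta> t = of_int m + 1/2"
    then have "cis (2 * pi * \<Theta> t) = cis (2 * pi * (1/2))" unfolding cis_2pi_eq_iff by (intro exI[of _ m]) simp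
    then show False using pos[OF that] by simp
  qed
  have near: "\<bar>\<Theta> t - of_int (round (\<Theta> t))\<bar> < 1/4" if "t \<in> {a..b}" for t
    using abs_diff_round_less[OF pos[OF that]] .
  have n: "\<bar>\<Theta> a - of_int (round (\<Theta> a))\<bar> < 1/4" "\<bar>\<Theta> b - of_int (round (\<Theta> b))\<bar> < 1/4"
    using near[of a] near[of b] ab by auto
  show ?thesis
  proof (rule linorder_cases[of "round (\<Theta> a)" "round (\<Theta> b)"])
    assume "round (\<Theta> a) < round (\<Theta> b)"
    then have "of_int (round (\<Theta> a)) + 1 \<le> real_of_int (round (\<Theta> b))" by linarith
    then have "\<Theta> a \<le> of_int (round (\<Theta> a)) + 1/2" "of_int (round (\<Theta> a)) + 1/2 \<le> \<Theta> b" using n by linarith+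
    then show ?thesis using IVT'[of \<Theta> a _ b] \<Theta> ab no by (metis atLeastAtMost_iff)
  next
    assume "round (\<Theta> b) < round (\<Theta> a)"
    then have "of_int (round (\<Theta> b)) + 1 \<le> real_of_int (round (\<Theta> a))" by linarith
    then have "\<Theta> b \<le> of_int (round (\<Theta> b)) + 1/2" "of_int (round (\<Theta> b)) + 1/2 \<le> \<Theta> a" using n by linarith+
    then show ?thesis using IVT2'[of \<Theta> b _ a] \<Theta> ab no by (metis atLeastAtMost_iff)
  qed
qed

text \<open>The difference of the lifts stays within 1/4 of one integer \<open>N\<close>, and at the
  ends each lift is within 1/4 of its rounding; the three errors sum to less than 1, so the
  roundings differ by exactly \<open>N\<close>. At a half-integer of \<open>\<Theta>\<close> the
  other lift is still inside the corresponding letter. If the letters differed, collapsing onto the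
  first would give -1 for one curve and 1 for the other, which are 2 apart.\<close>

lemma (in wedge) close_curves_same_word:
  fixes \<Theta> \<Theta>' :: "real \<Rightarrow> real"
  assumes \<kappa>: "\<And>i. \<kappa> i < n" "\<And>i. \<kappa>' i < n" and ab: "a \<le> b"
    and \<Theta>: "continuous_on {a..b} \<Theta>" "continuous_on {a..b} \<Theta>'"
    and cl: "\<And>t. t \<in> {a..b} \<Longrightarrow> norm (clock c n (wcurve c \<kappa> (\<Theta> t)) - clock c n (wcurve c \<kappa>' (\<Theta>' t))) < 1"
    and ci: "\<And>t k. t \<in> {a..b} \<Longrightarrow> k < n \<Longrightarrow> norm (circ c n k (wcurve c \<kappa> (\<Theta> t)) - circ c n k (wcurve c \<kappa>' (\<Theta>' t))) < 1"
    and ends: "\<And>t. t \<in> {a, b} \<Longrightarrow> 0 < Re (clock c n (wcurve c \<kappa> (\<Theta> t)))"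
      "\<And>t. t \<in> {a, b} \<Longrightarrow> 0 < Re (clock c n (wcurve c \<kappa>' (\<Theta>' t)))"
  shows "map \<kappa> [round (\<Theta> a)..round (\<Theta> b) - 1] = map \<kappa>' [round (\<Theta>' a)..round (\<Theta>' b) - 1]"
proof -
  define N where "N = round (\<Theta> a - \<Theta>' a)"
  have pos: "0 < Re (cis (2 * pi * (\<Theta> t - \<Theta>' t)))" if "t \<in> {a..b}" for t
    by (rule Re_cis_diff_pos) (use cl[OF that] wcurve_clock \<kappa> in simp)
  have near: "\<bar>\<Theta> t - \<Theta>' t - of_int N\<bar> < 1/4" if t: "t \<in> {a..b}" for t
  proof -
    have "round (\<Theta> a - \<Theta>' a) = round (\<Theta> t - \<Theta>' t)"
    proof (rule round_const[where \<Theta>="\<lambda>t. \<Theta> t - \<Theta>' t"])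
      show "continuous_on {a..t} (\<lambda>t. \<Theta> t - \<Theta>' t)"
        by (intro continuous_intros continuous_on_subset[OF \<Theta>(1)] continuous_on_subset[OF \<Theta>(2)]) (use t in auto)
    qed (use pos t in auto)
    then show ?thesis using abs_diff_round_less[OF pos[OF t]] by (simp add: N_def)
  qed
  have e: "\<bar>\<Theta> t - of_int (round (\<Theta> t))\<bar> < 1/4" "\<bar>\<Theta>' t - of_int (round (\<Theta>' t))\<bar> < 1/4" if "t \<in> {a, b}" for t
    using abs_diff_round_less[of "\<Theta> t"] abs_diff_round_less[of "\<Theta>' t"] ends[OF that] wcurve_clock \<kappa> by auto
  have rN: "round (\<Theta> t) = round (\<Theta>' t) + N" if t: "t \<in> {a, b}" for t
  proof -
    have "t \<in> {a..b}" using t ab by auto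
    from near[OF this] e[OF t] have "\<bar>real_of_int (round (\<Theta> t)) - real_of_int (round (\<Theta>' t)) - real_of_int N\<bar> < 1" by linarith
    then have "\<bar>real_of_int (round (\<Theta> t) - round (\<Theta>' t) - N)\<bar> < 1" by simp
    then show ?thesis by linarith
  qed
  have ea: "\<bar>\<Theta> a - of_int (round (\<Theta> a))\<bar> < 1/4" "\<bar>\<Theta> b - of_int (round (\<Theta> b))\<bar> < 1/4"
    using e(1)[of a] e(1)[of b] by simp_all
  have l: "\<kappa> m = \<kappa>' (m - N)" if m: "round (\<Theta> a) \<le> m" "m < round (\<Theta> b)" for m
  proof -
    have "real_of_int (round (\<Theta> a)) \<le> of_int m" "of_int m + 1 \<le> real_of_int (round (\<Theta> b))" using m by linarith+
    then have "\<Theta> a \<le> of_int m + 1/2" "of_int m + 1/2 \<le> \<Theta> b" using ea by linarith+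
    then obtain t where t: "t \<in> {a..b}" "\<Theta> t = of_int m + 1/2" using IVT'[of \<Theta> a _ b] \<Theta> ab by auto
    have f: "\<lfloor>\<Theta> t\<rfloor> = m" unfolding t(2) by linarith
    have "\<lfloor>\<Theta>' t\<rfloor> = m - N"
    proof (rule floor_unique)
      show "real_of_int (m - N) \<le> \<Theta>' t" "\<Theta>' t < real_of_int (m - N) + 1"
        using near[OF t(1)] t(2) unfolding of_int_diff by linarith+
    qed
    then have 1: "circ c n (\<kappa> m) (wcurve c \<kappa>' (\<Theta>' t)) = 1" if "\<kappa> m \<noteq> \<kappa>' (m - N)"
      using wcurve_circ[of \<kappa>' "\<kappa> m" "\<Theta>' t"] \<kappa> that by auto
    have "cis (2 * pi * \<Theta> t) = cis (2 * pi * (1/2))" unfolding cis_2pi_eq_iff t(2) by (intro exI[of _ m]) simp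
    then have "circ c n (\<kappa> m) (wcurve c \<kappa> (\<Theta> t)) = -1"
      using wcurve_circ[of \<kappa> "\<kappa> m" "\<Theta> t"] \<kappa> f by simp
    then show ?thesis using ci[OF t(1) \<kappa>(1)[of m]] 1 by (cases "\<kappa> m = \<kappa>' (m - N)") auto
  qed
  have len: "length [round (\<Theta> a)..round (\<Theta> b) - 1] = length [round (\<Theta>' a)..round (\<Theta>' b) - 1]"
    using rN[of a] rN[of b] by simp
  show ?thesis
  proof (rule nth_equalityI)
    fix m assume "m < length (map \<kappa> [round (\<Theta> a)..round (\<Theta> b) - 1])"
    then have "int m < round (\<Theta> b) - round (\<Theta> a)" by simp
    then show "map \<kappa> [round (\<Theta> a)..round (\<Theta> b) - 1] ! m = map \<kappa>' [round (\<Theta>' a)..round (\<Theta>' b) - 1] ! m"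
      using l[of "round (\<Theta> a) + int m"] rN[of a] rN[of b] by (simp add: algebra_simps)
  qed (use len in simp)
qed

section \<open>Expansions over a common flow\<close>

text \<open>The normal form of an entire orbit. Surjectivity of the lift provides a passage time for
  every integer.\<close>

definition runs_along ::
  "(nat \<Rightarrow> real \<Rightarrow> 'a) \<Rightarrow> nat \<Rightarrow> (real \<Rightarrow> 'a) \<Rightarrow> (int \<Rightarrow> nat) \<Rightarrow> (real \<Rightarrow> real) \<Rightarrow> bool" where
  "runs_along c n \<gamma> \<kappa> \<Theta> \<longleftrightarrow> (\<forall>i. \<kappa> i < n) \<and> continuous_on UNIV \<Theta> \<and> strict_mono \<Theta> \<and> surj \<Theta> \<and>
     (\<forall>t. \<gamma> t = wcurve c \<kappa> (\<Theta> t))"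

locale positive_projection = compact_flow X \<phi> + wedge W w n c
  for X :: "'a topology" and \<phi> and W :: "'b topology" and w n c +
  fixes r :: "'a \<Rightarrow> 'b" and x0 :: 'a
  assumes r_cont: "continuous_map X W r"
    and r_surj: "r ` topspace X = topspace W"
    and x0_in: "x0 \<in> topspace X" and r_x0: "r x0 = w"
    and r_runs: "\<And>x. x \<in> topspace X \<Longrightarrow> \<exists>\<kappa> \<Theta>. runs_along c n (\<lambda>t. r (\<phi> t x)) \<kappa> \<Theta>"

text \<open>Points in one fibre of \<open>r\<close> look alike to \<open>r'\<close>. The bound 1
  keeps the clocks less than a quarter turn apart, and it rules out the distance 2 between the
  middle of a circle and the wedge point under a collapse.\<close>

definition resolves ::
  "'a topology \<Rightarrow> ('a \<Rightarrow> 'b) \<Rightarrow> ('a \<Rightarrow> 'c) \<Rightarrow> nat \<Rightarrow> (nat \<Rightarrow> real \<Rightarrow> 'c) \<Rightarrow> bool" where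
  "resolves X r r' n' c' \<longleftrightarrow> (\<forall>x\<in>topspace X. \<forall>x'\<in>topspace X. r x = r x' \<longrightarrow>
     norm (clock c' n' (r' x) - clock c' n' (r' x')) < 1 \<and>
     (\<forall>k<n'. norm (circ c' n' k (r' x) - circ c' n' k (r' x')) < 1))"

text \<open>While \<open>r\<close> runs once along the circle \<open>a\<close>, the curve in the other wedge reads the word \<open>D a\<close>,
where its end points, which are only close to the wedge point, are moved to the nearest passage through it.\<close>
definition transcribes where
  "transcribes X \<phi> n c r n' c' r' D \<longleftrightarrow>
     (\<forall>x\<in>topspace X. \<forall>\<kappa> \<Theta> \<kappa>' \<Theta>' t0 t1 i.
        runs_along c n (\<lambda>t. r (\<phi> t x)) \<kappa> \<Theta> \<and> runs_along c' n' (\<lambda>t. r' (\<phi> t x)) \<kappa>' \<Theta>' \<and>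
        \<Theta> t0 = of_int i \<and> \<Theta> t1 = of_int i + 1 \<longrightarrow>
        map \<kappa>' [round (\<Theta>' t0)..round (\<Theta>' t1) - 1] = D (\<kappa> i))"

lemma transcribesD:
  assumes "transcribes X \<phi> n c r n' c' r' D" "x \<in> topspace X"
    "runs_along c n (\<lambda>t. r (\<phi> t x)) \<kappa> \<Theta>" "runs_along c' n' (\<lambda>t. r' (\<phi> t x)) \<kappa>' \<Theta>'"
    "\<Theta> t0 = of_int i" "\<Theta> t1 = of_int i + 1"
  shows "map \<kappa>' [round (\<Theta>' t0)..round (\<Theta>' t1) - 1] = D (\<kappa> i)"
  by (rule assms(1)[unfolded transcribes_def, THEN bspec, OF assms(2), THEN spec[of _ \<kappa>], THEN spec[of _ \<Theta>],
      THEN spec[of _ \<kappa>'], THEN spec[of _ \<Theta>'], THEN spec[of _ t0], THEN spec[of _ t1], THEN spec[of _ i], THEN mp])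
    (intro conjI assms(3-6))

text \<open>The word is well defined: any two orbit segments over the circle \<open>a\<close> can be
  parametrised by the parameter of that circle. At equal parameters they lie in one fibre of
  \<open>r\<close>, so their images under \<open>r'\<close> are close and read the same
  word.\<close>

lemma transcribes_exists:
  assumes r: "positive_projection X \<phi> W w n c r x0" and r': "positive_projection X \<phi> W' w' n' c' r' x0"
    and res: "resolves X r r' n' c'"
  obtains D where "transcribes X \<phi> n c r n' c' r' D" "\<And>a. set (D a) \<subseteq> {..<n'}"
proof -
  interpret r: positive_projection X \<phi> W w n c r x0 by fact
  interpret r': positive_projection X \<phi> W' w' n' c' r' x0 by fact
  define R where "R a u \<longleftrightarrow> (\<exists>x\<in>topspace X. \<exists>\<kappa> \<Theta> \<kappa>' \<Theta>' t0 t1 i.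
        runs_along c n (\<lambda>t. r (\<phi> t x)) \<kappa> \<Theta> \<and> runs_along c' n' (\<lambda>t. r' (\<phi> t x)) \<kappa>' \<Theta>' \<and>
        \<Theta> t0 = of_int i \<and> \<Theta> t1 = of_int i + 1 \<and> a = \<kappa> i \<and> u = map \<kappa>' [round (\<Theta>' t0)..round (\<Theta>' t1) - 1])" for a u
  have uniq: "u1 = u2" if R1: "R a u1" and R2: "R a u2" for a u1 u2
  proof -
    obtain x1 \<kappa>1 \<Theta>1 \<kappa>1' \<Theta>1' t10 t11 i1 where x1: "x1 \<in> topspace X"
      and run1: "runs_along c n (\<lambda>t. r (\<phi> t x1)) \<kappa>1 \<Theta>1" "runs_along c' n' (\<lambda>t. r' (\<phi> t x1)) \<kappa>1' \<Theta>1'"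
      and t1: "\<Theta>1 t10 = of_int i1" "\<Theta>1 t11 = of_int i1 + 1" "a = \<kappa>1 i1"
      and u1: "u1 = map \<kappa>1' [round (\<Theta>1' t10)..round (\<Theta>1' t11) - 1]"
      using R1 unfolding R_def by blast
    obtain x2 \<kappa>2 \<Theta>2 \<kappa>2' \<Theta>2' t20 t21 i2 where x2: "x2 \<in> topspace X"
      and run2: "runs_along c n (\<lambda>t. r (\<phi> t x2)) \<kappa>2 \<Theta>2" "runs_along c' n' (\<lambda>t. r' (\<phi> t x2)) \<kappa>2' \<Theta>2'"
      and t2: "\<Theta>2 t20 = of_int i2" "\<Theta>2 t21 = of_int i2 + 1" "a = \<kappa>2 i2"
      and u2: "u2 = map \<kappa>2' [round (\<Theta>2' t20)..round (\<Theta>2' t21) - 1]"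
      using R2 unfolding R_def by blast
    \<comment> \<open>Inverting the lift along the segment turns the parameter of the circle into a
      time.\<close>
    have param: "\<exists>T. continuous_on {0..1} T \<and> T 0 = t0 \<and> T 1 = t1 \<and> (\<forall>s\<in>{0..1}. r (\<phi> (T s) x) = c (\<kappa> i) s)"
      if run: "runs_along c n (\<lambda>t. r (\<phi> t x)) \<kappa> \<Theta>" and t: "\<Theta> t0 = of_int i" "\<Theta> t1 = of_int i + 1" for x \<kappa> \<Theta> t0 t1 and i :: int
    proof -
      have \<Theta>: "continuous_on UNIV \<Theta>" "strict_mono \<Theta>" and \<kappa>: "\<And>j. \<kappa> j < n" and eq: "\<And>t. r (\<phi> t x) = wcurve c \<kappa> (\<Theta> t)"
        using run by (auto simp: runs_along_def)
      have "t0 \<le> t1" using \<Theta>(2) t by (metis add_increasing2 order_refl strict_mono_less_eq zero_le_one)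
      then obtain \<Phi> where \<Phi>: "continuous_on {\<Theta> t0..\<Theta> t1} \<Phi>"
        "\<And>y. y \<in> {\<Theta> t0..\<Theta> t1} \<Longrightarrow> \<Phi> y \<in> {t0..t1} \<and> \<Theta> (\<Phi> y) = y" "\<And>y. y \<in> {t0..t1} \<Longrightarrow> \<Phi> (\<Theta> y) = y"
        by (rule strict_mono_on_inverse[of t0 t1 \<Theta>]) (use \<Theta> in \<open>auto intro: continuous_on_subset simp: strict_mono_on_def strict_mono_def\<close>)
      show ?thesis
      proof (intro exI[of _ "\<lambda>s. \<Phi> (of_int i + s)"] conjI ballI)
        show "continuous_on {0..1} (\<lambda>s. \<Phi> (of_int i + s))"
          by (rule continuous_on_compose2[OF \<Phi>(1)]) (auto intro!: continuous_intros simp: t)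
        show "\<Phi> (of_int i + 0) = t0" "\<Phi> (of_int i + 1) = t1"
          using \<Phi>(3)[of t0] \<Phi>(3)[of t1] \<open>t0 \<le> t1\<close> t by auto
        fix s :: real assume s: "s \<in> {0..1}"
        then have "\<Theta> (\<Phi> (of_int i + s)) = of_int i + s" using \<Phi>(2)[of "of_int i + s"] t by auto
        then show "r (\<phi> (\<Phi> (of_int i + s)) x) = c (\<kappa> i) s"
          unfolding eq using r.wcurve_piece[of \<kappa> i "of_int i + s"] \<kappa> s by simp
      qed
    qed
    obtain T1 where T1: "continuous_on {0..1} T1" "T1 0 = t10" "T1 1 = t11" "\<And>s. s \<in> {0..1} \<Longrightarrow> r (\<phi> (T1 s) x1) = c a s"
      using param[OF run1(1) t1(1,2)] t1(3) by blast
    obtain T2 where T2: "continuous_on {0..1} T2" "T2 0 = t20" "T2 1 = t21" "\<And>s. s \<in> {0..1} \<Longrightarrow> r (\<phi> (T2 s) x2) = c a s"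
      using param[OF run2(1) t2(1,2)] t2(3) by blast
    have an: "a < n" using run1(1) t1(3) by (auto simp: runs_along_def)
    have eq: "r' (\<phi> t x1) = wcurve c' \<kappa>1' (\<Theta>1' t)" "r' (\<phi> t x2) = wcurve c' \<kappa>2' (\<Theta>2' t)" for t
      using run1(2) run2(2) by (auto simp: runs_along_def)
    have close: "norm (clock c' n' (r' (\<phi> (T1 s) x1)) - clock c' n' (r' (\<phi> (T2 s) x2))) < 1"
      "k < n' \<Longrightarrow> norm (circ c' n' k (r' (\<phi> (T1 s) x1)) - circ c' n' k (r' (\<phi> (T2 s) x2))) < 1"
      if "s \<in> {0..1}" for s k
      using res r.flow_in[OF x1] r.flow_in[OF x2] T1(4)[OF that] T2(4)[OF that] unfolding resolves_def by auto
    \<comment> \<open>The base point \<open>x0\<close> lies over both wedge points. Comparing with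
      it shows that \<open>r'\<close> is near its wedge point wherever \<open>r\<close> is at its
      own.\<close>
    have wp: "0 < Re (clock c' n' (r' y))" if "y \<in> topspace X" "r y = w" for y
      using res that r.x0_in r.r_x0 r'.r_x0 unfolding resolves_def
      by (intro norm_less_1_imp_Re_pos) (metis r'.clock_w)
    have cw: "c a s = w" if "s \<in> {0, 1}" for s using that r.c_0[OF an] r.c_1[OF an] by auto
    have cont: "continuous_on {0..1} (\<lambda>s. \<Theta> (T s))" if "continuous_on UNIV \<Theta>" "continuous_on {0..1} T" for \<Theta> T :: "real \<Rightarrow> real"
      by (rule continuous_on_compose2[OF that]) auto
    have k: "\<And>i. \<kappa>1' i < n'" "\<And>i. \<kappa>2' i < n'" and C: "continuous_on UNIV \<Theta>1'" "continuous_on UNIV \<Theta>2'"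
      using run1(2) run2(2) by (auto simp: runs_along_def)
    have near: "0 < Re (clock c' n' (wcurve c' \<kappa>1' (\<Theta>1' (T1 t))))" "0 < Re (clock c' n' (wcurve c' \<kappa>2' (\<Theta>2' (T2 t))))"
      if t: "t \<in> {0, 1}" for t
    proof -
      have t01: "t \<in> {0..1}" using t by auto
      have "r (\<phi> (T1 t) x1) = w" "r (\<phi> (T2 t) x2) = w" using T1(4)[OF t01] T2(4)[OF t01] cw[OF t] by simp_all
      from wp[OF r.flow_in[OF x1] this(1)] wp[OF r.flow_in[OF x2] this(2)]
      show "0 < Re (clock c' n' (wcurve c' \<kappa>1' (\<Theta>1' (T1 t))))" "0 < Re (clock c' n' (wcurve c' \<kappa>2' (\<Theta>2' (T2 t))))"
        unfolding eq .
    qed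
    have "map \<kappa>1' [round (\<Theta>1' (T1 0))..round (\<Theta>1' (T1 1)) - 1] = map \<kappa>2' [round (\<Theta>2' (T2 0))..round (\<Theta>2' (T2 1)) - 1]"
      by (rule r'.close_curves_same_word[where \<Theta>="\<lambda>s. \<Theta>1' (T1 s)" and \<Theta>'="\<lambda>s. \<Theta>2' (T2 s)" and a=0 and b=1,
            OF k _ cont[OF C(1) T1(1)] cont[OF C(2) T2(1)] close[unfolded eq] near]) simp_all
    then show ?thesis unfolding u1 u2 T1 T2 .
  qed
  \<comment> \<open>The default \<open>[]\<close> covers numbers that are not letters, so that the
    bound on the letters of \<open>D a\<close> holds for all \<open>a\<close>.\<close>
  define D where "D a = (if \<exists>u. R a u then SOME u. R a u else [])" for a
  have D: "D a = u" if "R a u" for a u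
    using that uniq[OF someI[of "R a", OF that] that] unfolding D_def by auto
  have "transcribes X \<phi> n c r n' c' r' D"
    unfolding transcribes_def
  proof (intro ballI allI impI)
    fix x \<kappa> \<Theta> \<kappa>' \<Theta>' t0 t1 and i :: int
    assume "x \<in> topspace X" and "runs_along c n (\<lambda>t. r (\<phi> t x)) \<kappa> \<Theta> \<and> runs_along c' n' (\<lambda>t. r' (\<phi> t x)) \<kappa>' \<Theta>' \<and>
        \<Theta> t0 = of_int i \<and> \<Theta> t1 = of_int i + 1"
    then show "map \<kappa>' [round (\<Theta>' t0)..round (\<Theta>' t1) - 1] = D (\<kappa> i)"
      by (intro D[symmetric]) (unfold R_def, intro bexI[of _ x] exI[of _ \<kappa>] exI[of _ \<Theta>] exI[of _ \<kappa>'] exI[of _ \<Theta>']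
        exI[of _ t0] exI[of _ t1] exI[of _ i], auto)
  qed
  moreover have "set (D a) \<subseteq> {..<n'}" for a
  proof (cases "\<exists>u. R a u")
    case True
    then obtain u where "R a u" by blast
    then show ?thesis using D unfolding R_def runs_along_def by auto
  qed (simp add: D_def)
  ultimately show thesis using that by blast
qed

text \<open>Adjacent stretches between the cut points \<open>R j\<close> telescope. Monotonicity of
  \<open>R\<close> excludes overlaps but allows empty stretches, as \<open>U\<close> may still
  produce empty words.\<close>

lemma concat_map_upto:
  fixes z z' :: int and R :: "int \<Rightarrow> int"
  assumes "z \<le> z'" "\<And>j. z \<le> j \<Longrightarrow> j < z' \<Longrightarrow> R j \<le> R (j + 1)"
    and U: "\<And>j. z \<le> j \<Longrightarrow> j < z' \<Longrightarrow> U (\<kappa> j) = map \<kappa>' [R j..R (j + 1) - 1]"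
  shows "R z \<le> R z' \<and> concat (map U (map \<kappa> [z..z' - 1])) = map \<kappa>' [R z..R z' - 1]"
  using assms
proof (induction z' rule: int_ge_induct)
  case (step i)
  have IH: "R z \<le> R i" "concat (map U (map \<kappa> [z..i - 1])) = map \<kappa>' [R z..R i - 1]" using step by auto
  have "[z..i] = [z..i - 1] @ [i]" using step(1) by (simp add: upto_rec2)
  moreover have "[R z..R (i + 1) - 1] = [R z..R i - 1] @ [R i..R (i + 1) - 1]"
    using upto_split1[of "R z" "R i" "R (i + 1) - 1"] IH(1) step.prems(1)[of i] step(1)
    by (cases "R i = R (i + 1)") auto
  ultimately show ?case using IH step.prems(1)[of i] step.prems(2)[of i] step(1) by simp
qed simp

text \<open>The two transcriptions cut the orbit at different times: \<open>D\<close> at passages of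
  \<open>r\<close>, but \<open>U\<close> at passages of \<open>r'\<close>. The threshold
  \<open>\<rho>\<close> ensures that moving an end from a passage of \<open>r\<close> to the nearest
  passage of \<open>r'\<close> does not change the rounding in the third wedge. The pieces then
  telescope to the word read by \<open>r''\<close> between two passages of \<open>r\<close>, which
  is \<open>v a\<close> because \<open>r''\<close> is \<open>f\<close> after
  \<open>r\<close>.\<close>

lemma transcribes_compose:
  assumes r: "positive_projection X \<phi> W w n c r x0" and r': "positive_projection X \<phi> W' w' n' c' r' x0"
    and r'': "positive_projection X \<phi> W'' w'' n'' c'' r'' x0"
    and D: "transcribes X \<phi> n c r n' c' r' D" and U: "transcribes X \<phi> n' c' r' n'' c'' r'' U"
    and \<rho>: "0 \<le> \<rho>" "\<And>y. y \<in> topspace X \<Longrightarrow> r y = w \<Longrightarrow> \<rho> < Re (clock c' n' (r' y))"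
      "\<And>y. y \<in> topspace X \<Longrightarrow> \<rho> < Re (clock c' n' (r' y)) \<Longrightarrow> 0 < Re (clock c'' n'' (r'' y))"
    and f: "follows_words n c n'' c'' f v" and fr: "\<And>y. y \<in> topspace X \<Longrightarrow> r'' y = f (r y)"
    and a: "a < n"
  shows "concat (map U (D a)) = v a"
proof -
  interpret r: positive_projection X \<phi> W w n c r x0 by fact
  interpret r': positive_projection X \<phi> W' w' n' c' r' x0 by fact
  interpret r'': positive_projection X \<phi> W'' w'' n'' c'' r'' x0 by fact
  \<comment> \<open>Surjectivity of \<open>r\<close> supplies an orbit through the middle of the
    circle \<open>a\<close>, so the letter \<open>a\<close> does occur.\<close>
  have "c a (1/2) \<in> r ` topspace X" unfolding r.r_surj using a by (intro r.c_in) auto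
  then obtain x where x: "x \<in> topspace X" "r x = c a (1/2)" by auto
  obtain \<kappa> \<Theta> where run: "runs_along c n (\<lambda>t. r (\<phi> t x)) \<kappa> \<Theta>" using r.r_runs[OF x(1)] by blast
  obtain \<kappa>' \<Theta>' where run': "runs_along c' n' (\<lambda>t. r' (\<phi> t x)) \<kappa>' \<Theta>'" using r'.r_runs[OF x(1)] by blast
  obtain \<kappa>'' \<Theta>'' where run'': "runs_along c'' n'' (\<lambda>t. r'' (\<phi> t x)) \<kappa>'' \<Theta>''" using r''.r_runs[OF x(1)] by blast
  have \<Theta>: "continuous_on UNIV \<Theta>" "strict_mono \<Theta>" "surj \<Theta>" and \<kappa>: "\<And>j. \<kappa> j < n" and eq: "\<And>t. r (\<phi> t x) = wcurve c \<kappa> (\<Theta> t)"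
    using run by (auto simp: runs_along_def)
  have \<Theta>': "continuous_on UNIV \<Theta>'" "strict_mono \<Theta>'" "surj \<Theta>'" and \<kappa>': "\<And>j. \<kappa>' j < n'" and eq': "\<And>t. r' (\<phi> t x) = wcurve c' \<kappa>' (\<Theta>' t)"
    using run' by (auto simp: runs_along_def)
  have \<Theta>'': "continuous_on UNIV \<Theta>''" "strict_mono \<Theta>''" and \<kappa>'': "\<And>j. \<kappa>'' j < n''" and eq'': "\<And>t. r'' (\<phi> t x) = wcurve c'' \<kappa>'' (\<Theta>'' t)"
    using run'' by (auto simp: runs_along_def)
  define i where "i = \<lfloor>\<Theta> 0\<rfloor>"
  have ka: "\<kappa> i = a"
  proof -
    have "c (\<kappa> i) (frac (\<Theta> 0)) = c a (1/2)" using eq[of 0] x r.flow_0 by (simp add: wcurve_def i_def)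
    then show ?thesis using r.c_eq_cases[of "\<kappa> i" a "frac (\<Theta> 0)" "1/2"] \<kappa> a frac_lt_1[of "\<Theta> 0"] by auto
  qed
  obtain t0 t1 where t: "\<Theta> t0 = of_int i" "\<Theta> t1 = of_int i + 1" using \<Theta>(3) by (metis surjD)
  have t01: "t0 \<le> t1" using \<Theta>(2) t by (metis add_increasing2 order_refl strict_mono_less_eq zero_le_one)
  have "r (\<phi> t x) = w" if "t \<in> {t0, t1}" for t
    using that eq t r.wcurve_int[of \<kappa> i] r.wcurve_int[of \<kappa> "i + 1"] \<kappa> by auto
  then have wt: "r (\<phi> t0 x) = w" "r (\<phi> t1 x) = w" by auto
  define z where "z t = round (\<Theta>' t)" for t
  have "\<forall>j. \<exists>t. \<Theta>' t = real_of_int j" using \<Theta>'(3) by (metis surjD)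
  then obtain \<delta> where \<delta>: "\<And>j. \<Theta>' (\<delta> j) = real_of_int j" by metis
  define R where "R j = round (\<Theta>'' (\<delta> j))" for j
  have \<delta>mono: "\<delta> j \<le> \<delta> (j + 1)" for j using \<delta>[of j] \<delta>[of "j + 1"] strict_mono_less_eq[OF \<Theta>'(2), of "\<delta> j" "\<delta> (j + 1)"] by simp
  have Rmono: "R j \<le> R (j + 1)" for j
    unfolding R_def using \<delta>mono[of j] strict_mono_less_eq[OF \<Theta>''(2)] by (intro round_mono) simp
  have Da: "map \<kappa>' [z t0..z t1 - 1] = D a"
    using transcribesD[OF D x(1) run run' t] by (simp add: ka z_def)
  have Uj: "U (\<kappa>' j) = map \<kappa>'' [R j..R (j + 1) - 1]" for j
    using transcribesD[OF U x(1) run' run'' \<delta>[of j], of "\<delta> (j + 1)"] \<delta>[of "j + 1"] by (simp add: R_def)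
  have z01: "z t0 \<le> z t1" unfolding z_def using t01 strict_mono_less_eq[OF \<Theta>'(2)] by (intro round_mono) simp
  have cU: "concat (map U (D a)) = map \<kappa>'' [R (z t0)..R (z t1) - 1]"
    unfolding Da[symmetric] using concat_map_upto[OF z01, of R U \<kappa>' \<kappa>'', OF Rmono Uj] by simp
  text \<open>Between a passage of \<open>r\<close> through the wedge point and the nearest passage of \<open>r'\<close>, the curve in the third wedge stays near the wedge point.\<close>
  have Rz: "R (z s) = round (\<Theta>'' s)" if "r (\<phi> s x) = w" for s
  proof -
    have s: "\<rho> < Re (cis (2 * pi * \<Theta>' s))" using \<rho>(2)[OF r.flow_in[OF x(1)] that] eq' r'.wcurve_clock \<kappa>' by simp
    define d where "d = \<Theta>' s - of_int (z s)"
    have dle: "\<bar>d\<bar> \<le> 1/2" using of_int_round_abs_le[of "\<Theta>' s"] by (auto simp: d_def z_def abs_minus_commute)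
    have cosd: "cos (2 * pi * (u - of_int (z s))) = cos (2 * pi * u)" for u
    proof -
      have "cis (2 * pi * (u - of_int (z s))) = cis (2 * pi * u)" unfolding cis_2pi_eq_iff by (intro exI[of _ "- z s"]) simp
      then show ?thesis by (simp add: complex_eq_iff)
    qed
    \<comment> \<open>Between \<open>s\<close> and the nearest passage the lift
      \<open>\<Theta>'\<close> only approaches the integer \<open>z s\<close>, within half a turn,
      where the cosine is monotone. So the real part of the clock of \<open>r'\<close> stays above
      \<open>\<rho>\<close>.\<close>
    have pos: "0 < Re (cis (2 * pi * \<Theta>'' u))" if u: "min s (\<delta> (z s)) \<le> u" "u \<le> max s (\<delta> (z s))" for u
    proof -
      have "min (\<Theta>' s) (of_int (z s)) \<le> \<Theta>' u \<and> \<Theta>' u \<le> max (\<Theta>' s) (of_int (z s))"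
        using u strict_mono_less_eq[OF \<Theta>'(2)] \<delta>[of "z s"] unfolding min_def max_def by (auto split: if_splits) (metis linear order_trans)+
      then have le: "\<bar>\<Theta>' u - of_int (z s)\<bar> \<le> \<bar>d\<bar>" unfolding d_def by (auto simp: min_def max_def abs_if split: if_splits)
      have "cos (2 * pi * \<bar>d\<bar>) \<le> cos (2 * pi * \<bar>\<Theta>' u - of_int (z s)\<bar>)"
      proof (rule cos_monotone_0_pi_le)
        show "2 * pi * \<bar>\<Theta>' u - of_int (z s)\<bar> \<le> 2 * pi * \<bar>d\<bar>" using le by (intro mult_left_mono) auto
        show "2 * pi * \<bar>d\<bar> \<le> pi" using mult_left_mono[OF dle, of "2 * pi"] by simp
      qed simp
      moreover have "cos (2 * pi * \<bar>y\<bar>) = cos (2 * pi * y)" for y :: real by (cases "y \<ge> 0") simp_all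
      ultimately have "cos (2 * pi * \<Theta>' s) \<le> cos (2 * pi * \<Theta>' u)" using cosd unfolding d_def by simp
      then have "\<rho> < Re (clock c' n' (r' (\<phi> u x)))" using s eq' r'.wcurve_clock \<kappa>' by simp
      from \<rho>(3)[OF r.flow_in[OF x(1)] this] show ?thesis using eq'' r''.wcurve_clock \<kappa>'' by simp
    qed
    have "round (\<Theta>'' (min s (\<delta> (z s)))) = round (\<Theta>'' (max s (\<delta> (z s))))"
      by (rule round_const) (use pos in \<open>auto intro: continuous_on_subset[OF \<Theta>''(1)]\<close>)
    then show ?thesis unfolding R_def by (auto simp: min_def max_def split: if_splits)
  qed
  \<comment> \<open>At \<open>t0\<close> and \<open>t1\<close> the curve \<open>r''\<close> is
    exactly at the wedge point, so rounding changes nothing there and the exact comparison of normal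
    forms applies.\<close>
  have "f w = w''" using r''.follows_words_cont(2)[OF r.wedge_axioms f] .
  then have "\<Theta>'' s \<in> \<int>" if "r (\<phi> s x) = w" for s
    using fr[OF r.flow_in[OF x(1)], of s] that eq''[of s] r''.wcurve_clock[of \<kappa>'' "\<Theta>'' s"] \<kappa>'' by (simp add: cis_2pi_eq_1_iff)
  from this[OF wt(1)] obtain i'' :: int where i'': "\<Theta>'' t0 = of_int i''" by (auto elim: Ints_cases)
  obtain \<Phi> where \<Phi>: "set (v a) \<subseteq> {..<n''}" "continuous_on {0..1} \<Phi>" "\<Phi> 0 = 0" "\<Phi> 1 = real (length (v a))"
    "\<And>s. s \<in> {0..1} \<Longrightarrow> f (c a s) = wcurve c'' (word_ext (v a)) (\<Phi> s)"
    by (rule follows_wordsE[OF f a]) blast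
  have im: "\<Theta> u - of_int i \<in> {0..1}" if "u \<in> {t0..t1}" for u
  proof -
    have "\<Theta> t0 \<le> \<Theta> u" "\<Theta> u \<le> \<Theta> t1" using that strict_mono_less_eq[OF \<Theta>(2)] by auto
    then show ?thesis using t by auto
  qed
  have same: "wcurve c'' (word_ext (v a)) (\<Phi> (\<Theta> u - of_int i)) = wcurve c'' \<kappa>'' (\<Theta>'' u)" if u: "u \<in> {t0..t1}" for u
  proof -
    have "r (\<phi> u x) = c a (\<Theta> u - of_int i)"
      using r.wcurve_piece[of \<kappa> i "\<Theta> u"] \<kappa> im[OF u] eq ka by auto
    then show ?thesis using \<Phi>(5)[OF im[OF u]] fr[OF r.flow_in[OF x(1)], of u] eq''[of u] by simp
  qed
  have cont: "continuous_on {t0..t1} (\<lambda>u. \<Phi> (\<Theta> u - of_int i))" "continuous_on {t0..t1} \<Theta>''"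
    by (rule continuous_on_compose2[OF \<Phi>(2)])
      (use im in \<open>auto intro!: continuous_intros continuous_on_subset[OF \<Theta>(1)] continuous_on_subset[OF \<Theta>''(1)]\<close>)
  have start: "\<Phi> (\<Theta> t0 - of_int i) = of_int 0" and stop: "\<Phi> (\<Theta> t1 - of_int i) = of_int (int (length (v a)))"
    using t \<Phi>(3,4) by simp_all
  have nf: "\<Theta>'' t1 = of_int (int (length (v a)) - 0 + i'')"
    "map (word_ext (v a)) [0..int (length (v a)) - 1] = map \<kappa>'' [i''..int (length (v a)) - 0 + i'' - 1]"
    by (rule r''.normal_form_letters_eq[OF r''.word_ext_less[OF \<Phi>(1)] \<kappa>'' t01 cont same start i'' stop], assumption)+
  have "concat (map U (D a)) = map \<kappa>'' [round (\<Theta>'' t0)..round (\<Theta>'' t1) - 1]"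
    using cU Rz[OF wt(1)] Rz[OF wt(2)] by simp
  also have "round (\<Theta>'' t1) = int (length (v a)) - 0 + i''" by (subst nf(1)) (rule round_of_int)
  also have "map \<kappa>'' [round (\<Theta>'' t0)..int (length (v a)) - 0 + i'' - 1] = v a" using nf(2) i'' map_word_ext[of "v a"] by simp
  finally show ?thesis .
qed

section \<open>Towers of projections over a flow\<close>

lemma bond_add: "bond f i (j + k) = bond f i j \<circ> bond f (i + j) k"
  by (induction k) (auto simp: add.assoc)

lemma bond_Suc_left: "bond f i (Suc j) = f i \<circ> bond f (Suc i) j"
  using bond_add[of f i 1 j] by simp

text \<open>The part of an expansion that can be pulled back along a flow equivalence, with the
  bonding maps already replaced by words. Of the homeomorphism onto the limit it keeps the
  separation of points; where the limit itself is meant, it is assumed separately.\<close>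

locale tower = compact_flow X \<phi>
  for X :: "'a topology" and \<phi> +
  fixes Ws :: "nat \<Rightarrow> 'b topology" and ws n c f r x0 v
  assumes projection: "\<And>i. positive_projection X \<phi> (Ws i) (ws i) (n i) (c i) (r i) x0"
    and words: "\<And>i. follows_words (n (Suc i)) (c (Suc i)) (n i) (c i) (f i) (v i)"
    and coherent: "\<And>i x. x \<in> topspace X \<Longrightarrow> r i x = f i (r (Suc i) x)"
    and separating: "\<And>x x'. x \<in> topspace X \<Longrightarrow> x' \<in> topspace X \<Longrightarrow> (\<And>i. r i x = r i x') \<Longrightarrow> x = x'"
begin

lemma wedges: "wedge (Ws i) (ws i) (n i) (c i)"
  using projection[of i] by (simp add: positive_projection_def)

lemma r_cont: "continuous_map X (Ws i) (r i)" and r_x0: "r i x0 = ws i" and x0_in: "x0 \<in> topspace X"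
  using positive_projection.r_cont[OF projection] positive_projection.r_x0[OF projection]
    positive_projection.x0_in[OF projection] by blast+

lemma r_in: "x \<in> topspace X \<Longrightarrow> r i x \<in> topspace (Ws i)"
  using r_cont[of i] by (auto simp: continuous_map_def)

lemma bond_r: "x \<in> topspace X \<Longrightarrow> bond f i j (r (i + j) x) = r i x"
  by (induction j) (auto simp flip: coherent)

lemma bond_r': "x \<in> topspace X \<Longrightarrow> i \<le> j \<Longrightarrow> bond f i (j - i) (r j x) = r i x"
  using bond_r[of x i "j - i"] by simp

lemma bond_words: "i \<le> j \<Longrightarrow> \<exists>u. follows_words (n j) (c j) (n i) (c i) (bond f i (j - i)) u"
  using follows_words_bond[where Ws=Ws and ws=ws and n=n and c=c and f=f and v=v, OF wedges words, of i "j - i"] by simp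

lemma bond_cont:
  assumes "i \<le> j"
  shows "continuous_map (Ws j) (Ws i) (bond f i (j - i))"
proof -
  obtain u where "follows_words (n j) (c j) (n i) (c i) (bond f i (j - i)) u" using bond_words[OF assms] by blast
  then show "continuous_map (Ws j) (Ws i) (bond f i (j - i))"
    using wedge.follows_words_cont(1)[OF wedges wedges] by blast
qed

lemma separating_cofinal:
  assumes x: "x \<in> topspace X" "x' \<in> topspace X" and M: "\<And>i. i \<le> M i" and eq: "\<And>k. r (M k) x = r (M k) x'"
  shows "x = x'"
proof (rule separating[OF x])
  fix i show "r i x = r i x'" using bond_r'[OF x(1) M[of i]] bond_r'[OF x(2) M[of i]] eq[of i] by simp
qed

lemma fibres_shrink:
  fixes F :: "'a \<Rightarrow> complex"
  assumes F: "continuous_map X euclidean F" and e: "e > 0"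
  obtains M where "\<And>m x x'. m \<ge> M \<Longrightarrow> x \<in> topspace X \<Longrightarrow> x' \<in> topspace X \<Longrightarrow> r m x = r m x' \<Longrightarrow> norm (F x - F x') < e"
proof (rule compact_fibres_shrink[OF compact r_cont _ _ separating F e])
  show "Hausdorff_space (Ws i)" for i using wedge.Haus[OF wedges] .
  show "r i x = r i x'" if "x \<in> topspace X" "x' \<in> topspace X" "r (Suc i) x = r (Suc i) x'" for i x x'
    using coherent[OF that(1), of i] coherent[OF that(2), of i] that(3) by simp
qed (assumption+, rule that, assumption)

text \<open>A wedge has finitely many circles, so finitely many continuous functions have to vary by
  less than 1 on the fibres, and one stage serves for all of them.\<close>

lemma eventually_resolves:
  assumes r': "positive_projection X \<phi> W' w' n' c' r' x0"
  shows "\<exists>M. \<forall>m\<ge>M. resolves X (r m) r' n' c'"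
proof -
  interpret r': positive_projection X \<phi> W' w' n' c' r' x0 by fact
  have c1: "continuous_map X euclidean (\<lambda>x. clock c' n' (r' x))"
    using continuous_map_compose[OF r'.r_cont r'.clock_cont] by (simp add: o_def)
  have c2: "continuous_map X euclidean (\<lambda>x. circ c' n' k (r' x))" for k
    using continuous_map_compose[OF r'.r_cont r'.circ_cont] by (simp add: o_def)
  obtain M0 where M0: "\<And>m x x'. m \<ge> M0 \<Longrightarrow> x \<in> topspace X \<Longrightarrow> x' \<in> topspace X \<Longrightarrow> r m x = r m x' \<Longrightarrow>
      norm (clock c' n' (r' x) - clock c' n' (r' x')) < 1"
    by (rule fibres_shrink[OF c1, of 1]) auto
  have "\<exists>M. \<forall>m x x'. m \<ge> M \<longrightarrow> x \<in> topspace X \<longrightarrow> x' \<in> topspace X \<longrightarrow> r m x = r m x' \<longrightarrow>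
      norm (circ c' n' k (r' x) - circ c' n' k (r' x')) < 1" for k
    by (rule fibres_shrink[OF c2[of k], of 1]) auto
  then obtain M where M: "\<And>k m x x'. m \<ge> M k \<Longrightarrow> x \<in> topspace X \<Longrightarrow> x' \<in> topspace X \<Longrightarrow> r m x = r m x' \<Longrightarrow>
      norm (circ c' n' k (r' x) - circ c' n' k (r' x')) < 1" by metis
  define N where "N = Max (insert M0 (M ` {..<n'}))"
  have "M0 \<le> N" "k < n' \<Longrightarrow> M k \<le> N" for k by (auto simp: N_def)
  then show ?thesis unfolding resolves_def using M0 M by (meson order_trans)
qed

end

text \<open>Where \<open>r\<close> is at the wedge point, \<open>r'\<close> is so close to it that \<open>r''\<close> stays near the wedge point
until \<open>r'\<close> passes through it.\<close>
definition handover where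
  "handover X r w n' c' r' n'' c'' r'' \<longleftrightarrow> (\<exists>\<rho>::real. 0 \<le> \<rho> \<and>
     (\<forall>y\<in>topspace X. r y = w \<longrightarrow> \<rho> < Re (clock c' n' (r' y))) \<and>
     (\<forall>y\<in>topspace X. \<rho> < Re (clock c' n' (r' y)) \<longrightarrow> 0 < Re (clock c'' n'' (r'' y))))"

text \<open>Where \<open>r'\<close> is at its wedge point it agrees with its value at
  \<open>x0\<close>, so the assumption on \<open>r'\<close> and \<open>r''\<close> puts
  \<open>r''\<close> near its own wedge point. Compactness extends this to all points whose clock
  under \<open>r'\<close> has real part above some \<open>\<rho> < 1\<close>. For high stages the
  fibre over the wedge point, which contains \<open>x0\<close>, has all its clocks within
  \<open>1 - \<rho>\<close> of 1.\<close>

lemma (in tower) eventually_handover: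
  assumes r': "positive_projection X \<phi> W' w' n' c' r' x0" and r'': "positive_projection X \<phi> W'' w'' n'' c'' r'' x0"
    and res: "resolves X r' r'' n'' c''"
  shows "\<exists>M. \<forall>m\<ge>M. handover X (r m) (ws m) n' c' r' n'' c'' r''"
proof -
  interpret r': positive_projection X \<phi> W' w' n' c' r' x0 by fact
  interpret r'': positive_projection X \<phi> W'' w'' n'' c'' r'' x0 by fact
  have c1: "continuous_map X euclidean (\<lambda>x. clock c' n' (r' x))"
    using continuous_map_compose[OF r'.r_cont r'.clock_cont] by (simp add: o_def)
  have c2: "continuous_map X euclidean (\<lambda>x. clock c'' n'' (r'' x))"
    using continuous_map_compose[OF r''.r_cont r''.clock_cont] by (simp add: o_def)
  have Re: "continuous_map euclidean euclideanreal Re" by (simp add: continuous_on_Re)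
  have at_w: "0 < Re (clock c'' n'' (r'' y))" if y: "y \<in> topspace X" "1 \<le> Re (clock c' n' (r' y))" for y
  proof -
    have in': "r' y \<in> topspace W'" using r'.r_cont y(1) by (auto simp: continuous_map_def)
    have "cmod (clock c' n' (r' y)) = 1" using r'.norm_clock[OF in'] .
    then have "clock c' n' (r' y) = 1"
      using y(2) complex_Re_le_cmod[of "clock c' n' (r' y)"] cmod_eq_Re[of "clock c' n' (r' y)"]
      by (auto simp: complex_eq_iff cmod_def)
    then have "r' y = r' x0" using r'.clock_eq_1_iff[OF in'] r'.r_x0 by simp
    then have "norm (clock c'' n'' (r'' y) - 1) < 1"
      using res y(1) x0_in r''.r_x0 r''.clock_w unfolding resolves_def by metis
    then show ?thesis by (rule norm_less_1_imp_Re_pos)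
  qed
  obtain \<rho> where \<rho>: "0 \<le> \<rho>" "\<rho> < 1" "\<And>y. y \<in> topspace X \<Longrightarrow> \<rho> < Re (clock c' n' (r' y)) \<Longrightarrow> 0 < Re (clock c'' n'' (r'' y))"
    by (rule compact_threshold[OF compact, of "\<lambda>y. Re (clock c' n' (r' y))" "\<lambda>y. Re (clock c'' n'' (r'' y))"])
      (use continuous_map_compose[OF c1 Re] continuous_map_compose[OF c2 Re] at_w in \<open>auto simp: o_def\<close>)
  obtain M where M: "\<And>m x x'. m \<ge> M \<Longrightarrow> x \<in> topspace X \<Longrightarrow> x' \<in> topspace X \<Longrightarrow> r m x = r m x' \<Longrightarrow>
      norm (clock c' n' (r' x) - clock c' n' (r' x')) < 1 - \<rho>"
    by (rule fibres_shrink[OF c1, of "1 - \<rho>"]) (use \<rho> in auto)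
  have "\<rho> < Re (clock c' n' (r' y))" if "m \<ge> M" "y \<in> topspace X" "r m y = ws m" for m y
  proof -
    have "norm (clock c' n' (r' y) - 1) < 1 - \<rho>"
      using M[OF that(1,2) x0_in] that(3) r_x0 r'.r_x0 by simp
    then show ?thesis using abs_Re_le_cmod[of "clock c' n' (r' y) - 1"] by simp
  qed
  then show ?thesis unfolding handover_def using \<rho>(1,3) by blast
qed

text \<open>The projection of an orbit has a normal form on the whole line. Uniform advance of the
  clock makes its lift surjective, and that completes \<open>runs_along\<close>.\<close>

lemma expansion_tower:
  assumes fs: "flow_space X \<phi>" and ex: "expansion X \<phi> x0 Ws ws n c f p"
  obtains v where "tower X \<phi> Ws ws n c f p x0 v"
proof -
  have fl: "compact_flow X \<phi>"
    using fs unfolding flow_space_def compact_flow_def by blast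
  interpret compact_flow X \<phi> by fact
  have W: "wedge (Ws i) (ws i) (n i) (c i)" for i using ex by (simp add: expansion_def wedge_def)
  have pm: "positive_map (Ws (Suc i)) (ws (Suc i)) (n (Suc i)) (c (Suc i)) (Ws i) (ws i) (n i) (c i) (f i)" for i
    using ex by (simp add: expansion_def)
  have p: "continuous_map X (Ws i) (p i)" "p i ` topspace X = topspace (Ws i)" "p i x0 = ws i"
    "\<And>x t. x \<in> topspace X \<Longrightarrow> locally_positive (c i) (n i) (\<lambda>t. p i (\<phi> t x)) t" for i
    using ex unfolding expansion_def by blast+
  have x0: "x0 \<in> topspace X" using ex by (simp add: expansion_def)
  have hm: "homeomorphic_map X (subtopology (product_topology Ws UNIV)
          {z. \<forall>i. z i \<in> topspace (Ws i) \<and> z i = f i (z (Suc i))}) (\<lambda>x i. p i x)"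
    using ex unfolding expansion_def by blast
  have proj: "positive_projection X \<phi> (Ws i) (ws i) (n i) (c i) (p i) x0" for i
  proof -
    interpret W: wedge "Ws i" "ws i" "n i" "c i" by (rule W)
    have nf: "\<exists>\<kappa> \<Theta>. (\<forall>j. \<kappa> j < n i) \<and> clock_lift (\<lambda>t. clock (c i) (n i) (p i (\<phi> t x))) \<Theta> \<and> (\<forall>t. p i (\<phi> t x) = wcurve (c i) \<kappa> (\<Theta> t))"
      if x: "x \<in> topspace X" for x
    proof -
      have "continuous_map (top_of_set UNIV) (Ws i) (\<lambda>t. p i (\<phi> t x))"
        using continuous_map_compose[OF orbit_cont[OF x] p(1)] by (simp add: o_def)
      then obtain \<kappa> \<Theta> where "\<And>j. \<kappa> j < n i" "continuous_on UNIV \<Theta>" "strict_mono_on UNIV \<Theta>"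
        "\<And>t. t \<in> UNIV \<Longrightarrow> p i (\<phi> t x) = wcurve (c i) \<kappa> (\<Theta> t)"
        by (rule W.positive_curve_normal_form[OF convex_UNIV]) (use p(4)[OF x] in auto)
      then show ?thesis using W.wcurve_clock by (intro exI[of _ \<kappa>] exI[of _ \<Theta>]) (auto simp: clock_lift_def)
    qed
    have F: "continuous_map X euclidean (\<lambda>x. clock (c i) (n i) (p i x))"
      using continuous_map_compose[OF p(1) W.clock_cont] by (simp add: o_def)
    have lifts: "\<exists>\<Theta>. clock_lift (\<lambda>t. clock (c i) (n i) (p i (\<phi> t x))) \<Theta>" if "x \<in> topspace X" for x
      using nf[OF that] by blast
    show ?thesis
    proof unfold_locales
      fix x assume x: "x \<in> topspace X"
      then obtain \<kappa> \<Theta> where k: "\<forall>j. \<kappa> j < n i" "clock_lift (\<lambda>t. clock (c i) (n i) (p i (\<phi> t x))) \<Theta>"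
        "\<forall>t. p i (\<phi> t x) = wcurve (c i) \<kappa> (\<Theta> t)" using nf by blast
      have "surj \<Theta>" by (rule clock_lift_surj[OF F lifts x k(2)])
      then show "\<exists>\<kappa> \<Theta>. runs_along (c i) (n i) (\<lambda>t. p i (\<phi> t x)) \<kappa> \<Theta>"
        using k unfolding runs_along_def clock_lift_def by blast
    qed (use p x0 in auto)
  qed
  have "\<exists>v. follows_words (n (Suc i)) (c (Suc i)) (n i) (c i) (f i) v" for i
    using wedge.positive_map_follows_words[OF W W pm] by blast
  then obtain v where v: "\<And>i. follows_words (n (Suc i)) (c (Suc i)) (n i) (c i) (f i) (v i)" by metis
  have "tower X \<phi> Ws ws n c f p x0 v"
  proof (intro tower.intro tower_axioms.intro fl proj v)
    fix i x assume "x \<in> topspace X"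
    then have "p i x = bond f i 1 (p (i + 1) x)" using ex unfolding expansion_def by blast
    then show "p i x = f i (p (Suc i) x)" by simp
  next
    fix x x' assume x: "x \<in> topspace X" "x' \<in> topspace X" "\<And>i. p i x = p i x'"
    have "inj_on (\<lambda>x i. p i x) (topspace X)" using hm homeomorphic_imp_injective_map by blast
    then show "x = x'" using x by (auto dest: inj_onD)
  qed
  then show thesis using that by blast
qed

text \<open>Composing the projections with \<open>h\<close> keeps the words: an orbit of
  \<open>X\<close> has the letters of its image orbit, with the lift reparametrised by
  \<open>\<tau>\<close>. Afterwards both expansions live over one flow and \<open>h\<close> has
  disappeared from the problem.\<close>

lemma tower_transfer:
  assumes Y: "tower Y \<psi> Ws ws n c g q y0 v" and X: "compact_flow X \<phi>"
    and h: "flow_equivalence X \<phi> Y \<psi> h" "h x0 = y0" "x0 \<in> topspace X"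
  shows "tower X \<phi> Ws ws n c g (\<lambda>i x. q i (h x)) x0 v"
proof -
  interpret X: compact_flow X \<phi> by fact
  interpret Y: tower Y \<psi> Ws ws n c g q y0 v by fact
  have hm: "homeomorphic_map X Y h" using h by (simp add: flow_equivalence_def)
  have hc: "continuous_map X Y h" using hm homeomorphic_imp_continuous_map by blast
  have him: "h ` topspace X = topspace Y" using hm homeomorphic_imp_surjective_map by blast
  have hinj: "inj_on h (topspace X)" using hm homeomorphic_imp_injective_map by blast
  have "positive_projection X \<phi> (Ws i) (ws i) (n i) (c i) (\<lambda>x. q i (h x)) x0" for i
  proof -
    interpret P: positive_projection Y \<psi> "Ws i" "ws i" "n i" "c i" "q i" y0 by (rule Y.projection)
    show ?thesis
    proof unfold_locales
      show "continuous_map X (Ws i) (\<lambda>x. q i (h x))"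
        using continuous_map_compose[OF hc P.r_cont] by (simp add: o_def)
      show "(\<lambda>x. q i (h x)) ` topspace X = topspace (Ws i)"
        using him P.r_surj by (metis image_image)
      show "x0 \<in> topspace X" "q i (h x0) = ws i" using h P.r_x0 by auto
      fix x assume x: "x \<in> topspace X"
      then have "h x \<in> topspace Y" using him by blast
      then obtain \<kappa> \<Theta> where run: "runs_along (c i) (n i) (\<lambda>t. q i (\<psi> t (h x))) \<kappa> \<Theta>" using P.r_runs by blast
      obtain \<tau> where \<tau>: "strict_mono \<tau>" "surj \<tau>" "\<And>t. h (\<phi> t x) = \<psi> (\<tau> t) (h x)"
        using h(1) x unfolding flow_equivalence_def by blast
      \<comment> \<open>A monotone surjection of the line is continuous.\<close>
      have "continuous_on UNIV \<tau>"
        by (rule continuous_onI_mono) (use \<tau> strict_mono_mono[OF \<tau>(1)] in \<open>auto dest: monoD\<close>)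
      then have "continuous_on UNIV (\<Theta> \<circ> \<tau>)"
        using run unfolding runs_along_def by (intro continuous_on_compose) (auto intro: continuous_on_subset)
      moreover have "strict_mono (\<Theta> \<circ> \<tau>)" "surj (\<Theta> \<circ> \<tau>)"
        using run \<tau> comp_surj[OF \<tau>(2), of \<Theta>] by (auto simp: runs_along_def strict_mono_def)
      ultimately have "runs_along (c i) (n i) (\<lambda>t. q i (h (\<phi> t x))) \<kappa> (\<Theta> \<circ> \<tau>)"
        using run \<tau>(3) by (simp add: runs_along_def)
      then show "\<exists>\<kappa> \<Theta>. runs_along (c i) (n i) (\<lambda>t. q i (h (\<phi> t x))) \<kappa> \<Theta>" by blast
    qed
  qed
  then show ?thesis
  proof (intro tower.intro tower_axioms.intro X Y.words)
    show "q i (h x) = g i (q (Suc i) (h x))" if "x \<in> topspace X" for i x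
      using Y.coherent[of "h x"] him that by blast
    show "x = x'" if x: "x \<in> topspace X" "x' \<in> topspace X" "\<And>i. q i (h x) = q i (h x')" for x x'
    proof -
      have "h x = h x'" by (rule Y.separating) (use him x in auto)
      then show ?thesis using hinj x by (auto dest: inj_onD)
    qed
  qed
qed

section \<open>From transcriptions to homomorphisms\<close>

lemma follows_words_exists:
  assumes W': "wedge W' w' n' c'" and W: "wedge W w n c"
    and v: "\<And>a. a < n' \<Longrightarrow> v a \<noteq> []" "\<And>a. a < n' \<Longrightarrow> set (v a) \<subseteq> {..<n}"
  obtains F where "follows_words n' c' n c F v"
proof -
  interpret W': wedge W' w' n' c' by fact
  interpret W: wedge W w n c by fact
  define F where "F = wedge_fun c' n' (\<lambda>a. wloop c (v a))"
  have F: "F (c' a s) = wloop c (v a) s" if "a < n'" "0 \<le> s" "s \<le> 1" for a s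
    unfolding F_def
  proof (rule W'.wedge_fun_eq[where v=w, OF that])
    fix j assume "j < n'"
    then show "wloop c (v j) 0 = w \<and> wloop c (v j) 1 = w"
      using W.wloop_loopin[OF v(2)] by (simp add: loopin_def)
  qed
  have "follows_words n' c' n c F v"
    unfolding follows_words_def
  proof (intro allI impI conjI v)
    fix a assume a: "a < n'"
    show "\<exists>\<Theta>. continuous_on {0..1} \<Theta> \<and> strict_mono_on {0..1} \<Theta> \<and> \<Theta> 0 = 0 \<and> \<Theta> 1 = real (length (v a)) \<and>
        (\<forall>s\<in>{0..1}. F (c' a s) = wcurve c (word_ext (v a)) (\<Theta> s))"
      using F[OF a] v(1)[OF a]
      by (intro exI[of _ "\<lambda>s. real (length (v a)) * s"]) (auto simp: wloop_def strict_mono_on_def intro!: continuous_intros)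
  qed
  then show thesis using that by blast
qed

lemma follows_words_cong:
  assumes "follows_words n' c' n c f v" "\<And>a. a < n' \<Longrightarrow> v a = v' a"
  shows "follows_words n' c' n c f v'"
  using assms unfolding follows_words_def by auto

lemma (in tower) hcomp_class:
  assumes "loopin (Ws (i + j)) (ws (i + j)) g"
  shows "hcomp (Pi_maps Ws ws f) i j (loop_class (Ws (i + j)) (ws (i + j)) g) = loop_class (Ws i) (ws i) (bond f i j \<circ> g)"
  using assms
proof (induction j arbitrary: g)
  case (Suc j)
  have f: "continuous_map (Ws (Suc (i + j))) (Ws (i + j)) (f (i + j))" "f (i + j) (ws (Suc (i + j))) = ws (i + j)"
    using wedge.follows_words_cont[OF wedges wedges words] by blast+
  have g: "loopin (Ws (Suc (i + j))) (ws (Suc (i + j))) g" using Suc.prems by simp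
  show ?case
    using Suc.IH[OF loopin_compose[OF g f], unfolded o_def] pi1_map_class[OF g f, unfolded o_def] by (simp add: Pi_maps_def o_def)
qed (simp add: o_def)

lemma (in tower) hcomp_class':
  assumes "i \<le> k" "loopin (Ws k) (ws k) g"
  shows "hcomp (Pi_maps Ws ws f) i (k - i) (loop_class (Ws k) (ws k) g) = loop_class (Ws i) (ws i) (bond f i (k - i) \<circ> g)"
  using hcomp_class[of i "k - i" g] assms by simp

text \<open>Substitution gives the composite of \<open>D\<close> and \<open>U\<close> the same words
  as \<open>B\<close>, so the two are homotopic on every loop. Thus an identity between words
  becomes an identity on the whole fundamental group.\<close>

lemma pi1_map_factor:
  assumes W3: "wedge W3 w3 n3 c3" and W2: "wedge W2 w2 n2 c2" and W1: "wedge W1 w1 n1 c1"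
    and D: "follows_words n3 c3 n2 c2 D d" and U: "follows_words n2 c2 n1 c1 U u" and B: "follows_words n3 c3 n1 c1 B b"
    and eq: "\<And>a. a < n3 \<Longrightarrow> concat (map u (d a)) = b a" and g: "loopin W3 w3 g"
  shows "pi1_map W1 w1 U (pi1_map W2 w2 D (loop_class W3 w3 g)) = loop_class W1 w1 (B \<circ> g)"
proof -
  have Dc: "continuous_map W3 W2 D" "D w3 = w2" using wedge.follows_words_cont[OF W2 W3 D] by auto
  have Uc: "continuous_map W2 W1 U" "U w2 = w1" using wedge.follows_words_cont[OF W1 W2 U] by auto
  have UD: "follows_words n3 c3 n1 c1 (U \<circ> D) b"
    by (rule follows_words_cong[OF follows_words_comp[OF W3 W2 W1 D U] eq])
  have "pi1_map W1 w1 U (pi1_map W2 w2 D (loop_class W3 w3 g)) = loop_class W1 w1 (U \<circ> (D \<circ> g))"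
    using pi1_map_class[OF g Dc] pi1_map_class[OF loopin_compose[OF g Dc] Uc] by simp
  also have "\<dots> = loop_class W1 w1 (B \<circ> g)"
    using loop_class_eq[OF wedge.same_words_homotopic[OF W1 W3 UD B g]] by (simp add: o_assoc)
  finally show ?thesis .
qed

text \<open>Stages are chosen alternately. Each new stage must resolve the last stage of the other
  tower and hand over through it to the stage before. The handover can be arranged because the
  preceding step already made that last stage resolve the one before it.\<close>

lemma towers_over_flow_isomorphic:
  assumes P: "tower X \<phi> Xs xs nX cX f p x0 v" and Q: "tower X \<phi> Ys ys nY cY g q x0 v'"
  shows "iso_inverse_seq (Pi_groups Xs xs) (Pi_gens Xs xs nX cX) (Pi_maps Xs xs f)
                         (Pi_groups Ys ys) (Pi_gens Ys ys nY cY) (Pi_maps Ys ys g)"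
proof -
  interpret P: tower X \<phi> Xs xs nX cX f p x0 v by fact
  interpret Q: tower X \<phi> Ys ys nY cY g q x0 v' by fact
  let ?XX = "\<lambda>i j. follows_words (nX i) (cX i) (nX j) (cX j)"
  let ?XY = "\<lambda>i j. follows_words (nX i) (cX i) (nY j) (cY j)"
  let ?YX = "\<lambda>i j. follows_words (nY i) (cY i) (nX j) (cX j)"
  let ?YY = "\<lambda>i j. follows_words (nY i) (cY i) (nY j) (cY j)"
  let ?resD = "\<lambda>i j. resolves X (p i) (q j) (nY j) (cY j)"
  let ?resU = "\<lambda>j i. resolves X (q j) (p i) (nX i) (cX i)"
  let ?hoD = "\<lambda>i j k. handover X (p i) (xs i) (nY j) (cY j) (q j) (nX k) (cX k) (p k)"
  let ?hoU = "\<lambda>j i k. handover X (q j) (ys j) (nX i) (cX i) (p i) (nY k) (cY k) (q k)"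
  let ?trD = "\<lambda>i j. transcribes X \<phi> (nX i) (cX i) (p i) (nY j) (cY j) (q j)"
  let ?trU = "\<lambda>j i. transcribes X \<phi> (nY j) (cY j) (q j) (nX i) (cX i) (p i)"
  let ?clX = "\<lambda>i y. clock (cX i) (nX i) (p i y)"
  let ?clY = "\<lambda>j y. clock (cY j) (nY j) (q j y)"
  define good where "good z \<longleftrightarrow> ?resD (snd z) (fst z)" for z
  define next_to where "next_to z z' \<longleftrightarrow> fst z < fst z' \<and> snd z < snd z' \<and>
     ?resU (fst z') (snd z) \<and>
     ?hoU (fst z') (snd z) (fst z) \<and>
     ?hoD (snd z') (fst z') (snd z)" for z z'
  have "\<exists>s. \<forall>k. good (s k) \<and> next_to (s k) (s (Suc k))"
  proof (rule dependent_nat_choice)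
    obtain M where "\<forall>m\<ge>M. ?resD m 0" using P.eventually_resolves[OF Q.projection] by blast
    then show "\<exists>z. good z" by (intro exI[of _ "(0, M)"]) (auto simp: good_def)
  next
    fix z :: "nat \<times> nat" assume z: "good z"
    obtain l m where lm: "z = (l, m)" by (cases z)
    have res: "?resD m l" using z by (simp add: good_def lm)
    obtain L1 where L1: "\<forall>l'\<ge>L1. resolves X (q l') (p m) (nX m) (cX m)" using Q.eventually_resolves[OF P.projection] by blast
    obtain L2 where L2: "\<forall>l'\<ge>L2. handover X (q l') (ys l') (nX m) (cX m) (p m) (nY l) (cY l) (q l)"
      using Q.eventually_handover[OF P.projection Q.projection res] by blast
    define l' where "l' = Max {L1, L2, Suc l}"
    have l': "L1 \<le> l'" "L2 \<le> l'" "l < l'" by (auto simp: l'_def)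
    have res': "resolves X (q l') (p m) (nX m) (cX m)" using L1 l' by blast
    obtain M1 where M1: "\<forall>m'\<ge>M1. resolves X (p m') (q l') (nY l') (cY l')" using P.eventually_resolves[OF Q.projection] by blast
    obtain M2 where M2: "\<forall>m'\<ge>M2. handover X (p m') (xs m') (nY l') (cY l') (q l') (nX m) (cX m) (p m)"
      using P.eventually_handover[OF Q.projection P.projection res'] by blast
    define m' where "m' = Max {M1, M2, Suc m}"
    have m': "M1 \<le> m'" "M2 \<le> m'" "m < m'" by (auto simp: m'_def)
    have "good (l', m')" "next_to z (l', m')" using L2 M1 M2 l' m' res' by (auto simp: good_def next_to_def lm)
    then show "\<exists>z'. good z' \<and> next_to z z'" by blast
  qed
  then obtain s where s: "\<And>k. good (s k)" "\<And>k. next_to (s k) (s (Suc k))" by blast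
  define l where "l k = fst (s k)" for k
  define m where "m k = snd (s k)" for k
  have mono: "l k < l (Suc k)" "m k < m (Suc k)" for k using s(2)[of k] by (auto simp: next_to_def l_def m_def)
  have resD: "?resD (m k) (l k)" for k using s(1)[of k] by (simp add: good_def l_def m_def)
  have resU: "?resU (l (Suc k)) (m k)" for k
    using s(2)[of k] by (simp add: next_to_def l_def m_def)
  have hoD: "?hoU (l (Suc k)) (m k) (l k)" for k
    using s(2)[of k] by (simp add: next_to_def l_def m_def)
  have hoU: "?hoD (m (Suc k)) (l (Suc k)) (m k)" for k
    using s(2)[of k] by (simp add: next_to_def l_def m_def)
  have "\<exists>D. ?trD (m k) (l k) D \<and> (\<forall>a. set (D a) \<subseteq> {..<nY (l k)})" for k
    using transcribes_exists[OF P.projection Q.projection resD] by metis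
  then obtain D where D: "\<And>k. ?trD (m k) (l k) (D k)"
    "\<And>k a. set (D k a) \<subseteq> {..<nY (l k)}" by metis
  have "\<exists>U. ?trU (l (Suc k)) (m k) U \<and> (\<forall>a. set (U a) \<subseteq> {..<nX (m k)})" for k
    using transcribes_exists[OF Q.projection P.projection resU] by metis
  then obtain U where U: "\<And>k. ?trU (l (Suc k)) (m k) (U k)"
    "\<And>k a. set (U k a) \<subseteq> {..<nX (m k)}" by metis
  define fb where "fb k = bond f (m k) (m (Suc k) - m k)" for k
  define gb where "gb k = bond g (l k) (l (Suc k) - l k)" for k
  have "\<exists>b. ?XX (m (Suc k)) (m k) (fb k) b" for k
    unfolding fb_def using P.bond_words mono(2) by (simp add: less_imp_le)
  then obtain fw where fw: "\<And>k. ?XX (m (Suc k)) (m k) (fb k) (fw k)" by metis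
  have "\<exists>b. ?YY (l (Suc k)) (l k) (gb k) b" for k
    unfolding gb_def using Q.bond_words mono(1) by (simp add: less_imp_le)
  then obtain gw where gw: "\<And>k. ?YY (l (Suc k)) (l k) (gb k) (gw k)" by metis
  have UD: "concat (map (U k) (D (Suc k) a)) = fw k a" if "a < nX (m (Suc k))" for k a
  proof -
    obtain \<rho> where \<rho>: "0 \<le> \<rho>" "\<And>y. y \<in> topspace X \<Longrightarrow> p (m (Suc k)) y = xs (m (Suc k)) \<Longrightarrow> \<rho> < Re (?clY (l (Suc k)) y)"
      "\<And>y. y \<in> topspace X \<Longrightarrow> \<rho> < Re (?clY (l (Suc k)) y) \<Longrightarrow> 0 < Re (?clX (m k) y)"
      using hoU[of k] unfolding handover_def by blast
    show ?thesis
      by (rule transcribes_compose[OF P.projection Q.projection P.projection D(1) U(1) \<rho> fw _ that])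
        (use P.bond_r' mono in \<open>auto simp: fb_def less_imp_le\<close>)
  qed
  have DU: "concat (map (D k) (U k b)) = gw k b" if "b < nY (l (Suc k))" for k b
  proof -
    obtain \<rho> where \<rho>: "0 \<le> \<rho>" "\<And>y. y \<in> topspace X \<Longrightarrow> q (l (Suc k)) y = ys (l (Suc k)) \<Longrightarrow> \<rho> < Re (?clX (m k) y)"
      "\<And>y. y \<in> topspace X \<Longrightarrow> \<rho> < Re (?clX (m k) y) \<Longrightarrow> 0 < Re (?clY (l k) y)"
      using hoD[of k] unfolding handover_def by blast
    show ?thesis
      by (rule transcribes_compose[OF Q.projection P.projection Q.projection U(1) D(1) \<rho> gw _ that])
        (use Q.bond_r' mono in \<open>auto simp: gb_def less_imp_le\<close>)
  qed
  \<comment> \<open>Rounding could make a transcribed word empty; but substituting into it yields a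
    word of a bonding map, which is nonempty.\<close>
  have Dne: "D (Suc k) a \<noteq> []" if a: "a < nX (m (Suc k))" for k a
  proof
    assume "D (Suc k) a = []"
    then show False using UD[OF a] fw[of k] a by (auto simp: follows_words_def)
  qed
  have Une: "U k b \<noteq> []" if b: "b < nY (l (Suc k))" for k b
  proof
    assume "U k b = []"
    then show False using DU[OF b] gw[of k] b by (auto simp: follows_words_def)
  qed
  have "\<exists>F. ?XY (m (Suc k)) (l (Suc k)) F (D (Suc k))" for k
    by (rule follows_words_exists[where v="D (Suc k)", OF P.wedges Q.wedges Dne D(2)]) blast+
  then have "\<forall>k. \<exists>F. ?XY (m (Suc k)) (l (Suc k)) F (D (Suc k))" by blast
  from choice[OF this] obtain FD where FD: "\<And>k. ?XY (m (Suc k)) (l (Suc k)) (FD k) (D (Suc k))" by blast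
  have "\<exists>F. ?YX (l (Suc k)) (m k) F (U k)" for k
    by (rule follows_words_exists[where v="U k", OF Q.wedges P.wedges Une U(2)]) blast+
  then have "\<forall>k. \<exists>F. ?YX (l (Suc k)) (m k) F (U k)" by blast
  from choice[OF this] obtain FU where FU: "\<And>k. ?YX (l (Suc k)) (m k) (FU k) (U k)" by blast
  define d where "d k = pi1_map (Ys (l (Suc k))) (ys (l (Suc k))) (FD k)" for k
  define u where "u k = pi1_map (Xs (m (Suc k))) (xs (m (Suc k))) (FU (Suc k))" for k
  show ?thesis
    unfolding iso_inverse_seq_def
  proof (rule exI[of _ "\<lambda>k. m (Suc k)"], rule exI[of _ "\<lambda>k. l (Suc k)"], rule exI[of _ d], rule exI[of _ u],
      intro conjI allI ballI)
    show "strict_mono (\<lambda>k. m (Suc k))" "strict_mono (\<lambda>k. l (Suc k))" using mono by (auto intro: strict_monoI_Suc)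
    show "positive_hom (Pi_groups Xs xs (m (Suc k))) (Pi_gens Xs xs nX cX (m (Suc k)))
        (Pi_groups Ys ys (l (Suc k))) (Pi_gens Ys ys nY cY (l (Suc k))) (d k)" for k
      unfolding Pi_groups_def Pi_gens_def d_def
      by (rule wedge.follows_words_positive_hom[OF Q.wedges P.wedges FD])
    show "positive_hom (Pi_groups Ys ys (l (Suc (Suc k)))) (Pi_gens Ys ys nY cY (l (Suc (Suc k))))
        (Pi_groups Xs xs (m (Suc k))) (Pi_gens Xs xs nX cX (m (Suc k))) (u k)" for k
      unfolding Pi_groups_def Pi_gens_def u_def
      by (rule wedge.follows_words_positive_hom[OF P.wedges Q.wedges FU])
  next
    fix k A assume "A \<in> carrier (Pi_groups Xs xs (m (Suc (Suc k))))"
    then obtain \<gamma> where \<gamma>: "loopin (Xs (m (Suc (Suc k)))) (xs (m (Suc (Suc k)))) \<gamma>"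
      "A = loop_class (Xs (m (Suc (Suc k)))) (xs (m (Suc (Suc k)))) \<gamma>"
      unfolding Pi_groups_def fundamental_group_carrier by blast
    show "u k (d (Suc k) A) = hcomp (Pi_maps Xs xs f) (m (Suc k)) (m (Suc (Suc k)) - m (Suc k)) A"
      unfolding u_def d_def \<gamma>(2) P.hcomp_class'[OF less_imp_le[OF mono(2)] \<gamma>(1)]
      using pi1_map_factor[OF P.wedges Q.wedges P.wedges FD FU fw UD \<gamma>(1)] unfolding fb_def .
  next
    fix k B assume "B \<in> carrier (Pi_groups Ys ys (l (Suc (Suc k))))"
    then obtain \<gamma> where \<gamma>: "loopin (Ys (l (Suc (Suc k)))) (ys (l (Suc (Suc k)))) \<gamma>"
      "B = loop_class (Ys (l (Suc (Suc k)))) (ys (l (Suc (Suc k)))) \<gamma>"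
      unfolding Pi_groups_def fundamental_group_carrier by blast
    show "d k (u k B) = hcomp (Pi_maps Ys ys g) (l (Suc k)) (l (Suc (Suc k)) - l (Suc k)) B"
      unfolding u_def d_def \<gamma>(2) Q.hcomp_class'[OF less_imp_le[OF mono(1)] \<gamma>(1)]
      using pi1_map_factor[OF Q.wedges P.wedges Q.wedges FU FD gw DU \<gamma>(1)] unfolding gb_def .
  qed
qed

section \<open>From isomorphic sequences to flow equivalences\<close>

lemma (in wedge) circ_separates:
  assumes y: "y \<in> topspace W" "y' \<in> topspace W" and eq: "\<And>k. k < n \<Longrightarrow> circ c n k y = circ c n k y'"
  shows "y = y'"
proof -
  obtain a s where a: "a < n" "0 \<le> s" "s < 1" "y = c a s" using y(1) by (rule wedge_cases)
  obtain b s' where b: "b < n" "0 \<le> s'" "s' < 1" "y' = c b s'" using y(2) by (rule wedge_cases)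
  have int: "x = x'" if e: "cis (2 * pi * x) = cis (2 * pi * x')" and r: "0 \<le> x" "x < 1" "0 \<le> x'" "x' < 1" for x x'
  proof -
    obtain i :: int where i: "x = x' + of_int i" using e unfolding cis_2pi_eq_iff by blast
    then have "\<bar>real_of_int i\<bar> < 1" using r by linarith
    then have "i = 0" by linarith
    then show ?thesis using i by simp
  qed
  have A: "cis (2 * pi * s) = (if b = a then cis (2 * pi * s') else 1)"
    using eq[OF a(1)] a b circ_c[of a s a] circ_c[of b s' a] by simp
  have B: "(if a = b then cis (2 * pi * s) else 1) = cis (2 * pi * s')"
    using eq[OF b(1)] a b circ_c[of a s b] circ_c[of b s' b] by simp
  show ?thesis
  proof (cases "a = b")
    case True
    then show ?thesis using A int[of s s'] a b by simp
  next
    case False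
    then have "s = 0" "s' = 0" using A B int[of s 0] int[of s' 0] a b by auto
    then show ?thesis using a b c_0 by simp
  qed
qed

text \<open>It suffices to see growth to the right of each time. For a short while after
  \<open>t\<close> the curve stays on one circle, even if \<open>t\<close> is a passage, and there
  the clock is lifted by a composite of two increasing functions.\<close>

lemma clock_lift_follows_words:
  assumes W': "wedge W' w' n' c'" and W: "wedge W w n c" and E: "follows_words n' c' n c E v"
    and run: "runs_along c' n' \<gamma> \<kappa> \<Theta>"
  obtains \<Xi> where "clock_lift (\<lambda>t. clock c n (E (\<gamma> t))) \<Xi>"
proof -
  interpret W': wedge W' w' n' c' by fact
  interpret W: wedge W w n c by fact
  have \<Theta>: "continuous_on UNIV \<Theta>" "strict_mono \<Theta>" and \<kappa>: "\<And>i. \<kappa> i < n'" and \<gamma>: "\<And>t. \<gamma> t = wcurve c' \<kappa> (\<Theta> t)"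
    using run by (auto simp: runs_along_def)
  have Ec: "continuous_map W' W E" using W.follows_words_cont[OF W' E] by blast
  have gc: "continuous_map euclideanreal W' \<gamma>"
    unfolding \<gamma> by (rule W'.wcurve_comp_cont[OF \<kappa>]) (use \<Theta> in auto)
  have cont: "continuous_on UNIV (\<lambda>t. clock c n (E (\<gamma> t)))"
    using continuous_map_compose[OF gc continuous_map_compose[OF Ec W.clock_cont]] by (simp add: o_def)
  have in': "E (\<gamma> t) \<in> topspace W" for t using gc Ec by (auto simp: continuous_map_def Pi_iff)
  obtain \<Xi> where \<Xi>: "continuous_on UNIV \<Xi>" "\<And>t. t \<in> UNIV \<Longrightarrow> clock c n (E (\<gamma> t)) = cis (2 * pi * \<Xi> t)"
    by (rule circle_lift[OF convex_UNIV cont]) (use W.norm_clock in' in auto)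
  have "strict_mono_on UNIV \<Xi>"
  proof (rule strict_mono_on_of_right_increasing[OF convex_UNIV \<Xi>(1)])
    fix t :: real
    define i where "i = \<lfloor>\<Theta> t\<rfloor>"
    have i: "of_int i \<le> \<Theta> t" "\<Theta> t < of_int i + 1" unfolding i_def by linarith+
    obtain \<Phi> where \<Phi>: "set (v (\<kappa> i)) \<subseteq> {..<n}" "continuous_on {0..1} \<Phi>" "strict_mono_on {0..1} \<Phi>"
      "\<And>s. s \<in> {0..1} \<Longrightarrow> E (c' (\<kappa> i) s) = wcurve c (word_ext (v (\<kappa> i))) (\<Phi> s)"
      by (rule follows_wordsE[OF E \<kappa>[of i]]) blast
    have "0 < of_int i + 1 - \<Theta> t" using i by simp
    then obtain e where e: "e > 0" "\<And>t'. dist t' t < e \<Longrightarrow> dist (\<Theta> t') (\<Theta> t) < of_int i + 1 - \<Theta> t"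
      using \<Theta>(1) unfolding continuous_on_iff by (meson UNIV_I)
    define d where "d = e / 2"
    have d: "d > 0" using e by (simp add: d_def)
    have ran: "\<Theta> t' - of_int i \<in> {0..1}" if "t' \<in> {t..t + d}" for t'
      using e(2)[of t'] that i d strict_mono_less_eq[OF \<Theta>(2), of t t'] by (auto simp: dist_real_def d_def)
    have cl: "cis (2 * pi * \<Xi> t') = cis (2 * pi * \<Phi> (\<Theta> t' - of_int i))" if t': "t' \<in> {t..t + d}" for t'
    proof -
      have "\<gamma> t' = c' (\<kappa> i) (\<Theta> t' - of_int i)"
        using W'.wcurve_piece[of \<kappa> i "\<Theta> t'"] \<kappa> ran[OF t'] \<gamma> by auto
      then show ?thesis
        using \<Xi>(2)[of t'] \<Phi>(4)[OF ran[OF t']] W.wcurve_clock[OF W.word_ext_less[OF \<Phi>(1)]] by simp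
    qed
    obtain N :: int where N: "\<And>t'. t' \<in> {t..t + d} \<Longrightarrow> \<Xi> t' = \<Phi> (\<Theta> t' - of_int i) + of_int N"
    proof (rule circle_lift_unique[of "{t..t + d}" \<Xi> "\<lambda>t'. \<Phi> (\<Theta> t' - of_int i)"])
      show "continuous_on {t..t + d} (\<lambda>t'. \<Phi> (\<Theta> t' - of_int i))"
        by (rule continuous_on_compose2[OF \<Phi>(2)]) (use ran in \<open>auto intro!: continuous_intros continuous_on_subset[OF \<Theta>(1)]\<close>)
    qed (use cl \<Xi>(1) in \<open>auto intro: continuous_on_subset\<close>)
    have "\<Xi> t < \<Xi> t'" if "t < t'" "t' \<le> t + d" for t'
    proof -
      have I: "t \<in> {t..t + d}" "t' \<in> {t..t + d}" using that d by auto
      have "\<Phi> (\<Theta> t - of_int i) < \<Phi> (\<Theta> t' - of_int i)"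
        using strict_mono_onD[OF \<Phi>(3) ran[OF I(1)] ran[OF I(2)]] strict_monoD[OF \<Theta>(2) that(1)] by simp
      then show ?thesis using N[OF I(1)] N[OF I(2)] by simp
    qed
    then show "\<exists>e>0. \<forall>t'\<in>UNIV. t < t' \<and> t' \<le> t + e \<longrightarrow> \<Xi> t < \<Xi> t'" using d by blast
  qed
  then have "clock_lift (\<lambda>t. clock c n (E (\<gamma> t))) \<Xi>" unfolding clock_lift_def using \<Xi> by blast
  then show thesis by (rule that)
qed

text \<open>On one circle the points of the fibre have lifts that differ by integers and stay
  between 0 and the length of the word; the lift is injective.\<close>

lemma finite_clock_fibre:
  assumes W': "wedge W' w' n' c'" and W: "wedge W w n c" and G: "follows_words n' c' n c G v"
  shows "finite {y \<in> topspace W'. clock c n (G y) = z}"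
proof -
  interpret W': wedge W' w' n' c' by fact
  interpret W: wedge W w n c by fact
  have fin: "finite {s \<in> {0..1}. clock c n (G (c' a s)) = z}" if a: "a < n'" for a
  proof -
    obtain \<Phi> where \<Phi>: "set (v a) \<subseteq> {..<n}" "strict_mono_on {0..1} \<Phi>" "\<Phi> 0 = 0" "\<Phi> 1 = real (length (v a))"
      "\<And>s. s \<in> {0..1} \<Longrightarrow> G (c' a s) = wcurve c (word_ext (v a)) (\<Phi> s)"
      by (rule follows_wordsE[OF G a]) blast
    define S where "S = {s \<in> {0..1}. clock c n (G (c' a s)) = z}"
    have cl: "cis (2 * pi * \<Phi> s) = z" if "s \<in> S" for s
      using that \<Phi>(5)[of s] W.wcurve_clock[OF W.word_ext_less[OF \<Phi>(1)]] by (simp add: S_def)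
    have ran: "0 \<le> \<Phi> s \<and> \<Phi> s \<le> real (length (v a))" if "s \<in> S" for s
      using strict_mono_on_leD[OF \<Phi>(2), of 0 s] strict_mono_on_leD[OF \<Phi>(2), of s 1] that \<Phi>(3,4) by (auto simp: S_def)
    have "finite (\<Phi> ` S)"
    proof (cases "S = {}")
      case False
      then obtain s0 where s0: "s0 \<in> S" by blast
      have "\<Phi> ` S \<subseteq> (\<lambda>i::int. \<Phi> s0 + of_int i) ` {- int (length (v a))..int (length (v a))}"
      proof
        fix y assume "y \<in> \<Phi> ` S"
        then obtain s where s: "s \<in> S" "y = \<Phi> s" by blast
        have "cis (2 * pi * \<Phi> s) = cis (2 * pi * \<Phi> s0)" using cl[OF s(1)] cl[OF s0] by simp
        then obtain i :: int where i: "\<Phi> s = \<Phi> s0 + of_int i" unfolding cis_2pi_eq_iff by blast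
        then have "\<bar>real_of_int i\<bar> \<le> real (length (v a))" using ran[OF s(1)] ran[OF s0] by linarith
        then have "\<bar>i\<bar> \<le> int (length (v a))" by linarith
        then have "i \<in> {- int (length (v a))..int (length (v a))}" by (auto simp: abs_le_iff)
        then show "y \<in> (\<lambda>i::int. \<Phi> s0 + of_int i) ` {- int (length (v a))..int (length (v a))}" using i s by blast
      qed
      then show ?thesis using finite_subset by blast
    qed simp
    moreover have "inj_on \<Phi> S"
      using strict_mono_on_imp_inj_on[OF \<Phi>(2)] by (rule inj_on_subset) (auto simp: S_def)
    ultimately show ?thesis using finite_imageD unfolding S_def by blast
  qed
  have "{y \<in> topspace W'. clock c n (G y) = z} \<subseteq> (\<Union>a\<in>{..<n'}. c' a ` {s \<in> {0..1}. clock c n (G (c' a s)) = z})"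
    unfolding W'.topW by auto
  then show ?thesis by (rule finite_subset) (use fin in auto)
qed

text \<open>At every stage above \<open>l\<close> the curve takes finitely many values, so by
  connectedness its collapses are constant, and they determine the point. The higher stages separate
  the points of \<open>X\<close>.\<close>

lemma (in tower) fibre_curve_constant:
  assumes B: "continuous_map euclideanreal X B"
    and const: "\<And>t. clock (c l) (n l) (r l (B t)) = clock (c l) (n l) (r l (B 0))"
  shows "B t = B 0"
proof -
  have Bin: "B s \<in> topspace X" for s using B by (auto simp: continuous_map_def)
  show ?thesis
  proof (rule separating_cofinal[OF Bin Bin, of "\<lambda>j. l + j"])
    fix j
    interpret W': wedge "Ws (l + j)" "ws (l + j)" "n (l + j)" "c (l + j)" by (rule wedges)
    obtain u where u: "follows_words (n (l + j)) (c (l + j)) (n l) (c l) (bond f l j) u"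
      using bond_words[of l "l + j"] by auto
    define P where "P = {y \<in> topspace (Ws (l + j)). clock (c l) (n l) (bond f l j y) = clock (c l) (n l) (r l (B 0))}"
    have fin: "finite P" unfolding P_def by (rule finite_clock_fibre[OF wedges wedges u])
    have P: "r (l + j) (B s) \<in> P" for s
      using const[of s] r_in[OF Bin] bond_r[OF Bin] by (simp add: P_def)
    have "circ (c (l + j)) (n (l + j)) k (r (l + j) (B t)) = circ (c (l + j)) (n (l + j)) k (r (l + j) (B 0))" for k
    proof -
      have "continuous_on UNIV (\<lambda>s. circ (c (l + j)) (n (l + j)) k (r (l + j) (B s)))"
        using continuous_map_compose[OF B continuous_map_compose[OF r_cont W'.circ_cont]] by (simp add: o_def)
      moreover have "finite ((\<lambda>s. circ (c (l + j)) (n (l + j)) k (r (l + j) (B s))) ` UNIV)"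
        by (rule finite_subset[OF _ finite_imageI[OF fin, of "circ (c (l + j)) (n (l + j)) k"]]) (use P in auto)
      ultimately have "(\<lambda>s. circ (c (l + j)) (n (l + j)) k (r (l + j) (B s))) constant_on UNIV"
        by (rule continuous_finite_range_constant[OF connected_UNIV])
      then show ?thesis unfolding constant_on_def by (metis UNIV_I)
    qed
    then show "r (l + j) (B t) = r (l + j) (B 0)" by (intro W'.circ_separates r_in Bin)
  qed simp
qed

text \<open>The universal property of the inverse limit, for maps given on a cofinal subsequence of
  stages.\<close>

lemma (in tower) map_into_limit:
  assumes lim: "homeomorphic_map X (subtopology (product_topology Ws UNIV)
       {z. \<forall>i. z i \<in> topspace (Ws i) \<and> z i = f i (z (Suc i))}) (\<lambda>x i. r i x)"
    and L: "strict_mono L" and \<zeta>: "\<And>k. continuous_map Z (Ws (L k)) (\<zeta> k)"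
    and coh: "\<And>k z. z \<in> topspace Z \<Longrightarrow> \<zeta> k z = bond f (L k) (L (Suc k) - L k) (\<zeta> (Suc k) z)"
  obtains h where "continuous_map Z X h" "\<And>k z. z \<in> topspace Z \<Longrightarrow> r (L k) (h z) = \<zeta> k z"
proof -
  have Lge: "k \<le> L k" for k using L by (rule strict_mono_imp_increasing)
  have Lmono: "L k \<le> L k'" if "k \<le> k'" for k k' using strict_mono_mono[OF L] that by (rule monoD)
  have bond_trans: "bond f i (j - i) (bond f j (k - j) y) = bond f i (k - i) y" if "i \<le> j" "j \<le> k" for i j k y
    using bond_add[of f i "j - i" "k - j"] that by simp
  have far: "\<zeta> k z = bond f (L k) (L k' - L k) (\<zeta> k' z)" if z: "z \<in> topspace Z" and "k \<le> k'" for k k' z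
    using \<open>k \<le> k'\<close>
  proof (induction k' rule: dec_induct)
    case (step j)
    have "\<zeta> k z = bond f (L k) (L j - L k) (bond f (L j) (L (Suc j) - L j) (\<zeta> (Suc j) z))"
      using step.IH coh[OF z, of j] by simp
    then show ?case using bond_trans[OF Lmono[OF step(1)] Lmono[of j "Suc j"]] by simp
  qed simp
  \<comment> \<open>Stage \<open>i\<close> is reached by bonding down from stage \<open>L i\<close>,
    which is at least \<open>i\<close>; any later member of the family gives the same value.\<close>
  define \<xi> where "\<xi> z i = bond f i (L i - i) (\<zeta> i z)" for z i
  have \<xi>: "\<xi> z i = bond f i (L k - i) (\<zeta> k z)" if z: "z \<in> topspace Z" and "i \<le> k" for z i k
    unfolding \<xi>_def far[OF that] using bond_trans[OF Lge[of i] Lmono[OF \<open>i \<le> k\<close>]] by simp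
  have \<xi>L: "\<xi> z (L k) = \<zeta> k z" if z: "z \<in> topspace Z" for z k
    using \<xi>[OF z, of "L k" "L k"] far[OF z Lge[of k]] by simp
  have \<xi>c: "continuous_map Z (Ws i) (\<lambda>z. \<xi> z i)" for i
    using continuous_map_compose[OF \<zeta>[of i] bond_cont[OF Lge[of i]]] by (simp add: \<xi>_def o_def)
  have \<xi>f: "\<xi> z i = f i (\<xi> z (Suc i))" if z: "z \<in> topspace Z" for z i
  proof -
    have "L (Suc i) - i = Suc (L (Suc i) - Suc i)" using Lge[of "Suc i"] by simp
    then have "\<xi> z i = bond f i (Suc (L (Suc i) - Suc i)) (\<zeta> (Suc i) z)" using \<xi>[OF z, of i "Suc i"] by simp
    also have "\<dots> = f i (\<xi> z (Suc i))" unfolding bond_Suc_left \<xi>_def by simp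
    finally show ?thesis .
  qed
  define T where "T = subtopology (product_topology Ws UNIV) {z. \<forall>i. z i \<in> topspace (Ws i) \<and> z i = f i (z (Suc i))}"
  have \<xi>in: "\<xi> z i \<in> topspace (Ws i)" if "z \<in> topspace Z" for z i using \<xi>c[of i] that by (auto simp: continuous_map_def)
  have \<xi>T: "continuous_map Z T \<xi>"
    unfolding T_def continuous_map_in_subtopology
  proof
    have "\<xi> = (\<lambda>z i. \<xi> z i)" by simp
    then show "continuous_map Z (product_topology Ws UNIV) \<xi>" using \<xi>c by (simp add: continuous_map_componentwise_UNIV)
    show "\<xi> \<in> topspace Z \<rightarrow> {z. \<forall>i. z i \<in> topspace (Ws i) \<and> z i = f i (z (Suc i))}"
      using \<xi>in \<xi>f by blast
  qed
  obtain H where H: "homeomorphic_maps X T (\<lambda>x i. r i x) H"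
    using lim unfolding T_def homeomorphic_map_maps by blast
  have "continuous_map Z X (H \<circ> \<xi>)"
    by (rule continuous_map_compose[OF \<xi>T]) (use H in \<open>simp add: homeomorphic_maps_def\<close>)
  moreover have "r (L k) ((H \<circ> \<xi>) z) = \<zeta> k z" if z: "z \<in> topspace Z" for z k
  proof -
    have "\<xi> z \<in> topspace T" using \<xi>T z by (auto simp: continuous_map_def)
    then have "(\<lambda>i. r i (H (\<xi> z))) = \<xi> z" using H by (simp add: homeomorphic_maps_def)
    then have "r (L k) (H (\<xi> z)) = \<xi> z (L k)" by (rule fun_cong)
    then show ?thesis using \<xi>L[OF z] by simp
  qed
  ultimately show thesis by (rule that)
qed

text \<open>The two sides of the ladder induce mutually inverse maps of the limits. For orbits and
  their direction a single clock is enough, that of stage \<open>L 0\<close> of \<open>Y\<close>,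
  since curves in its fibres are constant.\<close>

lemma ladder_imp_flow_equivalence:
  assumes P: "tower X \<phi> Xs xs nX cX f p x0 v" and Q: "tower Y \<psi> Ys ys nY cY g q y0 v'"
    and limX: "homeomorphic_map X (subtopology (product_topology Xs UNIV)
       {z. \<forall>i. z i \<in> topspace (Xs i) \<and> z i = f i (z (Suc i))}) (\<lambda>x i. p i x)"
    and limY: "homeomorphic_map Y (subtopology (product_topology Ys UNIV)
       {z. \<forall>i. z i \<in> topspace (Ys i) \<and> z i = g i (z (Suc i))}) (\<lambda>x i. q i x)"
    and M: "strict_mono M" and L: "strict_mono L"
    and E: "\<And>k. follows_words (nX (M k)) (cX (M k)) (nY (L k)) (cY (L k)) (E k) (e k)"
    and V: "\<And>k. follows_words (nY (L (Suc k))) (cY (L (Suc k))) (nX (M k)) (cX (M k)) (V k) (e' k)"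
    and VE: "\<And>k x. x \<in> topspace (Xs (M (Suc k))) \<Longrightarrow> V k (E (Suc k) x) = bond f (M k) (M (Suc k) - M k) x"
    and EV: "\<And>k y. y \<in> topspace (Ys (L (Suc k))) \<Longrightarrow> E k (V k y) = bond g (L k) (L (Suc k) - L k) y"
  shows "\<exists>h. flow_equivalence X \<phi> Y \<psi> h \<and> h x0 = y0"
proof -
  interpret P: tower X \<phi> Xs xs nX cX f p x0 v by fact
  interpret Q: tower Y \<psi> Ys ys nY cY g q y0 v' by fact
  have Mge: "k \<le> M k" and Lge: "k \<le> L k" for k using M L by (auto intro: strict_mono_imp_increasing)
  have Mle: "M k \<le> M (Suc k)" and Lle: "L k \<le> L (Suc k)" for k
    using strict_monoD[OF M, of k "Suc k"] strict_monoD[OF L, of k "Suc k"] by auto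
  have Ec: "continuous_map (Xs (M k)) (Ys (L k)) (E k)" "E k (xs (M k)) = ys (L k)" for k
    using wedge.follows_words_cont[OF Q.wedges P.wedges E] by auto
  have Vc: "continuous_map (Ys (L (Suc k))) (Xs (M k)) (V k)" for k
    using wedge.follows_words_cont[OF P.wedges Q.wedges V] by auto
  have Ep: "E k (p (M k) x) = bond g (L k) (L (Suc k) - L k) (E (Suc k) (p (M (Suc k)) x))" if x: "x \<in> topspace X" for x k
  proof -
    have "E (Suc k) (p (M (Suc k)) x) \<in> topspace (Ys (L (Suc k)))"
      using Ec(1)[of "Suc k"] P.r_in[OF x, of "M (Suc k)"] by (auto simp: continuous_map_def)
    then show ?thesis
      using EV VE[OF P.r_in[OF x], of k] P.bond_r'[OF x Mle[of k]] by metis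
  qed
  obtain h where h: "continuous_map X Y h" "\<And>k x. x \<in> topspace X \<Longrightarrow> q (L k) (h x) = E k (p (M k) x)"
  proof (rule Q.map_into_limit[OF limY L, of X "\<lambda>k x. E k (p (M k) x)"])
    show "continuous_map X (Ys (L k)) (\<lambda>x. E k (p (M k) x))" for k
      using continuous_map_compose[OF P.r_cont Ec(1)] by (simp add: o_def)
    show "E k (p (M k) x) = bond g (L k) (L (Suc k) - L k) (E (Suc k) (p (M (Suc k)) x))" if "x \<in> topspace X" for k x
      by (rule Ep[OF that])
  qed (rule that)
  have Vq: "V k (q (L (Suc k)) y) = bond f (M k) (M (Suc k) - M k) (V (Suc k) (q (L (Suc (Suc k))) y))" if y: "y \<in> topspace Y" for y k
  proof -
    have "V (Suc k) (q (L (Suc (Suc k))) y) \<in> topspace (Xs (M (Suc k)))"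
      using Vc[of "Suc k"] Q.r_in[OF y, of "L (Suc (Suc k))"] by (auto simp: continuous_map_def)
    from VE[OF this] show ?thesis
      unfolding EV[OF Q.r_in[OF y]] Q.bond_r'[OF y Lle[of "Suc k"]] .
  qed
  obtain h' where h': "continuous_map Y X h'" "\<And>k y. y \<in> topspace Y \<Longrightarrow> p (M k) (h' y) = V k (q (L (Suc k)) y)"
  proof (rule P.map_into_limit[OF limX M, of Y "\<lambda>k y. V k (q (L (Suc k)) y)"])
    show "continuous_map Y (Xs (M k)) (\<lambda>y. V k (q (L (Suc k)) y))" for k
      using continuous_map_compose[OF Q.r_cont Vc] by (simp add: o_def)
    show "V k (q (L (Suc k)) y) = bond f (M k) (M (Suc k) - M k) (V (Suc k) (q (L (Suc (Suc k))) y))" if "y \<in> topspace Y" for k y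
      by (rule Vq[OF that])
  qed (rule that)
  have hin: "h x \<in> topspace Y" if "x \<in> topspace X" for x using h(1) that by (auto simp: continuous_map_def)
  have hin': "h' y \<in> topspace X" if "y \<in> topspace Y" for y using h'(1) that by (auto simp: continuous_map_def)
  have h'h: "h' (h x) = x" if x: "x \<in> topspace X" for x
  proof (rule P.separating_cofinal[OF hin'[OF hin[OF x]] x Mge])
    fix k show "p (M k) (h' (h x)) = p (M k) x"
      using h'(2)[OF hin[OF x]] h(2)[OF x] VE[OF P.r_in[OF x]] P.bond_r'[OF x Mle] by simp
  qed
  have hh': "h (h' y) = y" if y: "y \<in> topspace Y" for y
  proof (rule Q.separating_cofinal[OF hin[OF hin'[OF y]] y Lge])
    fix k show "q (L k) (h (h' y)) = q (L k) y"
      using h(2)[OF hin'[OF y]] h'(2)[OF y] EV[OF Q.r_in[OF y]] Q.bond_r'[OF y Lle] by simp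
  qed
  have "homeomorphic_maps X Y h h'"
    using h(1) h'(1) h'h hh' by (simp add: homeomorphic_maps_def)
  then have hm: "homeomorphic_map X Y h" using homeomorphic_map_maps by blast
  have hx0: "h x0 = y0"
    by (rule Q.separating_cofinal[OF hin[OF P.x0_in] Q.x0_in Lge]) (simp add: h(2) P.x0_in P.r_x0 Q.r_x0 Ec)
  define F where "F y = clock (cY (L 0)) (nY (L 0)) (q (L 0) y)" for y
  interpret WY: wedge "Ys (L 0)" "ys (L 0)" "nY (L 0)" "cY (L 0)" by (rule Q.wedges)
  have F: "continuous_map Y euclidean F"
    using continuous_map_compose[OF Q.r_cont WY.clock_cont] by (simp add: F_def[abs_def] o_def)
  have liftsY: "\<exists>\<Theta>. clock_lift (\<lambda>t. F (\<psi> t y)) \<Theta>" if y: "y \<in> topspace Y" for y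
  proof -
    obtain \<kappa> \<Theta> where "runs_along (cY (L 0)) (nY (L 0)) (\<lambda>t. q (L 0) (\<psi> t y)) \<kappa> \<Theta>"
      using positive_projection.r_runs[OF Q.projection y] by blast
    then show ?thesis
      using WY.wcurve_clock by (intro exI[of _ \<Theta>]) (auto simp: clock_lift_def runs_along_def F_def)
  qed
  have Fh: "continuous_map X euclidean (\<lambda>x. F (h x))" using continuous_map_compose[OF h(1) F] by (simp add: o_def)
  \<comment> \<open>At stage \<open>L 0\<close> the image of an orbit is \<open>E 0\<close> applied
    to its projection, so its clock advances because \<open>E 0\<close> follows words. This makes
    \<open>F\<close> after \<open>h\<close> a clock on \<open>X\<close>, and the compactness
    argument in \<open>X\<close> shows that its lifts are surjective.\<close>
  have liftsX: "\<exists>\<Theta>. clock_lift (\<lambda>t. F (h (\<phi> t x))) \<Theta>" if x: "x \<in> topspace X" for x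
  proof -
    obtain \<kappa> \<Theta> where run: "runs_along (cX (M 0)) (nX (M 0)) (\<lambda>t. p (M 0) (\<phi> t x)) \<kappa> \<Theta>"
      using positive_projection.r_runs[OF P.projection x] by blast
    obtain \<Xi> where "clock_lift (\<lambda>t. clock (cY (L 0)) (nY (L 0)) (E 0 (p (M 0) (\<phi> t x)))) \<Xi>"
      by (rule clock_lift_follows_words[OF P.wedges Q.wedges E run])
    then show ?thesis using h(2)[OF P.flow_in[OF x]] by (auto simp: F_def)
  qed
  have "\<exists>\<tau>. strict_mono \<tau> \<and> surj \<tau> \<and> (\<forall>t. h (\<phi> t x) = \<psi> (\<tau> t) (h x))" if x: "x \<in> topspace X" for x
  proof -
    obtain \<Theta> where \<Theta>: "clock_lift (\<lambda>t. F (h (\<phi> t x))) \<Theta>" using liftsX[OF x] by blast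
    have surj: "surj \<Theta>" by (rule P.clock_lift_surj[OF Fh liftsX x \<Theta>])
    have A: "continuous_map euclideanreal Y (\<lambda>t. h (\<phi> t x))"
      using continuous_map_compose[OF P.orbit_cont[OF x] h(1)] by (simp add: o_def)
    have fibre: "B t = B 0" if "continuous_map euclideanreal Y B" "\<And>t. F (B t) = F (B 0)" for B t
      by (rule Q.fibre_curve_constant[OF that(1)]) (use that(2) in \<open>simp add: F_def\<close>)
    obtain s where "strict_mono s" "surj s" "\<And>t. h (\<phi> t x) = \<psi> (s t) (h (\<phi> 0 x))"
      by (rule Q.curve_in_orbit_increasing[OF F liftsY fibre A \<Theta> surj]) (assumption+, rule that, assumption+)
    then show ?thesis using P.flow_0[OF x] by auto
  qed
  then have "flow_equivalence X \<phi> Y \<psi> h" using hm by (simp add: flow_equivalence_def)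
  then show ?thesis using hx0 by blast
qed

section \<open>From homomorphisms to words\<close>

lemma hom_on_words:
  assumes W': "wedge W' w' n' c'" and W: "wedge W w n c"
    and d: "d \<in> hom (fundamental_group W' w') (fundamental_group W w)"
    and \<delta>: "\<And>a. a < n' \<Longrightarrow> set (\<delta> a) \<subseteq> {..<n}" "\<And>a. a < n' \<Longrightarrow> d (loop_class W' w' (c' a)) = loop_class W w (wloop c (\<delta> a))"
    and u: "u \<noteq> []" "set u \<subseteq> {..<n'}"
  shows "d (loop_class W' w' (wloop c' u)) = loop_class W w (wloop c (concat (map \<delta> u)))"
  using u
proof (induction u rule: list_nonempty_induct)
  interpret W': wedge W' w' n' c' by fact
  interpret W: wedge W w n c by fact
  case (single a)
  then show ?case using \<delta>(2)[of a] W'.c_class[of a] by simp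
next
  interpret W': wedge W' w' n' c' by fact
  interpret W: wedge W w n c by fact
  case (cons a u)
  have au: "a < n'" "set u \<subseteq> {..<n'}" using cons.prems by auto
  have carr: "loop_class W' w' (wloop c' x) \<in> carrier (fundamental_group W' w')" if "set x \<subseteq> {..<n'}" for x
    unfolding fundamental_group_carrier using W'.wloop_loopin[OF that] by blast
  have sub: "set (concat (map \<delta> u)) \<subseteq> {..<n}" using \<delta>(1) au by fastforce
  have "loop_class W' w' (wloop c' (a # u)) =
      loop_class W' w' (wloop c' [a]) \<otimes>\<^bsub>fundamental_group W' w'\<^esub> loop_class W' w' (wloop c' u)"
    using W'.wloop_append_class[of "[a]" u] au by simp
  then have "d (loop_class W' w' (wloop c' (a # u))) =
      d (loop_class W' w' (wloop c' [a])) \<otimes>\<^bsub>fundamental_group W w\<^esub> d (loop_class W' w' (wloop c' u))"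
    using hom_mult[OF d carr[of "[a]"] carr[of u]] au by simp
  also have "\<dots> = loop_class W w (wloop c (\<delta> a @ concat (map \<delta> u)))"
    using cons.IH[OF au(2)] \<delta>[OF au(1)] W'.c_class[OF au(1)] W.wloop_append_class[OF \<delta>(1)[OF au(1)] sub] by simp
  finally show ?case by simp
qed

lemma positive_hom_words:
  assumes W': "wedge W' w' n' c'" and W: "wedge W w n c"
    and d: "positive_hom (fundamental_group W' w') (pos_generators W' w' n' c') (fundamental_group W w) (pos_generators W w n c) d"
  obtains \<delta> where "\<And>a. a < n' \<Longrightarrow> \<delta> a \<noteq> []" "\<And>a. a < n' \<Longrightarrow> set (\<delta> a) \<subseteq> {..<n}"
    "\<And>a. a < n' \<Longrightarrow> d (loop_class W' w' (c' a)) = loop_class W w (wloop c (\<delta> a))"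
proof -
  have "\<exists>x. x \<noteq> [] \<and> set x \<subseteq> {..<n} \<and> d (loop_class W' w' (c' a)) = loop_class W w (wloop c x)" if a: "a < n'" for a
  proof -
    have "loop_class W' w' (c' a) \<in> pos_semigroup (fundamental_group W' w') (pos_generators W' w' n' c')"
      using a by (auto simp: pos_generators_def intro: pos_semigroup.gen)
    then have "d (loop_class W' w' (c' a)) \<in> pos_semigroup (fundamental_group W w) (pos_generators W w n c)"
      using d unfolding positive_hom_def by blast
    then show ?thesis unfolding wedge.pos_semigroup_eq[OF W] by blast
  qed
  then have "\<forall>a. \<exists>x. a < n' \<longrightarrow> x \<noteq> [] \<and> set x \<subseteq> {..<n} \<and> d (loop_class W' w' (c' a)) = loop_class W w (wloop c x)" by blast
  from choice[OF this] show thesis using that by blast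
qed

text \<open>Both words represent the image of the generator \<open>a\<close>. As homotopic word
  loops have equal words, the equation between homomorphisms becomes an equation between words,
  which can be lifted exactly.\<close>

lemma hom_factor_words:
  assumes W3: "wedge W3 w3 n3 c3" and W2: "wedge W2 w2 n2 c2" and W1: "wedge W1 w1 n1 c1"
    and u: "u \<in> hom (fundamental_group W2 w2) (fundamental_group W1 w1)"
    and \<upsilon>: "\<And>b. b < n2 \<Longrightarrow> set (\<upsilon> b) \<subseteq> {..<n1}" "\<And>b. b < n2 \<Longrightarrow> u (loop_class W2 w2 (c2 b)) = loop_class W1 w1 (wloop c1 (\<upsilon> b))"
    and \<delta>: "\<delta> a \<noteq> []" "set (\<delta> a) \<subseteq> {..<n2}" "d (loop_class W3 w3 (c3 a)) = loop_class W2 w2 (wloop c2 (\<delta> a))"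
    and B: "follows_words n3 c3 n1 c1 B b" and a: "a < n3"
    and ud: "u (d (loop_class W3 w3 (c3 a))) = loop_class W1 w1 (B \<circ> c3 a)"
  shows "concat (map \<upsilon> (\<delta> a)) = b a"
proof -
  interpret W3: wedge W3 w3 n3 c3 by fact
  interpret W1: wedge W1 w1 n1 c1 by fact
  have Bc: "continuous_map W3 W1 B" "B w3 = w1" using W1.follows_words_cont[OF W3 B] by auto
  have s1: "set (concat (map \<upsilon> (\<delta> a))) \<subseteq> {..<n1}" using \<upsilon>(1) \<delta>(2) by fastforce
  have s2: "set (b a) \<subseteq> {..<n1}" using B a by (simp add: follows_words_def)
  have "loop_class W1 w1 (wloop c1 (concat (map \<upsilon> (\<delta> a)))) = u (d (loop_class W3 w3 (c3 a)))"
    unfolding \<delta>(3) by (rule hom_on_words[OF W2 W1 u \<upsilon> \<delta>(1,2), symmetric])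
  also have "\<dots> = pi1_map W1 w1 B (loop_class W3 w3 (wloop c3 [a]))"
    using ud pi1_map_class[OF W3.c_loopin[OF a] Bc] W3.c_class[OF a] by simp
  also have "\<dots> = loop_class W1 w1 (wloop c1 (b a))"
    using W1.follows_words_wloop_class[OF W3 B, of "[a]"] a by simp
  finally have "loop_homotopic W1 w1 (wloop c1 (concat (map \<upsilon> (\<delta> a)))) (wloop c1 (b a))"
    using loop_class_eq_iff[OF W1.wloop_loopin[OF s2]] by blast
  then show ?thesis by (rule W1.wloop_homotopic_imp_eq[OF s1 s2])
qed

text \<open>The homomorphisms determine words but not parametrisations. The first upward map is
  chosen freely among maps with the right words; every later map arises by lifting a bonding map
  through its predecessor, so all triangles commute exactly.\<close>

lemma isomorphic_imp_flow_equivalence: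
  assumes P: "tower X \<phi> Xs xs nX cX f p x0 v" and Q: "tower Y \<psi> Ys ys nY cY g q y0 v'"
    and limX: "homeomorphic_map X (subtopology (product_topology Xs UNIV)
       {z. \<forall>i. z i \<in> topspace (Xs i) \<and> z i = f i (z (Suc i))}) (\<lambda>x i. p i x)"
    and limY: "homeomorphic_map Y (subtopology (product_topology Ys UNIV)
       {z. \<forall>i. z i \<in> topspace (Ys i) \<and> z i = g i (z (Suc i))}) (\<lambda>x i. q i x)"
    and iso: "iso_inverse_seq (Pi_groups Xs xs) (Pi_gens Xs xs nX cX) (Pi_maps Xs xs f)
                         (Pi_groups Ys ys) (Pi_gens Ys ys nY cY) (Pi_maps Ys ys g)"
  shows "\<exists>h. flow_equivalence X \<phi> Y \<psi> h \<and> h x0 = y0"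
proof -
  interpret P: tower X \<phi> Xs xs nX cX f p x0 v by fact
  interpret Q: tower Y \<psi> Ys ys nY cY g q y0 v' by fact
  let ?XX = "\<lambda>i j. follows_words (nX i) (cX i) (nX j) (cX j)"
  let ?XY = "\<lambda>i j. follows_words (nX i) (cX i) (nY j) (cY j)"
  let ?YX = "\<lambda>i j. follows_words (nY i) (cY i) (nX j) (cX j)"
  let ?YY = "\<lambda>i j. follows_words (nY i) (cY i) (nY j) (cY j)"
  let ?GX = "\<lambda>i. fundamental_group (Xs i) (xs i)"
  let ?SX = "\<lambda>i. pos_generators (Xs i) (xs i) (nX i) (cX i)"
  let ?CX = "\<lambda>i. loop_class (Xs i) (xs i)"
  let ?GY = "\<lambda>i. fundamental_group (Ys i) (ys i)"
  let ?SY = "\<lambda>i. pos_generators (Ys i) (ys i) (nY i) (cY i)"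
  let ?CY = "\<lambda>i. loop_class (Ys i) (ys i)"
  obtain m l d u where m: "strict_mono m" and l: "strict_mono l"
    and d: "\<And>k. positive_hom (?GX (m k)) (?SX (m k))
       (?GY (l k)) (?SY (l k)) (d k)"
    and u: "\<And>k. positive_hom (?GY (l (Suc k))) (?SY (l (Suc k)))
       (?GX (m k)) (?SX (m k)) (u k)"
    and ud: "\<And>k A. A \<in> carrier (?GX (m (Suc k))) \<Longrightarrow>
       u k (d (Suc k) A) = hcomp (Pi_maps Xs xs f) (m k) (m (Suc k) - m k) A"
    and du: "\<And>k A. A \<in> carrier (?GY (l (Suc k))) \<Longrightarrow>
       d k (u k A) = hcomp (Pi_maps Ys ys g) (l k) (l (Suc k) - l k) A"
    using iso unfolding iso_inverse_seq_def Pi_groups_def Pi_gens_def by blast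
  have mle: "m k \<le> m (Suc k)" and lle: "l k \<le> l (Suc k)" for k
    using strict_monoD[OF m, of k "Suc k"] strict_monoD[OF l, of k "Suc k"] by auto
  have "\<exists>\<delta>. (\<forall>a<nX (m k). \<delta> a \<noteq> [] \<and> set (\<delta> a) \<subseteq> {..<nY (l k)} \<and>
      d k (?CX (m k) (cX (m k) a)) = ?CY (l k) (wloop (cY (l k)) (\<delta> a)))" for k
    by (rule positive_hom_words[OF P.wedges Q.wedges d]) blast
  then have "\<forall>k. \<exists>\<delta>. (\<forall>a<nX (m k). \<delta> a \<noteq> [] \<and> set (\<delta> a) \<subseteq> {..<nY (l k)} \<and>
      d k (?CX (m k) (cX (m k) a)) = ?CY (l k) (wloop (cY (l k)) (\<delta> a)))" by blast
  from choice[OF this] obtain \<delta> where \<delta>: "\<And>k a. a < nX (m k) \<Longrightarrow> \<delta> k a \<noteq> []" "\<And>k a. a < nX (m k) \<Longrightarrow> set (\<delta> k a) \<subseteq> {..<nY (l k)}"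
    "\<And>k a. a < nX (m k) \<Longrightarrow> d k (?CX (m k) (cX (m k) a)) = ?CY (l k) (wloop (cY (l k)) (\<delta> k a))"
    by blast
  have "\<exists>\<upsilon>. (\<forall>b<nY (l (Suc k)). \<upsilon> b \<noteq> [] \<and> set (\<upsilon> b) \<subseteq> {..<nX (m k)} \<and>
      u k (?CY (l (Suc k)) (cY (l (Suc k)) b)) = ?CX (m k) (wloop (cX (m k)) (\<upsilon> b)))" for k
    by (rule positive_hom_words[OF Q.wedges P.wedges u]) blast
  then have "\<forall>k. \<exists>\<upsilon>. (\<forall>b<nY (l (Suc k)). \<upsilon> b \<noteq> [] \<and> set (\<upsilon> b) \<subseteq> {..<nX (m k)} \<and>
      u k (?CY (l (Suc k)) (cY (l (Suc k)) b)) = ?CX (m k) (wloop (cX (m k)) (\<upsilon> b)))" by blast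
  from choice[OF this] obtain \<upsilon> where \<upsilon>: "\<And>k b. b < nY (l (Suc k)) \<Longrightarrow> \<upsilon> k b \<noteq> []" "\<And>k b. b < nY (l (Suc k)) \<Longrightarrow> set (\<upsilon> k b) \<subseteq> {..<nX (m k)}"
    "\<And>k b. b < nY (l (Suc k)) \<Longrightarrow> u k (?CY (l (Suc k)) (cY (l (Suc k)) b)) = ?CX (m k) (wloop (cX (m k)) (\<upsilon> k b))"
    by blast
  define fb where "fb k = bond f (m k) (m (Suc k) - m k)" for k
  define gb where "gb k = bond g (l k) (l (Suc k) - l k)" for k
  have "\<forall>k. \<exists>b. ?XX (m (Suc k)) (m k) (fb k) b"
    unfolding fb_def using P.bond_words mle by blast
  from choice[OF this] obtain fw where fw: "\<And>k. ?XX (m (Suc k)) (m k) (fb k) (fw k)" by blast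
  have "\<forall>k. \<exists>b. ?YY (l (Suc k)) (l k) (gb k) b"
    unfolding gb_def using Q.bond_words lle by blast
  from choice[OF this] obtain gw where gw: "\<And>k. ?YY (l (Suc k)) (l k) (gb k) (gw k)" by blast
  have dhom: "d k \<in> hom (?GX (m k)) (?GY (l k))" for k
    using d[of k] unfolding positive_hom_def by (rule conjunct1)
  have uhom: "u k \<in> hom (?GY (l (Suc k))) (?GX (m k))" for k
    using u[of k] unfolding positive_hom_def by (rule conjunct1)
  have UD: "concat (map (\<upsilon> k) (\<delta> (Suc k) a)) = fw k a" if a: "a < nX (m (Suc k))" for k a
  proof (rule hom_factor_words[where u="u k" and d="d (Suc k)" and B="fb k" and b="fw k" and \<upsilon>="\<upsilon> k" and \<delta>="\<delta> (Suc k)" and a=a, OF P.wedges Q.wedges P.wedges uhom \<upsilon>(2,3) \<delta>(1,2,3)[OF a] fw a])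
    have lo: "loopin (Xs (m (Suc k))) (xs (m (Suc k))) (cX (m (Suc k)) a)" by (rule wedge.c_loopin[OF P.wedges a])
    then have "?CX (m (Suc k)) (cX (m (Suc k)) a) \<in> carrier (?GX (m (Suc k)))"
      unfolding fundamental_group_carrier by blast
    from ud[OF this] P.hcomp_class'[OF mle lo]
    show "u k (d (Suc k) (?CX (m (Suc k)) (cX (m (Suc k)) a))) =
      ?CX (m k) (fb k \<circ> cX (m (Suc k)) a)" unfolding fb_def by (rule trans)
  qed
  have DU: "concat (map (\<delta> k) (\<upsilon> k b)) = gw k b" if b: "b < nY (l (Suc k))" for k b
  proof (rule hom_factor_words[where u="d k" and d="u k" and B="gb k" and b="gw k" and \<upsilon>="\<delta> k" and \<delta>="\<upsilon> k" and a=b, OF Q.wedges P.wedges Q.wedges dhom \<delta>(2,3) \<upsilon>(1,2,3)[OF b] gw b])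
    have lo: "loopin (Ys (l (Suc k))) (ys (l (Suc k))) (cY (l (Suc k)) b)" by (rule wedge.c_loopin[OF Q.wedges b])
    then have "?CY (l (Suc k)) (cY (l (Suc k)) b) \<in> carrier (?GY (l (Suc k)))"
      unfolding fundamental_group_carrier by blast
    from du[OF this] Q.hcomp_class'[OF lle lo]
    show "d k (u k (?CY (l (Suc k)) (cY (l (Suc k)) b))) =
      ?CY (l k) (gb k \<circ> cY (l (Suc k)) b)" unfolding gb_def by (rule trans)
  qed
  \<comment> \<open>A state is the pair of the map from \<open>Y\<close> to \<open>X\<close> and the
    map from \<open>X\<close> to \<open>Y\<close> lifted through it. \<open>good\<close> records the
    triangle over \<open>X\<close> inside a state, and \<open>next_to\<close> the triangle over
    \<open>Y\<close> between consecutive states.\<close>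
  define good where "good k s \<longleftrightarrow>
     ?YX (l (Suc k)) (m k) (fst s) (\<upsilon> k) \<and>
     ?XY (m (Suc k)) (l (Suc k)) (snd s) (\<delta> (Suc k)) \<and>
     (\<forall>x\<in>topspace (Xs (m (Suc k))). fst s (snd s x) = fb k x)" for k s
  define next_to where "next_to k s s' \<longleftrightarrow> (\<forall>y\<in>topspace (Ys (l (Suc (Suc k)))). snd s (fst s' y) = gb (Suc k) y)"
    for k and s s' :: "('d \<Rightarrow> 'b) \<times> ('b \<Rightarrow> 'd)"
  have complete: "\<exists>D. good k (U, D)"
    if U: "?YX (l (Suc k)) (m k) U (\<upsilon> k)" for k U
  proof -
    obtain D where "?XY (m (Suc k)) (l (Suc k)) D (\<delta> (Suc k))"
      "\<And>x. x \<in> topspace (Xs (m (Suc k))) \<Longrightarrow> U (D x) = fb k x"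
      using follows_words_lift[OF P.wedges Q.wedges P.wedges U fw \<delta>(1,2) UD] by blast
    then show ?thesis using U by (intro exI[of _ D]) (simp add: good_def)
  qed
  have "\<exists>s. \<forall>k. good k (s k) \<and> next_to k (s k) (s (Suc k))"
  proof (rule dependent_nat_choice)
    obtain U where "?YX (l (Suc 0)) (m 0) U (\<upsilon> 0)"
      using follows_words_exists[where v="\<upsilon> 0", OF Q.wedges P.wedges \<upsilon>(1,2)] by blast
    then show "\<exists>s. good 0 s" using complete by blast
  next
    fix s k assume s: "good k s"
    then have D: "?XY (m (Suc k)) (l (Suc k)) (snd s) (\<delta> (Suc k))"
      by (simp add: good_def)
    obtain U where U: "?YX (l (Suc (Suc k))) (m (Suc k)) U (\<upsilon> (Suc k))"
      "\<And>y. y \<in> topspace (Ys (l (Suc (Suc k)))) \<Longrightarrow> snd s (U y) = gb (Suc k) y"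
      using follows_words_lift[OF Q.wedges P.wedges Q.wedges D gw \<upsilon>(1,2) DU] by blast
    obtain D' where "good (Suc k) (U, D')" using complete[OF U(1)] by blast
    then show "\<exists>s'. good (Suc k) s' \<and> next_to k s s'" using U(2) by (intro exI[of _ "(U, D')"]) (simp add: next_to_def)
  qed
  then obtain s where s: "\<And>k. good k (s k)" "\<And>k. next_to k (s k) (s (Suc k))" by blast
  show ?thesis
  \<comment> \<open>The first map from \<open>X\<close> to \<open>Y\<close> obtained starts at stage
    \<open>m 1\<close>, so the ladder is shifted by one, and its maps from \<open>Y\<close> to
    \<open>X\<close> come from the following state.\<close>
  proof (rule ladder_imp_flow_equivalence[OF P Q limX limY, of "\<lambda>k. m (Suc k)" "\<lambda>k. l (Suc k)"
        "\<lambda>k. snd (s k)" "\<lambda>k. \<delta> (Suc k)" "\<lambda>k. fst (s (Suc k))" "\<lambda>k. \<upsilon> (Suc k)"])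
    show "strict_mono (\<lambda>k. m (Suc k))" "strict_mono (\<lambda>k. l (Suc k))"
      using m l by (auto simp: strict_mono_def)
  next
    fix k
    show "?XY (m (Suc k)) (l (Suc k)) (snd (s k)) (\<delta> (Suc k))"
      using s(1)[of k] by (simp add: good_def)
    show "?YX (l (Suc (Suc k))) (m (Suc k)) (fst (s (Suc k))) (\<upsilon> (Suc k))"
      using s(1)[of "Suc k"] by (simp add: good_def)
    show "fst (s (Suc k)) (snd (s (Suc k)) x) = bond f (m (Suc k)) (m (Suc (Suc k)) - m (Suc k)) x"
      if "x \<in> topspace (Xs (m (Suc (Suc k))))" for x
      using s(1)[of "Suc k"] that by (simp add: good_def fb_def)
    show "snd (s k) (fst (s (Suc k)) y) = bond g (l (Suc k)) (l (Suc (Suc k)) - l (Suc k)) y"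
      if "y \<in> topspace (Ys (l (Suc (Suc k))))" for y
      using s(2)[of k] that by (simp add: next_to_def gb_def)
  qed
qed

theorem theorem6p4:
  fixes X :: "'a topology" and \<phi> :: "real \<Rightarrow> 'a \<Rightarrow> 'a" and x0 :: 'a
    and Xs :: "nat \<Rightarrow> 'b topology" and xs :: "nat \<Rightarrow> 'b" and nX :: "nat \<Rightarrow> nat"
    and cX :: "nat \<Rightarrow> nat \<Rightarrow> real \<Rightarrow> 'b" and f :: "nat \<Rightarrow> 'b \<Rightarrow> 'b" and p :: "nat \<Rightarrow> 'a \<Rightarrow> 'b"
    and Y :: "'c topology" and \<psi> :: "real \<Rightarrow> 'c \<Rightarrow> 'c" and y0 :: 'c
    and Ys :: "nat \<Rightarrow> 'd topology" and ys :: "nat \<Rightarrow> 'd" and nY :: "nat \<Rightarrow> nat"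
    and cY :: "nat \<Rightarrow> nat \<Rightarrow> real \<Rightarrow> 'd" and g :: "nat \<Rightarrow> 'd \<Rightarrow> 'd" and q :: "nat \<Rightarrow> 'c \<Rightarrow> 'd"
  assumes "flow_space X \<phi>" and "flow_space Y \<psi>"
    and "expansion X \<phi> x0 Xs xs nX cX f p"
    and "expansion Y \<psi> y0 Ys ys nY cY g q"
  shows "(\<exists>h. flow_equivalence X \<phi> Y \<psi> h \<and> h x0 = y0) \<longleftrightarrow>
         iso_inverse_seq (Pi_groups Xs xs) (Pi_gens Xs xs nX cX) (Pi_maps Xs xs f)
                         (Pi_groups Ys ys) (Pi_gens Ys ys nY cY) (Pi_maps Ys ys g)"
proof -
  obtain v where P: "tower X \<phi> Xs xs nX cX f p x0 v" by (rule expansion_tower[OF assms(1,3)])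
  obtain v' where Q: "tower Y \<psi> Ys ys nY cY g q y0 v'" by (rule expansion_tower[OF assms(2,4)])
  have limX: "homeomorphic_map X (subtopology (product_topology Xs UNIV)
       {z. \<forall>i. z i \<in> topspace (Xs i) \<and> z i = f i (z (Suc i))}) (\<lambda>x i. p i x)"
    using assms(3) unfolding expansion_def by blast
  have limY: "homeomorphic_map Y (subtopology (product_topology Ys UNIV)
       {z. \<forall>i. z i \<in> topspace (Ys i) \<and> z i = g i (z (Suc i))}) (\<lambda>x i. q i x)"
    using assms(4) unfolding expansion_def by blast
  show ?thesis
  proof
    assume "\<exists>h. flow_equivalence X \<phi> Y \<psi> h \<and> h x0 = y0"
    then obtain h where h: "flow_equivalence X \<phi> Y \<psi> h" "h x0 = y0" by blast
    have fl: "compact_flow X \<phi>" and x0: "x0 \<in> topspace X" using P tower.x0_in[OF P] by (auto simp: tower_def)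
    show "iso_inverse_seq (Pi_groups Xs xs) (Pi_gens Xs xs nX cX) (Pi_maps Xs xs f)
                         (Pi_groups Ys ys) (Pi_gens Ys ys nY cY) (Pi_maps Ys ys g)"
      by (rule towers_over_flow_isomorphic[OF P tower_transfer[OF Q fl h x0]])
  qed (rule isomorphic_imp_flow_equivalence[OF P Q limX limY])
qed

end
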